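(* Let $W:[0,1]\to\mathbb C$ be $(\sigma_*,2)$-Gevrey regular, $0<\sigma<\sigma_*$, and suppose $\mathcal L_s:\mathcal D^\sigma\to Y^\sigma$ is invertible at some $s_0\in\Omega_\sigma$. Fix $\delta>0$. Then there exist a neighbourhood $U\subset\Omega_\sigma$ of $s_0$ and a constant $C$ depending on $U,\delta,W$ such that for every $f\in Y^\sigma$ with support in $[\delta,1]$ and every $s\in U$, $\|\mathcal L_s^{-1}f\|_{H^2(I)}\le C\|f\|_{L^2(I)}$.
   Context: Let $I=(0,1)$. A function $u\in C^\infty(\overline I)$ is $(\sigma,k)$-Gevrey regular ($\sigma,k>0$) if there is $C>0$ with $\sup_{x\in I}|u^{(n)}(x)|\le C\sigma^{-n}(n!)^k$ for all $n\ge0$. For $\sigma>0$, $u\in C^\infty(\overline I)$, $k\in\{0,1,2\}$: $|u|^{0}_{\sigma,k,0}=\big(\sum_{n=0}^\infty\frac{\sigma^{2n}}{n!^2(n+1)!^2}n^{k}\int_0^1(x/\sigma)^k|\partial_x^nu|^2dx\big)^{1/2}$ (with $0^0:=1$), $\|u\|_{\sigma,0,0}=|u|^0_{\sigma,0,0}$, $[u]^0_\sigma=(\sum_{n=0}^\infty\frac{\sigma^{2n+1}}{n!^2(n+1)!^2}|u^{(n)}(0)|^2)^{1/2}$. $X^\sigma=\{u\in C^\infty(\overline I):u(1)=0,\ \|\partial_xu\|_{\sigma,0,0}+|\partial_xu|^0_{\sigma,1,0}+|\partial_xu|^0_{\sigma,2,0}+[\partial_xu]^0_\sigma<\infty\}$,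 $Y^\sigma=\{u\in C^\infty(\overline I):\|u\|_{\sigma,0,0}+|u|^0_{\sigma,1,0}+[u]^0_\sigma<\infty\}$. $\Omega^1_\sigma=\{s:\Re s\le0,\ \sigma<|\Im s|\}\cup\{s:\Re s>0,\ \sigma<|s|\}$; $\Omega^2_\sigma=\{s:\ \sigma<|s|+\Re s,\ \sigma>\frac{-\Re(s)|s|}{2(|s|+\Re s)}\}$; $\Omega^3_\sigma=\{s\neq0:\ \sigma(|s|-\sigma+\Re s)-(\sigma(1+\frac{\Re s}{|s|})+\frac12\Re s)^2>0\}$; $\Omega_\sigma=\Omega^1_\sigma\cap(\Omega^2_\sigma\cup\Omega^3_\sigma)$. $\mathcal L_su=\frac{d}{dx}(x^2\frac{du}{dx})+s\frac{du}{dx}-Wu$ and $\mathcal D^\sigma=\{u\in X^\sigma:\mathcal L_su\in Y^\sigma\}$. *)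

theory Defs
  imports "HOL-Analysis.Analysis"
begin

text \<open>Functions on the closed interval [0,1] are modelled as maps real => complex;
only their values on [0,1] matter. Derivatives are one-sided at the endpoints.\<close>

fun dn :: "nat \<Rightarrow> (real \<Rightarrow> complex) \<Rightarrow> real \<Rightarrow> complex" where
  "dn 0 u = u"
| "dn (Suc n) u = (\<lambda>x. vector_derivative (dn n u) (at x within {0..1}))"

definition smooth01 :: "(real \<Rightarrow> complex) \<Rightarrow> bool" where
  "smooth01 u \<longleftrightarrow> (\<forall>n. \<forall>x\<in>{0..1}. dn n u differentiable (at x within {0..1}))"

definition gevrey :: "real \<Rightarrow> real \<Rightarrow> (real \<Rightarrow> complex) \<Rightarrow> bool" where
  "gevrey \<sigma> k u \<longleftrightarrow> smooth01 u \<and>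
     (\<exists>C>0. \<forall>n. \<forall>x\<in>{0<..<1}. norm (dn n u x) \<le> C * \<sigma> powr (- real n) * (fact n) powr k)"

text \<open>n-th term of the square of the weighted norm |u|^0_{sigma,k,0}.\<close>
definition wterm :: "real \<Rightarrow> nat \<Rightarrow> (real \<Rightarrow> complex) \<Rightarrow> nat \<Rightarrow> real" where
  "wterm \<sigma> k u n = \<sigma> ^ (2*n) / ((fact n)^2 * (fact (n+1))^2) * (real n) ^ k *
     integral {0..1} (\<lambda>x. (x / \<sigma>) ^ k * (norm (dn n u x))^2)"

text \<open>n-th term of the square of the boundary norm [u]^0_sigma.\<close>
definition bterm :: "real \<Rightarrow> (real \<Rightarrow> complex) \<Rightarrow> nat \<Rightarrow> real" where
  "bterm \<sigma> u n = \<sigma> ^ (2*n+1) / ((fact n)^2 * (fact (n+1))^2) * (norm (dn n u 0))^2"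

definition Xsp :: "real \<Rightarrow> (real \<Rightarrow> complex) set" where
  "Xsp \<sigma> = {u. smooth01 u \<and> u 1 = 0 \<and>
     summable (wterm \<sigma> 0 (dn 1 u)) \<and> summable (wterm \<sigma> 1 (dn 1 u)) \<and>
     summable (wterm \<sigma> 2 (dn 1 u)) \<and> summable (bterm \<sigma> (dn 1 u))}"

definition Ysp :: "real \<Rightarrow> (real \<Rightarrow> complex) set" where
  "Ysp \<sigma> = {u. smooth01 u \<and>
     summable (wterm \<sigma> 0 u) \<and> summable (wterm \<sigma> 1 u) \<and> summable (bterm \<sigma> u)}"

definition Omega1 :: "real \<Rightarrow> complex set" where
  "Omega1 \<sigma> = {s. Re s \<le> 0 \<and> \<sigma> < \<bar>Im s\<bar>} \<union> {s. Re s > 0 \<and> \<sigma> < cmod s}"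

definition Omega2 :: "real \<Rightarrow> complex set" where
  "Omega2 \<sigma> = {s. \<sigma> < cmod s + Re s \<and> \<sigma> > - Re s * cmod s / (2 * (cmod s + Re s))}"

definition Omega3 :: "real \<Rightarrow> complex set" where
  "Omega3 \<sigma> = {s. s \<noteq> 0 \<and>
     \<sigma> * (cmod s - \<sigma> + Re s) - (\<sigma> * (1 + Re s / cmod s) + Re s / 2)^2 > 0}"

definition Omega :: "real \<Rightarrow> complex set" where
  "Omega \<sigma> = Omega1 \<sigma> \<inter> (Omega2 \<sigma> \<union> Omega3 \<sigma>)"

definition Lop :: "(real \<Rightarrow> complex) \<Rightarrow> complex \<Rightarrow> (real \<Rightarrow> complex) \<Rightarrow> real \<Rightarrow> complex" where
  "Lop W s u = (\<lambda>x. dn 1 (\<lambda>y. complex_of_real (y^2) * dn 1 u y) x + s * dn 1 u x - W x * u x)"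

definition Dom :: "(real \<Rightarrow> complex) \<Rightarrow> real \<Rightarrow> complex \<Rightarrow> (real \<Rightarrow> complex) set" where
  "Dom W \<sigma> s = {u \<in> Xsp \<sigma>. Lop W s u \<in> Ysp \<sigma>}"

definition Linvertible :: "(real \<Rightarrow> complex) \<Rightarrow> real \<Rightarrow> complex \<Rightarrow> bool" where
  "Linvertible W \<sigma> s \<longleftrightarrow>
     (\<forall>u\<in>Dom W \<sigma> s. \<forall>v\<in>Dom W \<sigma> s.
        (\<forall>x\<in>{0..1}. Lop W s u x = Lop W s v x) \<longrightarrow> (\<forall>x\<in>{0..1}. u x = v x)) \<and>
     (\<forall>f\<in>Ysp \<sigma>. \<exists>u\<in>Dom W \<sigma> s. \<forall>x\<in>{0..1}. Lop W s u x = f x)"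

definition L2norm :: "(real \<Rightarrow> complex) \<Rightarrow> real" where
  "L2norm f = sqrt (integral {0..1} (\<lambda>x. (norm (f x))^2))"

definition H2norm :: "(real \<Rightarrow> complex) \<Rightarrow> real" where
  "H2norm u = sqrt (integral {0..1} (\<lambda>x. (norm (u x))^2 + (norm (dn 1 u x))^2 + (norm (dn 2 u x))^2))"

end

theory Submission
  imports Defs "HOL-Real_Asymp.Real_Asymp"
begin

text \<open>
  Since \<open>u \<in> X\<close> forces \<open>u' \<in> Y\<close>, the domain does not depend on \<open>s\<close>, and \<open>L\<^sub>s\<close> is the perturbation
  of \<open>L\<close> at \<open>s0\<close> by \<open>(s - s0) d/dx\<close>. Completeness of \<open>X\<close> and \<open>Y\<close> makes the inverse at \<open>s0\<close> bounded
  from \<open>Y\<close> to \<open>X\<close>, so a Neumann series inverts \<open>L\<^sub>s\<close> near \<open>s0\<close> with a uniform bound.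

  For the estimate in \<open>L\<^sup>2\<close>, let \<open>f\<close> vanish near the origin and let \<open>z\<close> solve \<open>L\<^sub>s z = f\<close> with zero
  initial data there; this is a regular initial value problem, so \<open>z\<close> is controlled by the \<open>L\<^sup>2\<close> norm
  of \<open>f\<close>. The difference \<open>u - z\<close> solves the homogeneous equation, coincides with \<open>u\<close> near the origin and
  is Gevrey regular of order 2 away from it. As \<open>1 + w\<close>, where \<open>L\<^sub>s w = W\<close>, is another homogeneous
  solution of this regularity and does not vanish at \<open>1\<close>, injectivity gives \<open>u = z - z(1) (1 + w)\<close>.
\<close>

section \<open>Iterated one-sided derivatives\<close>

text \<open>The norm of Y involves all derivatives and is not controlled by the norm of
  \<open>L\<^sup>2\<close>, so the bound on the inverse from Y to X cannot be applied to
  \<open>f\<close>. It is applied to the single right-hand side \<open>W\<close>, where it bounds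
  \<open>w\<close>, \<open>w'\<close> and \<open>w''\<close> uniformly in \<open>s\<close>; all
  dependence on \<open>f\<close> passes through \<open>z\<close>. The function \<open>1 + w\<close>
  is homogeneous because the operator sends the constant 1 to \<open>- W\<close>, and its value 1 at
  the right endpoint is what allows the boundary value of \<open>z\<close> to be corrected. Gevrey
  order 2 fits the operator: away from the origin the differentiated equation determines the
  derivative of order \<open>n + 2\<close> with a power of \<open>n\<close> to spare, so the radius
  of \<open>W\<close> is inherited without loss, and \<open>\<sigma> < \<sigma>s\<close> makes the
  norms converge. Functions that agree on the interval remain distinct objects, so the norms are
  seminorms on sets of functions, and completeness and boundedness are argued with series that
  converge in seminorm.\<close>

declare dn.simps(2) [simp del]

lemma at_within_unit_interval_nontrivial:
  "x \<in> {0..1} \<Longrightarrow> at x within {0..1::real} \<noteq> bot"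
  by (auto simp: trivial_limit_within intro!: islimpt_closure_open[where s="{0<..<1::real}"])

lemma dn_has_derivative:
  assumes "smooth01 u" "x \<in> {0..1}"
  shows "(dn n u has_vector_derivative dn (Suc n) u x) (at x within {0..1})"
  using assms by (auto simp: smooth01_def dn.simps(2) vector_derivative_works[symmetric])

text \<open>One-sided derivatives are unique on the interval, so a tower \<open>g\<close> in which
  each member differentiates to the next yields smoothness and all \<open>dn n u\<close> at once.
  Closure under sums, multiples and limits is proved below by naming such a tower.\<close>

lemma dn_eqI:
  assumes "\<And>x. x \<in> {0..1} \<Longrightarrow> u x = g 0 x"
    and "\<And>n x. x \<in> {0..1} \<Longrightarrow> (g n has_vector_derivative g (Suc n) x) (at x within {0..1})"
  shows "smooth01 u" and "x \<in> {0..1} \<Longrightarrow> dn n u x = g n x"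
proof -
  have eq: "\<forall>x\<in>{0..1}. dn n u x = g n x" for n
  proof (induction n)
    case (Suc n)
    have "(dn n u has_vector_derivative g (Suc n) x) (at x within {0..1})" if "x \<in> {0..1}" for x
      by (rule has_vector_derivative_transform[OF that _ assms(2)[OF that]]) (use Suc in auto)
    then show ?case
      by (metis dn.simps(2) vector_derivative_within at_within_unit_interval_nontrivial)
  qed (use assms(1) in auto)
  show "x \<in> {0..1} \<Longrightarrow> dn n u x = g n x" using eq by auto
  show "smooth01 u"
    unfolding smooth01_def
  proof (intro allI ballI)
    fix n and x :: real assume x: "x \<in> {0..1}"
    have "(dn n u has_vector_derivative g (Suc n) x) (at x within {0..1})"
      by (rule has_vector_derivative_transform[OF x _ assms(2)[OF x]]) (use eq in auto)
    then show "dn n u differentiable (at x within {0..1})"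
      by (auto simp: differentiable_def has_vector_derivative_def)
  qed
qed

lemma smooth01_cong:
  assumes "smooth01 u" "\<And>x. x \<in> {0..1} \<Longrightarrow> u x = v x"
  shows "smooth01 v" and "x \<in> {0..1} \<Longrightarrow> dn n v x = dn n u x"
  by (rule dn_eqI[where g="\<lambda>n. dn n u"]; use assms dn_has_derivative in simp)+

text \<open>A derivative within the interval depends only on the germ. This later carries the
  regularity of the solution at the origin over to the homogeneous remainder.\<close>

lemma dn_local:
  assumes "open O'" "\<And>x. x \<in> {0..1} \<inter> O' \<Longrightarrow> u x = v x" "x \<in> {0..1} \<inter> O'"
  shows "dn n u x = dn n v x"
  using assms(3)
proof (induction n arbitrary: x)
  case (Suc n)
  have "eventually (\<lambda>y. y \<in> {0..1} \<longrightarrow> dn n u y = dn n v y) (nhds x)"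
    unfolding eventually_nhds by (rule exI[of _ O']) (use assms(1) Suc in auto)
  then have "vector_derivative (dn n u) (at x within {0..1}) = vector_derivative (dn n v) (at x within {0..1})"
    by (intro vector_derivative_cong_eq) (use Suc in auto)
  then show ?case by (simp add: dn.simps(2))
qed (use assms in auto)

section \<open>Linearity of the iterated derivatives\<close>

lemma
  assumes "smooth01 u" "smooth01 v"
  shows smooth01_add: "smooth01 (\<lambda>x. u x + v x)"
    and dn_add: "x \<in> {0..1} \<Longrightarrow> dn n (\<lambda>x. u x + v x) x = dn n u x + dn n v x"
  by (rule dn_eqI[where g="\<lambda>n x. dn n u x + dn n v x"];
      auto intro!: has_vector_derivative_add dn_has_derivative simp: assms)+

lemma
  assumes "smooth01 u" "smooth01 v"
  shows smooth01_diff: "smooth01 (\<lambda>x. u x - v x)"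
    and dn_diff: "x \<in> {0..1} \<Longrightarrow> dn n (\<lambda>x. u x - v x) x = dn n u x - dn n v x"
  by (rule dn_eqI[where g="\<lambda>n x. dn n u x - dn n v x"];
      auto intro!: has_vector_derivative_diff dn_has_derivative simp: assms)+

lemma
  assumes "smooth01 u"
  shows smooth01_cmult: "smooth01 (\<lambda>x. c * u x)"
    and dn_cmult: "x \<in> {0..1} \<Longrightarrow> dn n (\<lambda>x. c * u x) x = c * dn n u x"
  by (rule dn_eqI[where g="\<lambda>n x. c * dn n u x"];
      auto intro!: has_vector_derivative_mult_right dn_has_derivative simp: assms)+

lemma
  shows smooth01_const: "smooth01 (\<lambda>x. c)"
    and dn_const: "x \<in> {0..1} \<Longrightarrow> dn n (\<lambda>x. c) x = (if n = 0 then c else 0)"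
  by (rule dn_eqI[where g="\<lambda>n x. if n = 0 then c else 0"]; auto)+

lemma
  assumes "\<And>i. smooth01 (F i)"
  shows smooth01_sum: "smooth01 (\<lambda>x. \<Sum>i<(m::nat). F i x)"
    and dn_sum: "x \<in> {0..1} \<Longrightarrow> dn n (\<lambda>x. \<Sum>i<m. F i x) x = (\<Sum>i<m. dn n (F i) x)"
  by (rule dn_eqI[where g="\<lambda>n x. \<Sum>i<m. dn n (F i) x"];
      auto intro!: has_vector_derivative_sum dn_has_derivative simp: assms)+

lemma dn_dn: "dn n (dn k u) = dn (n + k) u"
  by (induction n) (auto simp: dn.simps(2))

lemma smooth01_dn: "smooth01 u \<Longrightarrow> smooth01 (dn k u)"
  by (auto simp: smooth01_def dn_dn)

lemma dn_continuous: "smooth01 u \<Longrightarrow> continuous_on {0..1} (dn n u)"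
  by (auto simp: smooth01_def intro!: differentiable_imp_continuous_on simp: differentiable_on_def)

lemma smooth01_continuous: "smooth01 u \<Longrightarrow> continuous_on {0..1} u"
  using dn_continuous[of u 0] by simp

section \<open>The operator in expanded form\<close>

lemma Lop_eq:
  assumes "smooth01 u" "x \<in> {0..1}"
  shows "Lop W s u x = of_real (x\<^sup>2) * dn 2 u x + (of_real (2*x) + s) * dn 1 u x - W x * u x"
proof -
  have "((\<lambda>y. complex_of_real (y^2) * dn 1 u y) has_vector_derivative
      of_real (x\<^sup>2) * dn 2 u x + of_real (2*x) * dn 1 u x) (at x within {0..1})"
  proof (rule has_vector_derivative_mult)
    show "((\<lambda>y. complex_of_real (y\<^sup>2)) has_vector_derivative complex_of_real (2 * x)) (at x within {0..1})"
      by (rule has_vector_derivative_of_real)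
         (auto intro!: derivative_eq_intros simp: has_real_derivative_iff_has_vector_derivative[symmetric])
    show "(dn 1 u has_vector_derivative dn 2 u x) (at x within {0..1})"
      using dn_has_derivative[OF assms, of 1] by (simp add: numeral_2_eq_2)
  qed
  from vector_derivative_within[OF at_within_unit_interval_nontrivial[OF assms(2)] this]
  show ?thesis unfolding Lop_def by (simp add: dn.simps(2) algebra_simps)
qed

lemma Lop_diff:
  "smooth01 u \<Longrightarrow> smooth01 v \<Longrightarrow> x \<in> {0..1} \<Longrightarrow>
    Lop W s (\<lambda>x. u x - v x) x = Lop W s u x - Lop W s v x"
  by (simp add: Lop_eq smooth01_diff dn_diff) (simp add: algebra_simps)

lemma Lop_cmult:
  "smooth01 u \<Longrightarrow> x \<in> {0..1} \<Longrightarrow> Lop W s (\<lambda>x. c * u x) x = c * Lop W s u x"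
  by (simp add: Lop_eq smooth01_cmult dn_cmult) (simp add: algebra_simps)

lemma Lop_sum:
  "(\<And>i. smooth01 (F i)) \<Longrightarrow> x \<in> {0..1} \<Longrightarrow>
    Lop W s (\<lambda>x. \<Sum>i<(m::nat). F i x) x = (\<Sum>i<m. Lop W s (F i) x)"
  by (simp add: Lop_eq smooth01_sum dn_sum sum.distrib sum_subtractf sum_distrib_left)

lemma Lop_shift:
  "smooth01 u \<Longrightarrow> x \<in> {0..1} \<Longrightarrow> Lop W s u x = Lop W t u x + (s - t) * dn 1 u x"
  by (simp add: Lop_eq algebra_simps)

section \<open>Elementary estimates\<close>

text \<open>Cauchy-Schwarz against the constant 1: integrate
  \<open>(g x - ?m)\<^sup>2 \<ge> 0\<close>, where \<open>?m\<close> is the mean of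
  \<open>g\<close>.\<close>

lemma integral_le_sqrt_integral_square:
  fixes g :: "real \<Rightarrow> real"
  assumes "continuous_on {0..1} g"
  shows "integral {0..1} g \<le> sqrt (integral {0..1} (\<lambda>x. (g x)\<^sup>2))"
proof -
  let ?m = "integral {0..1} g"
  have i: "g integrable_on {0..1}" "(\<lambda>x. (g x)\<^sup>2) integrable_on {0..1}"
    using assms by (auto intro!: integrable_continuous_real continuous_intros)
  have i2: "(\<lambda>x. 2 * ?m * g x - ?m\<^sup>2) integrable_on {0..1}"
    using assms by (intro integrable_continuous_real continuous_intros)
  have "integral {0..1} (\<lambda>x. 2 * ?m * g x - ?m\<^sup>2) \<le> integral {0..1} (\<lambda>x. (g x)\<^sup>2)"
  proof (rule integral_le[OF i2 i(2)])
    fix x show "2 * ?m * g x - ?m\<^sup>2 \<le> (g x)\<^sup>2"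
      using zero_le_power2[of "g x - ?m"] by (simp add: power2_diff algebra_simps)
  qed
  moreover have "integral {0..1} (\<lambda>x. 2 * ?m * g x - ?m\<^sup>2) = ?m\<^sup>2"
    using i(1) integrable_on_cmult_left[OF i(1), of "2 * ?m"]
    by (subst integral_diff) (auto simp: power2_eq_square)
  ultimately show ?thesis by (intro real_le_rsqrt) simp
qed

lemma norm_diff_le_integral:
  fixes g h :: "real \<Rightarrow> 'a::banach"
  assumes "\<And>x. x \<in> {0..1} \<Longrightarrow> (g has_vector_derivative h x) (at x within {0..1})"
    and "continuous_on {0..1} h" "x \<in> {0..1}" "y \<in> {0..1}"
  shows "norm (g x - g y) \<le> integral {0..1} (\<lambda>t. norm (h t))"
proof -
  have *: "norm (g b - g a) \<le> integral {0..1} (\<lambda>t. norm (h t))" if "0 \<le> a" "a \<le> b" "b \<le> 1" for a b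
  proof -
    have "(h has_integral g b - g a) {a..b}"
      using that by (intro fundamental_theorem_of_calculus has_vector_derivative_within_subset[OF assms(1)]) auto
    moreover have c: "continuous_on {a..b} h" using assms(2) by (rule continuous_on_subset) (use that in auto)
    ultimately have "norm (g b - g a) \<le> integral {a..b} (\<lambda>t. norm (h t))"
      by (metis integral_unique integral_norm_bound_integral integrable_continuous_real
          continuous_on_norm order_refl)
    also have "\<dots> \<le> integral {0..1} (\<lambda>t. norm (h t))"
      using that c assms(2)
      by (intro integral_subset_le) (auto intro!: integrable_continuous_real continuous_intros)
    finally show ?thesis .
  qed
  show ?thesis
    using *[of x y] *[of y x] assms(3,4) by (cases "x \<le> y") (auto simp: norm_minus_commute)
qed

text \<open>One-dimensional Sobolev embedding: \<open>norm_diff_le_integral\<close> is averaged over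
  the base point \<open>y\<close>.\<close>

lemma norm_le_integrals:
  fixes g h :: "real \<Rightarrow> 'a::banach"
  assumes "\<And>x. x \<in> {0..1} \<Longrightarrow> (g has_vector_derivative h x) (at x within {0..1})"
    and "continuous_on {0..1} h" "x \<in> {0..1}"
  shows "norm (g x) \<le> integral {0..1} (\<lambda>t. norm (g t)) + integral {0..1} (\<lambda>t. norm (h t))"
proof -
  have cg: "continuous_on {0..1} g"
    using assms(1) has_vector_derivative_continuous by (fastforce simp: continuous_on_eq_continuous_within)
  have "integral {0..1} (\<lambda>y::real. norm (g x)) \<le> integral {0..1} (\<lambda>y. norm (g y) + integral {0..1} (\<lambda>t. norm (h t)))"
  proof (rule integral_le)
    fix y :: real assume "y \<in> {0..1}"
    then have "norm (g x - g y) \<le> integral {0..1} (\<lambda>t. norm (h t))"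
      using assms by (intro norm_diff_le_integral) auto
    then show "norm (g x) \<le> norm (g y) + integral {0..1} (\<lambda>t. norm (h t))"
      using norm_triangle_sub[of "g x" "g y"] by linarith
  qed (use cg in \<open>auto intro!: integrable_continuous_real continuous_intros\<close>)
  also have "\<dots> = integral {0..1} (\<lambda>t. norm (g t)) + integral {0..1} (\<lambda>t. norm (h t))"
    using cg by (subst integral_add) (auto intro!: integrable_continuous_real continuous_intros)
  finally show ?thesis by simp
qed

text \<open>Convexity of the square with the weight \<open>t\<close> left free. Minimising over
  \<open>t\<close> would recover \<open>(norm a + norm b)\<^sup>2\<close>, so nothing is lost if
  \<open>t\<close> is chosen only after integration and summation.\<close>

lemma norm_add_square_le:
  fixes a b :: "'a::real_normed_vector"
  assumes "0 < t" "t < 1"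
  shows "(norm (a + b))\<^sup>2 \<le> (norm a)\<^sup>2 / t + (norm b)\<^sup>2 / (1 - t)"
proof -
  have "(norm (a + b))\<^sup>2 \<le> (norm a + norm b)\<^sup>2"
    by (intro power_mono norm_triangle_ineq) auto
  also have "\<dots> \<le> (norm a)\<^sup>2 / t + (norm b)\<^sup>2 / (1 - t)"
  proof -
    have "0 \<le> ((1 - t) * norm a - t * norm b)\<^sup>2 / (t * (1 - t))" using assms by simp
    also have "\<dots> = (norm a)\<^sup>2 / t + (norm b)\<^sup>2 / (1 - t) - (norm a + norm b)\<^sup>2"
      using assms by (simp add: field_simps power2_eq_square)
    finally show ?thesis by simp
  qed
  finally show ?thesis .
qed

text \<open>The optimal weight is \<open>t = sqrt a / (sqrt a + sqrt b)\<close>. Combined with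
  \<open>norm_add_square_le\<close> this gives Minkowski's inequality with one \<open>t\<close>
  serving all terms.\<close>

lemma sqrt_triangle_of_convex_bound:
  assumes "0 \<le> a" "0 \<le> b" "0 \<le> c"
    and "\<And>t. 0 < t \<Longrightarrow> t < 1 \<Longrightarrow> c \<le> a / t + b / (1 - t)"
  shows "sqrt c \<le> sqrt a + sqrt b"
proof -
  \<comment> \<open>Both roots are shifted by \<open>e\<close> so that the weight stays strictly
    between 0 and 1 even if \<open>a\<close> or \<open>b\<close> vanishes.\<close>
  have "sqrt c \<le> sqrt a + sqrt b + 2 * e" if e: "e > 0" for e :: real
  proof -
    let ?p = "sqrt a + e" and ?q = "sqrt b + e"
    have pq: "?p > 0" "?q > 0" "a \<le> ?p\<^sup>2" "b \<le> ?q\<^sup>2"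
      using assms e by (auto simp: power2_sum add_nonneg_pos)
    have "c \<le> a / (?p / (?p + ?q)) + b / (1 - ?p / (?p + ?q))"
      using pq by (intro assms(4)) (auto simp: field_simps)
    also have "1 - ?p / (?p + ?q) = ?q / (?p + ?q)" using pq by (simp add: field_simps)
    also have "a / (?p / (?p + ?q)) + b / (?q / (?p + ?q)) \<le> ?p\<^sup>2 / (?p / (?p + ?q)) + ?q\<^sup>2 / (?q / (?p + ?q))"
      using pq by (intro add_mono divide_right_mono) auto
    also have "\<dots> = (?p + ?q)\<^sup>2"
      using pq(1,2) by (simp add: power2_eq_square) (simp add: algebra_simps)
    finally show ?thesis using pq by (intro real_le_lsqrt) (auto simp: algebra_simps)
  qed
  then show ?thesis
    by (metis field_le_epsilon field_sum_of_halves half_gt_zero mult_2)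
qed

section \<open>The weighted energy norms\<close>

definition gcoef :: "real \<Rightarrow> nat \<Rightarrow> real" where
  "gcoef \<sigma> n = \<sigma> ^ (2*n) / ((fact n)^2 * (fact (n+1))^2)"

text \<open>The weights of \<open>wterm\<close> for the exponents 0, 1 and 2 are merged, so that
  each level of the norm needs a single integral.\<close>

definition wgt :: "real \<Rightarrow> real \<Rightarrow> nat \<Rightarrow> real \<Rightarrow> real" where
  "wgt j \<sigma> n x = gcoef \<sigma> n * (1 + real n * (x / \<sigma>) + j * (real n)\<^sup>2 * (x / \<sigma>)\<^sup>2)"

text \<open>The \<open>n\<close>-th term of the square of the norm; \<open>j = 0\<close> gives the space \<open>Y\<close>, and \<open>j = 1\<close>
  gives the norm imposed on the derivative of a member of \<open>X\<close>.\<close>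
definition eterm :: "real \<Rightarrow> real \<Rightarrow> (real \<Rightarrow> complex) \<Rightarrow> nat \<Rightarrow> real" where
  "eterm j \<sigma> f n = integral {0..1} (\<lambda>x. wgt j \<sigma> n x * (norm (dn n f x))\<^sup>2) +
     gcoef \<sigma> n * \<sigma> * (norm (dn n f 0))\<^sup>2"

definition Esp :: "real \<Rightarrow> real \<Rightarrow> (real \<Rightarrow> complex) set" where
  "Esp j \<sigma> = {f. smooth01 f \<and> summable (eterm j \<sigma> f)}"

definition Enorm :: "real \<Rightarrow> real \<Rightarrow> (real \<Rightarrow> complex) \<Rightarrow> real" where
  "Enorm j \<sigma> f = sqrt (suminf (eterm j \<sigma> f))"

text \<open>Supremum of the weight over the interval (attained at 1) plus the point mass of the
  boundary term.\<close>

definition ebound :: "real \<Rightarrow> real \<Rightarrow> nat \<Rightarrow> real" where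
  "ebound j \<sigma> n = gcoef \<sigma> n * (1 + real n / \<sigma> + j * (real n)\<^sup>2 / \<sigma>\<^sup>2 + \<sigma>)"

text \<open>Embedding constant: a value of the derivative of order \<open>n\<close> is bounded by
  the mean sizes of orders \<open>n\<close> and \<open>n + 1\<close>, each of which the energy norm
  controls up to the root of its coefficient.\<close>

definition sob :: "real \<Rightarrow> nat \<Rightarrow> real" where
  "sob \<sigma> n = 1 / sqrt (gcoef \<sigma> n) + 1 / sqrt (gcoef \<sigma> (Suc n))"

lemma continuous_wgt: "continuous_on S (wgt j \<sigma> n)"
proof (cases "\<sigma> = 0")
  case True then show ?thesis unfolding wgt_def by (simp add: continuous_on_const)
next
  case False then show ?thesis unfolding wgt_def by (intro continuous_intros) auto
qed

lemma integrable_wgt_norm: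
  assumes "smooth01 f"
  shows "(\<lambda>x. wgt j \<sigma> n x * (norm (dn n f x))\<^sup>2) integrable_on {0..1}"
  by (intro integrable_continuous_real continuous_intros continuous_wgt dn_continuous assms)

lemma integrable_norm_dn:
  assumes "smooth01 f"
  shows "(\<lambda>x. (norm (dn n f x))\<^sup>2) integrable_on {0..1}"
  by (intro integrable_continuous_real continuous_intros dn_continuous assms)

lemma eterm_eq_wterm:
  assumes "smooth01 f" "\<sigma> > 0"
  shows "eterm j \<sigma> f n = wterm \<sigma> 0 f n + wterm \<sigma> 1 f n + j * wterm \<sigma> 2 f n + bterm \<sigma> f n"
proof -
  have i: "(\<lambda>x. c * ((x / \<sigma>)^k * (norm (dn n f x))\<^sup>2)) integrable_on {0..1}" for c k
    using assms by (intro integrable_continuous_real continuous_intros dn_continuous) auto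
  have "integral {0..1} (\<lambda>x. wgt j \<sigma> n x * (norm (dn n f x))\<^sup>2) =
    integral {0..1} (\<lambda>x. gcoef \<sigma> n * ((x / \<sigma>)^0 * (norm (dn n f x))\<^sup>2) +
      gcoef \<sigma> n * real n * ((x / \<sigma>)^1 * (norm (dn n f x))\<^sup>2) +
      gcoef \<sigma> n * j * (real n)\<^sup>2 * ((x / \<sigma>)^2 * (norm (dn n f x))\<^sup>2))"
    by (intro integral_cong) (simp add: wgt_def algebra_simps)
  also have "\<dots> = wterm \<sigma> 0 f n + wterm \<sigma> 1 f n + j * wterm \<sigma> 2 f n"
    by (subst integral_add integral_mult_right, (intro i integrable_add)+)+
       (simp add: wterm_def gcoef_def)
  finally show ?thesis
    by (simp add: eterm_def bterm_def gcoef_def)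
qed

section \<open>Minkowski's inequality and pointwise control for the energy norms\<close>

context
  fixes j \<sigma> :: real
  assumes j: "j \<ge> 0" and \<sigma>: "\<sigma> > 0"
begin

lemma gcoef_pos: "gcoef \<sigma> n > 0"
  using \<sigma> by (simp add: gcoef_def)

lemma wgt_ge: "x \<in> {0..1} \<Longrightarrow> wgt j \<sigma> n x \<ge> gcoef \<sigma> n"
  unfolding wgt_def using gcoef_pos[of n] j \<sigma> by (simp add: mult_le_cancel_left1)

lemma wgt_nonneg: "x \<in> {0..1} \<Longrightarrow> wgt j \<sigma> n x \<ge> 0"
  using wgt_ge[of x n] gcoef_pos[of n] by linarith

lemma wgt_le:
  assumes "x \<in> {0..1}"
  shows "wgt j \<sigma> n x \<le> gcoef \<sigma> n * (1 + real n / \<sigma> + j * (real n)\<^sup>2 / \<sigma>\<^sup>2)"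
proof -
  have "real n * (x / \<sigma>) \<le> real n * (1 / \<sigma>)" "j * (real n)\<^sup>2 * (x / \<sigma>)\<^sup>2 \<le> j * (real n)\<^sup>2 * (1 / \<sigma>)\<^sup>2"
    using assms \<sigma> j by (intro mult_left_mono power_mono divide_right_mono; simp)+
  then show ?thesis
    unfolding wgt_def using gcoef_pos[of n] by (intro mult_left_mono) (auto simp: power_divide)
qed

lemma eterm_nonneg: "smooth01 f \<Longrightarrow> eterm j \<sigma> f n \<ge> 0"
  unfolding eterm_def using gcoef_pos[of n] \<sigma>
  by (intro add_nonneg_nonneg integral_nonneg integrable_wgt_norm mult_nonneg_nonneg wgt_nonneg) auto

lemma eterm_add:
  assumes f: "smooth01 f" and g: "smooth01 g" and t: "0 < t" "t < 1"
  shows "eterm j \<sigma> (\<lambda>x. f x + g x) n \<le> eterm j \<sigma> f n / t + eterm j \<sigma> g n / (1 - t)"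
proof -
  let ?h = "\<lambda>x. f x + g x"
  let ?I = "\<lambda>f. integral {0..1} (\<lambda>x. wgt j \<sigma> n x * (norm (dn n f x))\<^sup>2)"
  have i: "(\<lambda>x. wgt j \<sigma> n x * (norm (dn n f x))\<^sup>2 / t) integrable_on {0..1}"
    "(\<lambda>x. wgt j \<sigma> n x * (norm (dn n g x))\<^sup>2 / (1 - t)) integrable_on {0..1}"
    by (intro integrable_on_divide integrable_wgt_norm f g)+
  have "?I ?h \<le> integral {0..1} (\<lambda>x. wgt j \<sigma> n x * (norm (dn n f x))\<^sup>2 / t + wgt j \<sigma> n x * (norm (dn n g x))\<^sup>2 / (1 - t))"
  proof (rule integral_le)
    fix x :: real assume x: "x \<in> {0..1}"
    have "wgt j \<sigma> n x * (norm (dn n f x + dn n g x))\<^sup>2 \<le>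
        wgt j \<sigma> n x * ((norm (dn n f x))\<^sup>2 / t + (norm (dn n g x))\<^sup>2 / (1 - t))"
      by (intro mult_left_mono norm_add_square_le t wgt_nonneg x)
    then show "wgt j \<sigma> n x * (norm (dn n ?h x))\<^sup>2 \<le> wgt j \<sigma> n x * (norm (dn n f x))\<^sup>2 / t + wgt j \<sigma> n x * (norm (dn n g x))\<^sup>2 / (1 - t)"
      using x f g by (simp add: dn_add algebra_simps)
  qed (intro integrable_add i integrable_wgt_norm smooth01_add f g)+
  also have "\<dots> = ?I f / t + ?I g / (1 - t)"
    by (subst integral_add[OF i]) simp
  finally have 1: "?I ?h \<le> ?I f / t + ?I g / (1 - t)" .
  have "gcoef \<sigma> n * \<sigma> * (norm (dn n f 0 + dn n g 0))\<^sup>2 \<le>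
      gcoef \<sigma> n * \<sigma> * ((norm (dn n f 0))\<^sup>2 / t + (norm (dn n g 0))\<^sup>2 / (1 - t))"
    using \<sigma> gcoef_pos[of n] by (intro mult_left_mono norm_add_square_le t) auto
  then show ?thesis
    unfolding eterm_def using 1 f g by (simp add: dn_add add_divide_distrib distrib_left)
qed

lemma eterm_cmult:
  assumes f: "smooth01 f"
  shows "eterm j \<sigma> (\<lambda>x. c * f x) n = (norm c)\<^sup>2 * eterm j \<sigma> f n"
proof -
  have "integral {0..1} (\<lambda>x. wgt j \<sigma> n x * (norm (dn n (\<lambda>x. c * f x) x))\<^sup>2) =
     integral {0..1} (\<lambda>x. (norm c)\<^sup>2 * (wgt j \<sigma> n x * (norm (dn n f x))\<^sup>2))"
    by (intro integral_cong) (simp add: dn_cmult f norm_mult power_mult_distrib)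
  also have "\<dots> = (norm c)\<^sup>2 * integral {0..1} (\<lambda>x. wgt j \<sigma> n x * (norm (dn n f x))\<^sup>2)"
    by simp
  finally show ?thesis
    unfolding eterm_def by (simp add: dn_cmult f norm_mult power_mult_distrib algebra_simps)
qed

text \<open>\<open>ebound\<close> dominates the total mass of the weight. The additive error lets
  \<open>v\<close> be compared with \<open>u\<close> on one part of the interval and with an
  explicit bound on the other.\<close>

lemma eterm_le:
  assumes u: "smooth01 u" and v: "smooth01 v"
    and le: "\<And>x. x \<in> {0..1} \<Longrightarrow> (norm (dn n v x))\<^sup>2 \<le> (norm (dn n u x))\<^sup>2 + B\<^sup>2"
  shows "eterm j \<sigma> v n \<le> eterm j \<sigma> u n + ebound j \<sigma> n * B\<^sup>2"
proof -
  let ?c = "gcoef \<sigma> n * (1 + real n / \<sigma> + j * (real n)\<^sup>2 / \<sigma>\<^sup>2)"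
  have "integral {0..1} (\<lambda>x. wgt j \<sigma> n x * (norm (dn n v x))\<^sup>2) \<le>
      integral {0..1} (\<lambda>x. wgt j \<sigma> n x * (norm (dn n u x))\<^sup>2 + ?c * B\<^sup>2)"
  proof (rule integral_le)
    fix x :: real assume x: "x \<in> {0..1}"
    have "wgt j \<sigma> n x * (norm (dn n v x))\<^sup>2 \<le> wgt j \<sigma> n x * ((norm (dn n u x))\<^sup>2 + B\<^sup>2)"
      by (intro mult_left_mono le wgt_nonneg x)
    also have "\<dots> \<le> wgt j \<sigma> n x * (norm (dn n u x))\<^sup>2 + ?c * B\<^sup>2"
      using mult_right_mono[OF wgt_le[OF x], of "B\<^sup>2" n] by (simp add: distrib_left)
    finally show "wgt j \<sigma> n x * (norm (dn n v x))\<^sup>2 \<le> wgt j \<sigma> n x * (norm (dn n u x))\<^sup>2 + ?c * B\<^sup>2" .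
  qed (intro integrable_add integrable_wgt_norm u v integrable_const_ivl)+
  also have "\<dots> = integral {0..1} (\<lambda>x. wgt j \<sigma> n x * (norm (dn n u x))\<^sup>2) + ?c * B\<^sup>2"
    by (subst integral_add) (auto intro: integrable_wgt_norm u)
  moreover have "gcoef \<sigma> n * \<sigma> * (norm (dn n v 0))\<^sup>2 \<le> gcoef \<sigma> n * \<sigma> * ((norm (dn n u 0))\<^sup>2 + B\<^sup>2)"
    using \<sigma> gcoef_pos[of n] by (intro mult_left_mono le) auto
  ultimately show ?thesis
    unfolding eterm_def ebound_def by (simp add: algebra_simps)
qed

lemma eterm_cong:
  assumes "smooth01 f" "\<And>x. x \<in> {0..1} \<Longrightarrow> f x = g x"
  shows "eterm j \<sigma> g n = eterm j \<sigma> f n"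
proof -
  have "integral {0..1} (\<lambda>x. wgt j \<sigma> n x * (norm (dn n g x))\<^sup>2) = integral {0..1} (\<lambda>x. wgt j \<sigma> n x * (norm (dn n f x))\<^sup>2)"
    by (rule integral_cong) (use smooth01_cong(2)[OF assms] in auto)
  then show ?thesis unfolding eterm_def using smooth01_cong(2)[OF assms] by simp
qed

lemma Esp_smooth: "f \<in> Esp j \<sigma> \<Longrightarrow> smooth01 f"
  by (simp add: Esp_def)

lemma Esp_cong:
  assumes "f \<in> Esp j \<sigma>" "\<And>x. x \<in> {0..1} \<Longrightarrow> f x = g x"
  shows "g \<in> Esp j \<sigma>" "Enorm j \<sigma> g = Enorm j \<sigma> f"
proof -
  have "eterm j \<sigma> g = eterm j \<sigma> f"
    using eterm_cong[OF Esp_smooth[OF assms(1)] assms(2)] by auto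
  then show "g \<in> Esp j \<sigma>" "Enorm j \<sigma> g = Enorm j \<sigma> f"
    using assms smooth01_cong(1)[OF Esp_smooth[OF assms(1)] assms(2)] by (auto simp: Esp_def Enorm_def)
qed

text \<open>The weight \<open>t = 1/2\<close> gives summability; keeping \<open>t\<close> free until
  the series has been summed then gives the triangle inequality with constant 1.\<close>

lemma
  assumes f: "f \<in> Esp j \<sigma>" and g: "g \<in> Esp j \<sigma>"
  shows Esp_add: "(\<lambda>x. f x + g x) \<in> Esp j \<sigma>"
    and Enorm_add: "Enorm j \<sigma> (\<lambda>x. f x + g x) \<le> Enorm j \<sigma> f + Enorm j \<sigma> g"
proof -
  have s: "smooth01 f" "smooth01 g" and su: "summable (eterm j \<sigma> f)" "summable (eterm j \<sigma> g)"
    using f g by (auto simp: Esp_def)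
  note le = eterm_add[OF s]
  note sh = smooth01_add[OF s]
  have suh: "summable (eterm j \<sigma> (\<lambda>x. f x + g x))"
  proof (rule summable_comparison_test')
    show "summable (\<lambda>n. eterm j \<sigma> f n / (1/2) + eterm j \<sigma> g n / (1 - 1/2))"
      by (intro summable_add summable_divide su)
    show "norm (eterm j \<sigma> (\<lambda>x. f x + g x) n) \<le> eterm j \<sigma> f n / (1/2) + eterm j \<sigma> g n / (1 - 1/2)" for n
      using le[of "1/2" n] eterm_nonneg[OF sh, of n] by simp
  qed
  then show "(\<lambda>x. f x + g x) \<in> Esp j \<sigma>" using sh by (simp add: Esp_def)
  show "Enorm j \<sigma> (\<lambda>x. f x + g x) \<le> Enorm j \<sigma> f + Enorm j \<sigma> g"
    unfolding Enorm_def
  proof (rule sqrt_triangle_of_convex_bound)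
    fix t :: real assume t: "0 < t" "t < 1"
    have "suminf (eterm j \<sigma> (\<lambda>x. f x + g x)) \<le> (\<Sum>n. eterm j \<sigma> f n / t + eterm j \<sigma> g n / (1 - t))"
      by (intro suminf_le suh summable_add summable_divide su le t)
    also have "\<dots> = suminf (eterm j \<sigma> f) / t + suminf (eterm j \<sigma> g) / (1 - t)"
      by (subst suminf_add[symmetric]) (auto intro!: summable_divide su simp: suminf_divide su)
    finally show "suminf (eterm j \<sigma> (\<lambda>x. f x + g x)) \<le> suminf (eterm j \<sigma> f) / t + suminf (eterm j \<sigma> g) / (1 - t)" .
  qed (intro suminf_nonneg su suh eterm_nonneg s sh)+
qed

lemma
  assumes f: "f \<in> Esp j \<sigma>"
  shows Esp_cmult: "(\<lambda>x. c * f x) \<in> Esp j \<sigma>"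
    and Enorm_cmult: "Enorm j \<sigma> (\<lambda>x. c * f x) = norm c * Enorm j \<sigma> f"
proof -
  have s: "smooth01 f" and su: "summable (eterm j \<sigma> f)"
    using f by (auto simp: Esp_def)
  have eq: "eterm j \<sigma> (\<lambda>x. c * f x) = (\<lambda>n. (norm c)\<^sup>2 * eterm j \<sigma> f n)"
    using eterm_cmult[OF s] by auto
  show "(\<lambda>x. c * f x) \<in> Esp j \<sigma>"
    using su s summable_mult[OF su] by (auto simp: Esp_def eq smooth01_cmult)
  show "Enorm j \<sigma> (\<lambda>x. c * f x) = norm c * Enorm j \<sigma> f"
    unfolding Enorm_def eq by (simp add: suminf_mult su real_sqrt_mult)
qed

lemma
  assumes f: "f \<in> Esp j \<sigma>" and g: "g \<in> Esp j \<sigma>"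
  shows Esp_diff: "(\<lambda>x. f x - g x) \<in> Esp j \<sigma>"
    and Enorm_diff: "Enorm j \<sigma> (\<lambda>x. f x - g x) \<le> Enorm j \<sigma> f + Enorm j \<sigma> g"
  using Esp_add[OF f Esp_cmult[OF g, of "-1"]] Enorm_add[OF f Esp_cmult[OF g, of "-1"]]
    Enorm_cmult[OF g, of "-1"] by simp_all

lemma Enorm_nonneg: "f \<in> Esp j \<sigma> \<Longrightarrow> Enorm j \<sigma> f \<ge> 0"
  unfolding Enorm_def Esp_def by (auto intro!: suminf_nonneg eterm_nonneg)

lemma Esp_zero: "(\<lambda>x. 0) \<in> Esp j \<sigma>" and Enorm_zero: "Enorm j \<sigma> (\<lambda>x. 0) = 0"
proof -
  have "eterm j \<sigma> (\<lambda>x. 0) n = 0" for n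
    using eterm_cmult[OF smooth01_const[of 0], of 0 n] by simp
  then have "eterm j \<sigma> (\<lambda>x. 0) = (\<lambda>n. 0)" by auto
  then show "(\<lambda>x. 0) \<in> Esp j \<sigma>" "Enorm j \<sigma> (\<lambda>x. 0) = 0"
    by (auto simp: Esp_def Enorm_def smooth01_const)
qed

lemma
  fixes F :: "nat \<Rightarrow> real \<Rightarrow> complex"
  assumes "\<And>i. F i \<in> Esp j \<sigma>"
  shows Esp_sum: "(\<lambda>x. \<Sum>i<m. F i x) \<in> Esp j \<sigma>"
    and Enorm_sum: "Enorm j \<sigma> (\<lambda>x. \<Sum>i<m. F i x) \<le> (\<Sum>i<m. Enorm j \<sigma> (F i))"
proof -
  have "(\<lambda>x. \<Sum>i<m. F i x) \<in> Esp j \<sigma> \<and> Enorm j \<sigma> (\<lambda>x. \<Sum>i<m. F i x) \<le> (\<Sum>i<m. Enorm j \<sigma> (F i))"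
  proof (induction m)
    case (Suc m)
    then show ?case
      using Esp_add[OF _ assms, of "\<lambda>x. \<Sum>i<m. F i x" m] Enorm_add[OF _ assms, of "\<lambda>x. \<Sum>i<m. F i x" m] by simp
  qed (simp add: Esp_zero Enorm_zero)
  then show "(\<lambda>x. \<Sum>i<m. F i x) \<in> Esp j \<sigma>"
    "Enorm j \<sigma> (\<lambda>x. \<Sum>i<m. F i x) \<le> (\<Sum>i<m. Enorm j \<sigma> (F i))" by auto
qed

lemma integral_norm_dn_le:
  assumes "f \<in> Esp j \<sigma>"
  shows "integral {0..1} (\<lambda>x. (norm (dn n f x))\<^sup>2) \<le> (Enorm j \<sigma> f)\<^sup>2 / gcoef \<sigma> n"
proof -
  have s: "smooth01 f" using assms by (simp add: Esp_def)
  have "gcoef \<sigma> n * integral {0..1} (\<lambda>x. (norm (dn n f x))\<^sup>2) = integral {0..1} (\<lambda>x. gcoef \<sigma> n * (norm (dn n f x))\<^sup>2)"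
    by simp
  also have "\<dots> \<le> integral {0..1} (\<lambda>x. wgt j \<sigma> n x * (norm (dn n f x))\<^sup>2)"
    using integrable_on_cmult_left[OF integrable_norm_dn[OF s], of "gcoef \<sigma> n" n]
    by (intro integral_le integrable_wgt_norm s mult_right_mono wgt_ge) auto
  also have "\<dots> \<le> eterm j \<sigma> f n"
    unfolding eterm_def using gcoef_pos[of n] \<sigma> by simp
  also have "\<dots> \<le> suminf (eterm j \<sigma> f)"
    using sum_le_suminf[of "eterm j \<sigma> f" "{n}"] assms eterm_nonneg[OF s] by (auto simp: Esp_def)
  also have "\<dots> = (Enorm j \<sigma> f)\<^sup>2"
    unfolding Enorm_def using assms eterm_nonneg[OF s] by (auto simp: Esp_def suminf_nonneg)
  finally show ?thesis using gcoef_pos[of n] by (simp add: field_simps)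
qed

lemma sob_nonneg: "sob \<sigma> n \<ge> 0"
  unfolding sob_def using gcoef_pos[of n] gcoef_pos[of "Suc n"] by simp

lemma norm_dn_le_Enorm:
  assumes "f \<in> Esp j \<sigma>" "x \<in> {0..1}"
  shows "norm (dn n f x) \<le> sob \<sigma> n * Enorm j \<sigma> f"
proof -
  have s: "smooth01 f" using assms by (simp add: Esp_def)
  have *: "integral {0..1} (\<lambda>x. norm (dn n f x)) \<le> Enorm j \<sigma> f / sqrt (gcoef \<sigma> n)" for n
  proof -
    have "integral {0..1} (\<lambda>x. norm (dn n f x)) \<le> sqrt (integral {0..1} (\<lambda>x. (norm (dn n f x))\<^sup>2))"
      by (intro integral_le_sqrt_integral_square continuous_intros dn_continuous s)
    also have "\<dots> \<le> sqrt ((Enorm j \<sigma> f)\<^sup>2 / gcoef \<sigma> n)"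
      using integral_norm_dn_le[OF assms(1)] by simp
    also have "\<dots> = Enorm j \<sigma> f / sqrt (gcoef \<sigma> n)"
      using Enorm_nonneg[OF assms(1)] by (simp add: real_sqrt_divide)
    finally show ?thesis .
  qed
  have "norm (dn n f x) \<le> integral {0..1} (\<lambda>t. norm (dn n f t)) + integral {0..1} (\<lambda>t. norm (dn (Suc n) f t))"
    using dn_has_derivative[OF s] dn_continuous[OF s] assms by (intro norm_le_integrals) auto
  also have "\<dots> \<le> sob \<sigma> n * Enorm j \<sigma> f"
    using *[of n] *[of "Suc n"] unfolding sob_def by (simp add: algebra_simps)
  finally show ?thesis .
qed

end

section \<open>Completeness of the energy spaces\<close>

lemma suminf_tail_tendsto_0:
  fixes a :: "nat \<Rightarrow> real"
  assumes "summable a"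
  shows "(\<lambda>m. \<Sum>i. a (i + m)) \<longlonglongrightarrow> 0"
proof -
  have "(\<lambda>m. suminf a - sum a {..<m}) \<longlonglongrightarrow> suminf a - suminf a"
    using assms by (intro tendsto_intros summable_LIMSEQ)
  then show ?thesis using assms by (simp add: suminf_minus_initial_segment)
qed

text \<open>Termwise differentiation; the rate \<open>r\<close>, independent of the point, encodes
  uniform convergence of the differentiated series.\<close>

lemma has_vector_derivative_suminf:
  fixes f f' :: "nat \<Rightarrow> real \<Rightarrow> 'a::banach"
  assumes "convex S"
    and der: "\<And>i x. x \<in> S \<Longrightarrow> (f i has_vector_derivative f' i x) (at x within S)"
    and tail: "\<And>m x. x \<in> S \<Longrightarrow> norm ((\<Sum>i<m. f' i x) - (\<Sum>i. f' i x)) \<le> r m" and "r \<longlonglongrightarrow> 0"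
    and summ: "\<And>x. x \<in> S \<Longrightarrow> summable (\<lambda>i. f i x)"
    and x: "x \<in> S"
  shows "((\<lambda>x. \<Sum>i. f i x) has_vector_derivative (\<Sum>i. f' i x)) (at x within S)"
proof -
  have "\<exists>g. \<forall>x\<in>S. (\<lambda>i. f i x) sums g x \<and> (g has_derivative (\<lambda>h. h *\<^sub>R (\<Sum>i. f' i x))) (at x within S)"
  proof (rule has_derivative_series)
    show "convex S" "x \<in> S" by fact+
    show "(f i has_derivative (\<lambda>h. h *\<^sub>R f' i x)) (at x within S)" if "x \<in> S" for i x
      using der[OF that] by (simp add: has_vector_derivative_def)
    show "(\<lambda>i. f i x) sums suminf (\<lambda>i. f i x)" using summ[OF x] by (rule summable_sums)
    fix e :: real assume "e > 0"
    then have "\<forall>\<^sub>F m in sequentially. r m < e"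
      using \<open>r \<longlonglongrightarrow> 0\<close> by (simp add: order_tendstoD)
    then show "\<forall>\<^sub>F m in sequentially. \<forall>x\<in>S. \<forall>h. norm ((\<Sum>i<m. h *\<^sub>R f' i x) - h *\<^sub>R (\<Sum>i. f' i x)) \<le> e * norm h"
    proof eventually_elim
      case (elim m)
      show ?case
      proof (intro ballI allI)
        fix x h assume "x \<in> S"
        then have "norm ((\<Sum>i<m. f' i x) - (\<Sum>i. f' i x)) \<le> e" using tail[of x m] elim by linarith
        then show "norm ((\<Sum>i<m. h *\<^sub>R f' i x) - h *\<^sub>R (\<Sum>i. f' i x)) \<le> e * norm h"
          using mult_right_mono[of "norm ((\<Sum>i<m. f' i x) - (\<Sum>i. f' i x))" e "\<bar>h\<bar>"]
          by (simp add: scaleR_sum_right[symmetric] scaleR_diff_right[symmetric] mult.commute)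
      qed
    qed
  qed
  then obtain g where g: "\<And>x. x \<in> S \<Longrightarrow> (\<lambda>i. f i x) sums g x"
      "\<And>x. x \<in> S \<Longrightarrow> (g has_vector_derivative (\<Sum>i. f' i x)) (at x within S)"
    by (auto simp: has_vector_derivative_def)
  show ?thesis
    by (rule has_vector_derivative_transform[OF x _ g(2)[OF x]]) (use g(1) sums_unique in fastforce)
qed

text \<open>The limit is built by summing every derivative pointwise, which the embedding permits.
  Convergence in norm does not follow from these pointwise rates; it needs a Fatou-type argument,
  with finitely many orders at a time.\<close>

lemma Esp_complete:
  assumes j: "j \<ge> 0" and \<sigma>: "\<sigma> > 0"
    and F: "\<And>i::nat. F i \<in> Esp j \<sigma>" and summ: "summable (\<lambda>i. Enorm j \<sigma> (F i))"
  shows "\<exists>f\<in>Esp j \<sigma>. (\<lambda>m. Enorm j \<sigma> (\<lambda>x. f x - (\<Sum>i<m. F i x))) \<longlonglongrightarrow> 0"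
proof -
  note s = Esp_smooth[OF j \<sigma> F]
  define R where "R m = (\<Sum>i. Enorm j \<sigma> (F (i + m)))" for m
  have R0: "R \<longlonglongrightarrow> 0" unfolding R_def by (rule suminf_tail_tendsto_0[OF summ])
  have summ': "summable (\<lambda>i. Enorm j \<sigma> (F (i + m)))" for m
    using summ by (subst summable_iff_shift)
  have R_nonneg: "R m \<ge> 0" for m
    unfolding R_def by (intro suminf_nonneg summ' Enorm_nonneg[OF j \<sigma> F])
  define G where "G n x = (\<Sum>i. dn n (F i) x)" for n x
  have sumG: "summable (\<lambda>i. dn n (F i) x)" if "x \<in> {0..1}" for n x
    by (rule summable_comparison_test'[where g="\<lambda>i. sob \<sigma> n * Enorm j \<sigma> (F i)"])
       (use summ norm_dn_le_Enorm[OF j \<sigma> F that] in \<open>auto intro: summable_mult\<close>)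
  have tail: "norm ((\<Sum>i<m. dn n (F i) x) - G n x) \<le> sob \<sigma> n * R m" if x: "x \<in> {0..1}" for n m x
  proof -
    have "(\<Sum>i<m. dn n (F i) x) - G n x = - (\<Sum>i. dn n (F (i + m)) x)"
      unfolding G_def using suminf_minus_initial_segment[OF sumG[OF x], of n m] by simp
    also have "norm \<dots> \<le> (\<Sum>i. sob \<sigma> n * Enorm j \<sigma> (F (i + m)))"
      unfolding norm_minus_cancel
      by (intro norm_suminf_le norm_dn_le_Enorm j \<sigma> F x summable_mult summ')
    also have "\<dots> = sob \<sigma> n * R m"
      unfolding R_def by (rule suminf_mult[OF summ'])
    finally show ?thesis .
  qed
  have der: "(G n has_vector_derivative G (Suc n) x) (at x within {0..1})" if "x \<in> {0..1}" for n x
    unfolding G_def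
  proof (rule has_vector_derivative_suminf[where r="\<lambda>m. sob \<sigma> (Suc n) * R m"])
    show "(\<lambda>m. sob \<sigma> (Suc n) * R m) \<longlonglongrightarrow> 0" using tendsto_mult_right_zero[OF R0] .
  qed (use that tail[where n="Suc n"] sumG dn_has_derivative[OF s] in \<open>auto simp: G_def\<close>)
  define f where "f = G 0"
  have f: "smooth01 f" and dnf: "\<And>n x. x \<in> {0..1} \<Longrightarrow> dn n f x = G n x"
    unfolding f_def by (rule dn_eqI[where g=G]; use der in simp)+
  define h where "h m x = (\<Sum>i<m. F i x)" for m :: nat and x
  have hE: "h m \<in> Esp j \<sigma>" for m unfolding h_def by (rule Esp_sum[OF j \<sigma> F])
  note hs = Esp_smooth[OF j \<sigma> hE]
  have dnh: "dn n (h m) x = (\<Sum>i<m. dn n (F i) x)" if "x \<in> {0..1}" for n m x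
    unfolding h_def using dn_sum[OF s that] .
  \<comment> \<open>The product \<open>ebound j \<sigma> n * (sob \<sigma> n)\<^sup>2\<close> is at
    least 1, so these bounds cannot be summed over all \<open>n\<close>; they are used for
    \<open>n < K\<close> only.\<close>
  have e_small: "eterm j \<sigma> (\<lambda>x. f x - h l x) n \<le> ebound j \<sigma> n * (sob \<sigma> n * R l)\<^sup>2" for n l
  proof -
    have "eterm j \<sigma> (\<lambda>x. f x - h l x) n \<le> eterm j \<sigma> (\<lambda>x. 0) n + ebound j \<sigma> n * (sob \<sigma> n * R l)\<^sup>2"
    proof (rule eterm_le[OF j \<sigma> smooth01_const smooth01_diff[OF f hs]])
      fix x :: real assume x: "x \<in> {0..1}"
      have "norm (dn n (\<lambda>x. f x - h l x) x) \<le> sob \<sigma> n * R l"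
        using tail[OF x, where n=n and m=l] by (simp add: dn_diff[OF f hs x] dnf[OF x] dnh[OF x] norm_minus_commute)
      then show "(norm (dn n (\<lambda>x. f x - h l x) x))\<^sup>2 \<le> (norm (dn n (\<lambda>x. 0) x))\<^sup>2 + (sob \<sigma> n * R l)\<^sup>2"
        by (simp add: power_mono add_increasing)
    qed
    moreover have "eterm j \<sigma> (\<lambda>x. 0) n = 0"
      using eterm_cmult[OF j \<sigma> smooth01_const[of 0], of 0 n] by simp
    ultimately show ?thesis by simp
  qed
  have h_diff: "Enorm j \<sigma> (\<lambda>x. h (k + m) x - h m x) \<le> R m" for k m
  proof -
    have "h (k + m) x - h m x = (\<Sum>i<k. F (i + m) x)" for x
      unfolding h_def by (induction k) auto
    then have "Enorm j \<sigma> (\<lambda>x. h (k + m) x - h m x) \<le> (\<Sum>i<k. Enorm j \<sigma> (F (i + m)))"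
      using Enorm_sum[OF j \<sigma>, of "\<lambda>i. F (i + m)" k] F by simp
    also have "\<dots> \<le> R m"
      unfolding R_def by (intro sum_le_suminf summ') (auto intro: Enorm_nonneg[OF j \<sigma> F])
    finally show ?thesis .
  qed
  \<comment> \<open>With \<open>K\<close> fixed, \<open>f - h m\<close> is split at
    \<open>h (k + m)\<close>. As \<open>k\<close> grows the crude remainder disappears, while the
    Cauchy part stays below \<open>R m\<close> independently of \<open>K\<close>.\<close>
  have part: "(\<Sum>n<K. eterm j \<sigma> (\<lambda>x. f x - h m x) n) \<le> 2 * (R m)\<^sup>2" for K m
  proof (rule tendsto_lowerbound)
    let ?c = "\<Sum>n<K. ebound j \<sigma> n * (sob \<sigma> n)\<^sup>2"
    have "(\<lambda>k. 2 * (R m)\<^sup>2 + 2 * (?c * (R (k + m))\<^sup>2)) \<longlonglongrightarrow> 2 * (R m)\<^sup>2 + 2 * (?c * 0\<^sup>2)"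
      by (intro tendsto_intros LIMSEQ_ignore_initial_segment R0)
    then show "(\<lambda>k. 2 * (R m)\<^sup>2 + 2 * (?c * (R (k + m))\<^sup>2)) \<longlonglongrightarrow> 2 * (R m)\<^sup>2" by simp
    show "\<forall>\<^sub>F k in sequentially. (\<Sum>n<K. eterm j \<sigma> (\<lambda>x. f x - h m x) n) \<le> 2 * (R m)\<^sup>2 + 2 * (?c * (R (k + m))\<^sup>2)"
    proof (intro always_eventually allI)
      fix k
      let ?d = "\<lambda>x. h (k + m) x - h m x" and ?e = "\<lambda>x. f x - h (k + m) x"
      have dE: "?d \<in> Esp j \<sigma>" by (rule Esp_diff[OF j \<sigma> hE hE])
      have "(\<Sum>n<K. eterm j \<sigma> (\<lambda>x. f x - h m x) n) \<le> (\<Sum>n<K. 2 * eterm j \<sigma> ?d n + 2 * (ebound j \<sigma> n * (sob \<sigma> n * R (k + m))\<^sup>2))"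
      proof (rule sum_mono)
        fix n
        have "eterm j \<sigma> (\<lambda>x. ?d x + ?e x) n \<le> eterm j \<sigma> ?d n / (1/2) + eterm j \<sigma> ?e n / (1 - 1/2)"
          by (intro eterm_add j \<sigma> Esp_smooth[OF j \<sigma> dE] smooth01_diff f hs) auto
        then show "eterm j \<sigma> (\<lambda>x. f x - h m x) n \<le> 2 * eterm j \<sigma> ?d n + 2 * (ebound j \<sigma> n * (sob \<sigma> n * R (k + m))\<^sup>2)"
          using e_small[of "k + m" n] by simp
      qed
      also have "\<dots> = 2 * (\<Sum>n<K. eterm j \<sigma> ?d n) + 2 * (?c * (R (k + m))\<^sup>2)"
        by (simp add: sum.distrib sum_distrib_left sum_distrib_right power_mult_distrib mult.assoc)
      also have "(\<Sum>n<K. eterm j \<sigma> ?d n) \<le> suminf (eterm j \<sigma> ?d)"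
        using dE eterm_nonneg[OF j \<sigma> Esp_smooth[OF j \<sigma> dE]] by (intro sum_le_suminf) (auto simp: Esp_def)
      also have "suminf (eterm j \<sigma> ?d) = (Enorm j \<sigma> ?d)\<^sup>2"
        unfolding Enorm_def using dE eterm_nonneg[OF j \<sigma> Esp_smooth[OF j \<sigma> dE]] by (auto simp: Esp_def suminf_nonneg)
      also have "\<dots> \<le> (R m)\<^sup>2"
        by (intro power_mono h_diff Enorm_nonneg[OF j \<sigma> dE])
      finally show "(\<Sum>n<K. eterm j \<sigma> (\<lambda>x. f x - h m x) n) \<le> 2 * (R m)\<^sup>2 + 2 * (?c * (R (k + m))\<^sup>2)" by simp
    qed
  qed auto
  have diffE: "(\<lambda>x. f x - h m x) \<in> Esp j \<sigma>" and diffN: "Enorm j \<sigma> (\<lambda>x. f x - h m x) \<le> sqrt 2 * R m" for m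
  proof -
    have sm: "smooth01 (\<lambda>x. f x - h m x)" by (rule smooth01_diff[OF f hs])
    have su: "summable (eterm j \<sigma> (\<lambda>x. f x - h m x))"
      using part by (intro summableI_nonneg_bounded eterm_nonneg j \<sigma> sm)
    then show "(\<lambda>x. f x - h m x) \<in> Esp j \<sigma>" using sm by (simp add: Esp_def)
    have "Enorm j \<sigma> (\<lambda>x. f x - h m x) \<le> sqrt (2 * (R m)\<^sup>2)"
      unfolding Enorm_def using suminf_le_const[OF su part] by simp
    then show "Enorm j \<sigma> (\<lambda>x. f x - h m x) \<le> sqrt 2 * R m"
      using R_nonneg by (simp add: real_sqrt_mult)
  qed
  have "f \<in> Esp j \<sigma>" using diffE[of 0] by (simp add: h_def)
  moreover have "(\<lambda>m. Enorm j \<sigma> (\<lambda>x. f x - h m x)) \<longlonglongrightarrow> 0"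
  proof (rule tendsto_sandwich[OF always_eventually always_eventually tendsto_const])
    show "(\<lambda>m. sqrt 2 * R m) \<longlonglongrightarrow> 0" using tendsto_mult_right_zero[OF R0] .
  qed (use diffN diffE Enorm_nonneg[OF j \<sigma>] in auto)
  ultimately show ?thesis unfolding h_def by blast
qed

text \<open>Seminorm convergence carries finite subadditivity to the limit. Through
  \<open>Xnorm_le_suminf\<close> this supplies the countable subadditivity demanded by
  \<open>zabrejko\<close>.\<close>

lemma Enorm_le_suminf:
  assumes j: "j \<ge> 0" and \<sigma>: "\<sigma> > 0"
    and F: "\<And>i::nat. F i \<in> Esp j \<sigma>" and f: "f \<in> Esp j \<sigma>"
    and lim: "(\<lambda>m. Enorm j \<sigma> (\<lambda>x. f x - (\<Sum>i<m. F i x))) \<longlonglongrightarrow> 0"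
    and le: "\<And>i. Enorm j \<sigma> (F i) \<le> a i" and "summable a"
  shows "Enorm j \<sigma> f \<le> suminf a"
proof (rule tendsto_lowerbound)
  show "(\<lambda>m. Enorm j \<sigma> (\<lambda>x. f x - (\<Sum>i<m. F i x)) + suminf a) \<longlonglongrightarrow> suminf a"
    using tendsto_add[OF lim tendsto_const] by simp
  show "\<forall>\<^sub>F m in sequentially. Enorm j \<sigma> f \<le> Enorm j \<sigma> (\<lambda>x. f x - (\<Sum>i<m. F i x)) + suminf a"
  proof (intro always_eventually allI)
    fix m
    have S: "(\<lambda>x. \<Sum>i<m. F i x) \<in> Esp j \<sigma>" by (rule Esp_sum[OF j \<sigma> F])
    have "Enorm j \<sigma> f \<le> Enorm j \<sigma> (\<lambda>x. f x - (\<Sum>i<m. F i x)) + Enorm j \<sigma> (\<lambda>x. \<Sum>i<m. F i x)"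
      using Enorm_add[OF j \<sigma> Esp_diff[OF j \<sigma> f S] S] by simp
    also have "Enorm j \<sigma> (\<lambda>x. \<Sum>i<m. F i x) \<le> (\<Sum>i<m. a i)"
      by (rule order_trans[OF Enorm_sum[OF j \<sigma> F] sum_mono[OF le]])
    also have "\<dots> \<le> suminf a"
      using le Enorm_nonneg[OF j \<sigma> F] \<open>summable a\<close> by (intro sum_le_suminf) (auto intro: order_trans)
    finally show "Enorm j \<sigma> f \<le> Enorm j \<sigma> (\<lambda>x. f x - (\<Sum>i<m. F i x)) + suminf a" by simp
  qed
qed auto

section \<open>Countably subadditive seminorms\<close>

text \<open>The subtracted term makes the induction close.\<close>

lemma halving_sum_le:
  fixes r :: "nat \<Rightarrow> real"
  assumes "\<And>k. r (Suc k) \<le> r k / 2"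
  shows "(\<Sum>i<m. r (i + k)) \<le> 2 * r k - 2 * r (m + k)"
proof (induction m)
  case (Suc m)
  then show ?case using assms[of "m + k"] by simp
qed simp

text \<open>Zabrejko's lemma: a seminorm that is countably subadditive on a complete seminormed space is
  bounded. It plays the role of the closed graph theorem. Limits are taken in seminorms, so that
  functions need not be identified when they agree on the interval.\<close>
lemma zabrejko:
  fixes S :: "('a \<Rightarrow> 'b::real_vector) set" and N p :: "('a \<Rightarrow> 'b) \<Rightarrow> real"
  assumes diff: "\<And>f g. f \<in> S \<Longrightarrow> g \<in> S \<Longrightarrow> (\<lambda>x. f x - g x) \<in> S"
    and scale: "\<And>f c. f \<in> S \<Longrightarrow> (\<lambda>x. c *\<^sub>R f x) \<in> S"
    and ne: "(\<lambda>x. 0) \<in> S"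
    and N_nonneg: "\<And>f. f \<in> S \<Longrightarrow> N f \<ge> 0"
    and N_diff: "\<And>f g. f \<in> S \<Longrightarrow> g \<in> S \<Longrightarrow> N (\<lambda>x. f x - g x) \<le> N f + N g"
    and N_scale: "\<And>f c. f \<in> S \<Longrightarrow> N (\<lambda>x. c *\<^sub>R f x) = \<bar>c\<bar> * N f"
    and complete: "\<And>F. (\<And>i::nat. F i \<in> S) \<Longrightarrow> summable (\<lambda>i. N (F i)) \<Longrightarrow>
        \<exists>f\<in>S. (\<lambda>m. N (\<lambda>x. f x - (\<Sum>i<m. F i x))) \<longlonglongrightarrow> 0"
    and p_diff: "\<And>f g. f \<in> S \<Longrightarrow> g \<in> S \<Longrightarrow> p (\<lambda>x. f x - g x) \<le> p f + p g"
    and p_scale: "\<And>f c. f \<in> S \<Longrightarrow> p (\<lambda>x. c *\<^sub>R f x) = \<bar>c\<bar> * p f"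
    and p_csub: "\<And>F f a. (\<And>i::nat. F i \<in> S) \<Longrightarrow> f \<in> S \<Longrightarrow>
        (\<lambda>m. N (\<lambda>x. f x - (\<Sum>i<m. F i x))) \<longlonglongrightarrow> 0 \<Longrightarrow>
        (\<And>i. p (F i) \<le> a i) \<Longrightarrow> summable a \<Longrightarrow> p f \<le> suminf a"
  shows "\<exists>K\<ge>0. \<forall>f\<in>S. p f \<le> K * N f"
proof -
  have add: "(\<lambda>x. f x + g x) \<in> S" and N_add: "N (\<lambda>x. f x + g x) \<le> N f + N g"
    if "f \<in> S" "g \<in> S" for f g
    using diff[OF that(1) scale[OF that(2), of "-1"]] N_diff[OF that(1) scale[OF that(2), of "-1"]]
      N_scale[OF that(2), of "-1"] by simp_all
  have N_comm: "N (\<lambda>x. f x - g x) = N (\<lambda>x. g x - f x)" if "f \<in> S" "g \<in> S" for f g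
    using N_scale[OF diff[OF that(2,1)], of "-1"] by simp
  have N_tri: "N (\<lambda>x. f x - h x) \<le> N (\<lambda>x. f x - g x) + N (\<lambda>x. g x - h x)"
    if "f \<in> S" "g \<in> S" "h \<in> S" for f g h
    using N_add[OF diff[OF that(1,2)] diff[OF that(2,3)]] by simp
  \<comment> \<open>Closure, in the seminorm and within \<open>S\<close>, of the sublevel set of
    \<open>p\<close> at height \<open>k\<close>.\<close>
  define cl where "cl k = {f\<in>S. \<forall>e>0. \<exists>a\<in>S. p a \<le> k \<and> N (\<lambda>x. f x - a x) < e}" for k :: real
  \<comment> \<open>Baire's argument: if no closure contained a ball, the centres of shrinking balls
    that avoid one sublevel set after another would converge to some \<open>f\<close> with
    \<open>p f > k\<close> for every \<open>k\<close>.\<close>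
  have "\<exists>k f0 r. k \<ge> 0 \<and> f0 \<in> S \<and> r > 0 \<and> (\<forall>f\<in>S. N (\<lambda>x. f x - f0 x) < r \<longrightarrow> f \<in> cl k)"
  proof (rule ccontr)
    assume "\<not> ?thesis"
    then have *: "\<exists>f\<in>S. N (\<lambda>x. f x - f0 x) < r \<and> f \<notin> cl k" if "k \<ge> 0" "f0 \<in> S" "r > 0" for k f0 r
      using that by metis
    \<comment> \<open>A pair consists of a centre and a radius. The factor 3 leaves room: the limit
      lies within twice the radius of each centre and therefore still misses the sublevel
      set.\<close>
    define P where "P k y y' \<longleftrightarrow> fst y' \<in> S \<and> snd y' > 0 \<and> N (\<lambda>x. fst y' x - fst y x) < snd y \<and> snd y' \<le> snd y / 2 \<and>
        (\<forall>a\<in>S. p a \<le> real k \<longrightarrow> N (\<lambda>x. fst y' x - a x) \<ge> 3 * snd y')" for k and y y' :: "('a \<Rightarrow> 'b) \<times> real"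
    have step: "\<exists>y'. P k y y'" if y: "fst y \<in> S" "snd y > 0" for k y
    proof -
      obtain f where f: "f \<in> S" "N (\<lambda>x. f x - fst y x) < snd y" "f \<notin> cl (real k)"
        using *[of "real k" "fst y" "snd y"] y by auto
      then obtain e where e: "e > 0" "\<And>a. a \<in> S \<Longrightarrow> p a \<le> real k \<Longrightarrow> N (\<lambda>x. f x - a x) \<ge> e"
        unfolding cl_def by (auto simp: not_less)
      have "P k y (f, min (snd y / 2) (e / 3))"
        unfolding P_def using f e y by fastforce
      then show ?thesis ..
    qed
    have "\<exists>Y. \<forall>k. (fst (Y k) \<in> S \<and> snd (Y k) > 0) \<and> P k (Y k) (Y (Suc k))"
    proof (rule dependent_nat_choice)
      show "\<exists>y::('a \<Rightarrow> 'b) \<times> real. fst y \<in> S \<and> snd y > 0"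
        using ne by (intro exI[of _ "(\<lambda>x. 0, 1)"]) auto
      show "\<exists>z. (fst z \<in> S \<and> snd z > 0) \<and> P k y z" if "fst y \<in> S \<and> snd y > 0" for y k
        using step[of y k] that unfolding P_def by blast
    qed
    then obtain Y where Y: "\<And>k. fst (Y k) \<in> S" "\<And>k. snd (Y k) > 0" "\<And>k. P k (Y k) (Y (Suc k))" by blast
    define c r where "c k = fst (Y k)" and "r k = snd (Y k)" for k
    have c: "c k \<in> S" and r: "r k > 0" "r (Suc k) \<le> r k / 2" and cc: "N (\<lambda>x. c (Suc k) x - c k x) < r k"
      and far: "\<And>a. a \<in> S \<Longrightarrow> p a \<le> real k \<Longrightarrow> N (\<lambda>x. c (Suc k) x - a x) \<ge> 3 * r (Suc k)" for k
      using Y unfolding P_def c_def r_def by auto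
    have hs: "(\<Sum>i<m. r (i + k)) \<le> 2 * r k" for m k
      using halving_sum_le[of r, OF r(2), where m=m and k=k] r(1)[of "m + k"] by linarith
    define F where "F i = (\<lambda>x. c (Suc i) x - c i x)" for i
    have FS: "F i \<in> S" for i unfolding F_def by (intro diff c)
    have sumF: "(\<Sum>i<m. F i x) = c m x - c 0 x" for m x
      unfolding F_def by (rule sum_lessThan_telescope)
    have "summable (\<lambda>i. N (F i))"
    proof (rule summable_comparison_test')
      show "summable r"
        using hs[where k=0] by (intro summableI_nonneg_bounded[where x="2 * r 0"]) (auto intro: less_imp_le r)
      show "norm (N (F i)) \<le> r i" for i using cc[of i] N_nonneg[OF FS[of i]] by (simp add: F_def)
    qed
    from complete[OF FS this] obtain g where g: "g \<in> S" "(\<lambda>m. N (\<lambda>x. g x - (\<Sum>i<m. F i x))) \<longlonglongrightarrow> 0"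
      by blast
    define f where "f x = g x + c 0 x" for x
    have f: "f \<in> S" unfolding f_def by (intro add g c)
    have lim: "(\<lambda>m. N (\<lambda>x. f x - c m x)) \<longlonglongrightarrow> 0"
      using g(2) by (simp add: sumF f_def algebra_simps)
    have "p f > real k" for k
    proof (rule ccontr)
      assume "\<not> p f > real k"
      then have "3 * r (Suc k) \<le> N (\<lambda>x. c (Suc k) x - f x)" using far[OF f] by simp
      moreover have "N (\<lambda>x. c (Suc k) x - f x) \<le> 2 * r (Suc k)"
      proof (rule tendsto_lowerbound)
        show "(\<lambda>m. 2 * r (Suc k) + N (\<lambda>x. f x - c (m + Suc k) x)) \<longlonglongrightarrow> 2 * r (Suc k)"
          using tendsto_add[OF tendsto_const[of "2 * r (Suc k)"]
              LIMSEQ_ignore_initial_segment[OF lim, of "Suc k"]] by simp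
        have "N (\<lambda>x. c (m + k) x - c k x) \<le> (\<Sum>i<m. r (i + k))" for m k
        proof (induction m)
          case 0 then show ?case using N_scale[OF ne, of 0] by simp
        next
          case (Suc m)
          then show ?case using N_tri[OF c[of "Suc m + k"] c[of "m + k"] c[of k]] cc[of "m + k"] by simp
        qed
        then have near: "N (\<lambda>x. c (m + Suc k) x - c (Suc k) x) \<le> 2 * r (Suc k)" for m
          using hs order_trans by blast
        have "N (\<lambda>x. c (Suc k) x - f x) \<le> 2 * r (Suc k) + N (\<lambda>x. f x - c (m + Suc k) x)" for m
          using N_tri[OF c[of "Suc k"] c[of "m + Suc k"] f] N_comm[OF c[of "Suc k"] c[of "m + Suc k"]]
            N_comm[OF c[of "m + Suc k"] f] near[of m] by linarith
        then show "\<forall>\<^sub>F m in sequentially. N (\<lambda>x. c (Suc k) x - f x) \<le> 2 * r (Suc k) + N (\<lambda>x. f x - c (m + Suc k) x)"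
          by (intro always_eventually allI)
      qed auto
      ultimately show False using r(1)[of "Suc k"] by simp
    qed
    moreover obtain k :: nat where "p f < real k" using reals_Archimedean2 by blast
    ultimately show False using less_asym by blast
  qed
  then obtain k f0 r where k: "k \<ge> 0" and f0: "f0 \<in> S" and r: "r > 0"
    and ball: "\<And>f. f \<in> S \<Longrightarrow> N (\<lambda>x. f x - f0 x) < r \<Longrightarrow> f \<in> cl k" by blast
  \<comment> \<open>Approximating both \<open>f0 + g\<close> and \<open>f0\<close> and subtracting
    moves the ball to the origin, at the price of doubling \<open>k\<close>.\<close>
  have near0: "\<exists>a\<in>S. p a \<le> 2 * k \<and> N (\<lambda>x. g x - a x) < e" if g: "g \<in> S" "N g < r" and e: "e > 0" for g e
  proof -
    have "(\<lambda>x. f0 x + g x) \<in> cl k" "f0 \<in> cl k"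
      using ball[OF add[OF f0 g(1)]] ball[OF f0] g r N_scale[OF ne, of 0] by auto
    then obtain a b where a: "a \<in> S" "p a \<le> k" "N (\<lambda>x. f0 x + g x - a x) < e / 2"
      and b: "b \<in> S" "p b \<le> k" "N (\<lambda>x. f0 x - b x) < e / 2"
      unfolding cl_def using e half_gt_zero[OF e] by blast
    have "N (\<lambda>x. (f0 x + g x - a x) - (f0 x - b x)) < e"
      using N_diff[OF diff[OF add[OF f0 g(1)] a(1)] diff[OF f0 b(1)]] a(3) b(3) by linarith
    then have "N (\<lambda>x. g x - (a x - b x)) < e" by (simp add: algebra_simps)
    moreover have "p (\<lambda>x. a x - b x) \<le> 2 * k" using p_diff[OF a(1) b(1)] a(2) b(2) by linarith
    ultimately show ?thesis using diff[OF a(1) b(1)] by blast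
  qed
  have near: "\<exists>a\<in>S. p a \<le> 2 * k * t \<and> N (\<lambda>x. g x - a x) < e"
    if g: "g \<in> S" "N g < r * t" and t: "t > 0" and e: "e > 0" for g t e
  proof -
    have "N (\<lambda>x. (1/t) *\<^sub>R g x) < r" using N_scale[OF g(1), of "1/t"] g t by (simp add: pos_divide_less_eq)
    then obtain a where a: "a \<in> S" "p a \<le> 2 * k" "N (\<lambda>x. (1/t) *\<^sub>R g x - a x) < e / t"
      using near0[OF scale[OF g(1)], of "1/t" "e/t"] e t by auto
    have "N (\<lambda>x. g x - t *\<^sub>R a x) = t * N (\<lambda>x. (1/t) *\<^sub>R g x - a x)"
      using N_scale[OF diff[OF scale[OF g(1)] a(1)], of t "1/t"] t by (simp add: scaleR_diff_right)
    also have "\<dots> < e" using a(3) t by (simp add: field_simps)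
    finally have "N (\<lambda>x. g x - t *\<^sub>R a x) < e" .
    moreover have "p (\<lambda>x. t *\<^sub>R a x) \<le> 2 * k * t" using p_scale[OF a(1), of t] a(2) t by simp
    ultimately show ?thesis using scale[OF a(1)] by blast
  qed
  \<comment> \<open>Successive approximation at the scales \<open>(1/2)^n\<close> writes
    \<open>g\<close> as a seminorm-convergent series of \<open>F n\<close> with
    \<open>p (F n) \<le> 2 * k * (1/2)^n\<close>; countable subadditivity sums this to
    \<open>4 * k\<close>.\<close>
  have bound: "p g \<le> 4 * k" if g: "g \<in> S" "N g < r" for g
  proof -
    define P where "P n y y' \<longleftrightarrow> (\<exists>a\<in>S. p a \<le> 2 * k * (1/2)^n \<and> y' = (\<lambda>x. y x - a x))"
      for n :: nat and y y' :: "'a \<Rightarrow> 'b"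
    have "\<exists>Y. \<forall>n. (Y n \<in> S \<and> N (Y n) < r * (1/2)^n \<and> (n = 0 \<longrightarrow> Y n = g)) \<and> P n (Y n) (Y (Suc n))"
    proof (rule dependent_nat_choice)
      show "\<exists>y. y \<in> S \<and> N y < r * (1/2)^0 \<and> (0 = (0::nat) \<longrightarrow> y = g)" using g by auto
      fix y and n :: nat
      assume y: "y \<in> S \<and> N y < r * (1/2)^n \<and> (n = 0 \<longrightarrow> y = g)"
      obtain a where a: "a \<in> S" "p a \<le> 2 * k * (1/2)^n" "N (\<lambda>x. y x - a x) < r * (1/2)^(Suc n)"
        using near[of y "(1/2)^n" "r * (1/2)^(Suc n)"] y r by auto
      then show "\<exists>z. (z \<in> S \<and> N z < r * (1/2)^(Suc n) \<and> (Suc n = 0 \<longrightarrow> z = g)) \<and> P n y z"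
        unfolding P_def using diff[of y a] y by (intro exI[of _ "\<lambda>x. y x - a x"]) auto
    qed
    then obtain Y where Y: "\<And>n. Y n \<in> S" "\<And>n. N (Y n) < r * (1/2)^n" "Y 0 = g" "\<And>n. P n (Y n) (Y (Suc n))"
      by blast
    from Y(4) obtain F where F: "\<And>n. F n \<in> S" "\<And>n. p (F n) \<le> 2 * k * (1/2)^n" "\<And>n. Y (Suc n) = (\<lambda>x. Y n x - F n x)"
      unfolding P_def by metis
    have Ysum: "g x - (\<Sum>i<m. F i x) = Y m x" for m x
      by (induction m) (auto simp: Y(3) F(3) algebra_simps)
    have "(\<lambda>m. N (\<lambda>x. g x - (\<Sum>i<m. F i x))) \<longlonglongrightarrow> 0"
      unfolding Ysum
    proof (rule tendsto_sandwich[OF always_eventually always_eventually tendsto_const])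
      show "(\<lambda>m. r * (1/2)^m) \<longlonglongrightarrow> 0"
        using tendsto_mult_right_zero[OF LIMSEQ_power_zero[of "1/2::real"]] by simp
    qed (use Y(1) less_imp_le[OF Y(2)] N_nonneg in auto)
    from p_csub[OF F(1) g(1) this F(2)]
    have "p g \<le> (\<Sum>n. 2 * k * (1/2)^n)" by (simp add: summable_geometric)
    also have "\<dots> = 4 * k" by (subst suminf_mult) (auto simp: summable_geometric suminf_geometric)
    finally show ?thesis .
  qed
  have "p f \<le> (8 * k / r) * N f" if f: "f \<in> S" for f
  proof (rule field_le_epsilon)
    fix e :: real assume e: "e > 0"
    \<comment> \<open>Slightly more than \<open>N f\<close>, so that division by \<open>d\<close> is
      possible even if \<open>N f = 0\<close>; the excess multiplied by \<open>8 * k / r\<close> is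
      at most \<open>e\<close>.\<close>
    define d where "d = N f + e * r / (8 * k + 1)"
    have d: "d > 0" "N f < d" unfolding d_def using N_nonneg[OF f] e r k by (auto intro!: add_nonneg_pos)
    have "r / (2 * d) * N f \<le> r / (2 * d) * d" using d r by (intro mult_left_mono) auto
    also have "\<dots> < r" using d r by simp
    finally have "N (\<lambda>x. (r / (2 * d)) *\<^sub>R f x) < r" using N_scale[OF f, of "r / (2 * d)"] d r by simp
    from bound[OF scale[OF f] this] have "r / (2 * d) * p f \<le> 4 * k"
      using p_scale[OF f, of "r / (2 * d)"] r d by simp
    then have "p f \<le> 8 * k / r * d" using r d by (simp add: field_simps)
    also have "\<dots> = 8 * k / r * N f + e * (8 * k / (8 * k + 1))"
      unfolding d_def using r by (simp add: field_simps)
    also have "\<dots> \<le> 8 * k / r * N f + e"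
      using e k by (intro add_left_mono mult_left_le) auto
    finally show "p f \<le> 8 * k / r * N f + e" .
  qed
  then show ?thesis using k r by (intro exI[of _ "8 * k / r"]) auto
qed

section \<open>The spaces X and Y\<close>

lemma wterm_nonneg:
  assumes "smooth01 f" "\<sigma> > 0"
  shows "wterm \<sigma> k f n \<ge> 0"
proof -
  have "integral {0..1} (\<lambda>x. (x / \<sigma>) ^ k * (norm (dn n f x))\<^sup>2) \<ge> 0"
    using assms by (intro integral_nonneg integrable_continuous_real continuous_intros dn_continuous) auto
  then show ?thesis using assms by (simp add: wterm_def)
qed

lemma bterm_nonneg: "\<sigma> > 0 \<Longrightarrow> bterm \<sigma> f n \<ge> 0"
  by (simp add: bterm_def)

lemma summable_add_nonneg_iff:
  fixes a b :: "nat \<Rightarrow> real"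
  assumes "\<And>n. a n \<ge> 0" "\<And>n. b n \<ge> 0"
  shows "summable (\<lambda>n. a n + b n) \<longleftrightarrow> summable a \<and> summable b"
  using assms by (auto intro: summable_add summable_comparison_test'[of "\<lambda>n. a n + b n"])

lemma Ysp_eq:
  assumes "\<sigma> > 0"
  shows "Ysp \<sigma> = Esp 0 \<sigma>"
proof -
  have "eterm 0 \<sigma> f = (\<lambda>n. wterm \<sigma> 0 f n + wterm \<sigma> 1 f n + bterm \<sigma> f n)" if "smooth01 f" for f
    using eterm_eq_wterm[OF that assms, of 0] by auto
  then show ?thesis
    unfolding Ysp_def Esp_def
    using assms by (auto simp: summable_add_nonneg_iff wterm_nonneg bterm_nonneg)
qed

lemma Xsp_iff:
  assumes "\<sigma> > 0"
  shows "u \<in> Xsp \<sigma> \<longleftrightarrow> smooth01 u \<and> u 1 = 0 \<and> dn 1 u \<in> Esp 1 \<sigma>"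
proof -
  have "eterm 1 \<sigma> f = (\<lambda>n. wterm \<sigma> 0 f n + wterm \<sigma> 1 f n + wterm \<sigma> 2 f n + bterm \<sigma> f n)" if "smooth01 f" for f
    using eterm_eq_wterm[OF that assms, of 1] by auto
  then show ?thesis
    unfolding Xsp_def Esp_def using assms smooth01_dn[of u 1]
    by (auto simp: summable_add_nonneg_iff wterm_nonneg bterm_nonneg)
qed

lemma
  assumes "\<sigma> > 0" and f: "f \<in> Esp 1 \<sigma>"
  shows Esp_1_subset_0: "f \<in> Esp 0 \<sigma>" and Enorm_0_le_1: "Enorm 0 \<sigma> f \<le> Enorm 1 \<sigma> f"
proof -
  have s: "smooth01 f" and su: "summable (eterm 1 \<sigma> f)" using f by (auto simp: Esp_def)
  have le: "eterm 0 \<sigma> f n \<le> eterm 1 \<sigma> f n" for n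
    using wterm_nonneg[OF s assms(1), of 2 n] by (simp add: eterm_eq_wterm[OF s assms(1)])
  have su0: "summable (eterm 0 \<sigma> f)"
    using le eterm_nonneg[of 0 \<sigma> f] assms s by (intro summable_comparison_test'[OF su]) auto
  then show "f \<in> Esp 0 \<sigma>" using s by (simp add: Esp_def)
  show "Enorm 0 \<sigma> f \<le> Enorm 1 \<sigma> f"
    unfolding Enorm_def using suminf_le[OF le su0 su] by simp
qed

text \<open>Against \<open>gcoef \<sigma> n\<close> the factorials cancel down to
  \<open>(n + 1)\<^sup>2\<close>, which leaves a polynomial times
  \<open>(\<sigma> / \<tau>)^(2 * n)\<close>; here the gap between the two radii is spent. The index
  \<open>Suc n\<close> anticipates that X measures the derivative.\<close>

lemma geometric_ebound_summable:
  assumes \<sigma>: "0 < \<sigma>" "\<sigma> < \<tau>"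
  shows "summable (\<lambda>n. ebound j \<sigma> n * (A * (1 / \<tau>) ^ Suc n * (fact (Suc n))\<^sup>2)\<^sup>2)"
proof -
  define q where "q = (\<sigma> / \<tau>)\<^sup>2"
  have q: "0 < q" "q < 1" unfolding q_def using \<sigma> by (auto simp: power_less_one_iff)
  have eq: "ebound j \<sigma> n * (A * (1 / \<tau>) ^ Suc n * (fact (Suc n))\<^sup>2)\<^sup>2 =
      (A / \<tau>)\<^sup>2 * (q ^ n * ((1 + real n / \<sigma> + j * (real n)\<^sup>2 / \<sigma>\<^sup>2 + \<sigma>) * (real n + 1)\<^sup>2))" for n
  proof -
    define P where "P = (1 / \<tau>) ^ Suc n * (fact (Suc n))\<^sup>2"
    have "gcoef \<sigma> n * ((1 / \<tau>) ^ Suc n * (fact (Suc n))\<^sup>2)\<^sup>2 = q ^ n * (real n + 1)\<^sup>2 / \<tau>\<^sup>2"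
    proof -
      define a b m F where "a = \<sigma> ^ (2*n)" "b = \<tau> ^ (2*n)" "m = real n + 1" "F = (fact n :: real)"
      have "gcoef \<sigma> n = a / (F\<^sup>2 * (m * F)\<^sup>2)" "(fact (Suc n) :: real) = m * F"
        "((1 / \<tau>) ^ Suc n)\<^sup>2 = 1 / (b * \<tau>\<^sup>2)" "q ^ n = a / b" and "F > 0" "m > 0" "b > 0"
        unfolding gcoef_def q_def a_b_m_F_def using \<sigma>
        by (auto simp: power_mult power_divide power_mult_distrib algebra_simps power2_eq_square)
      then show ?thesis
        unfolding power_mult_distrib using \<sigma>
        by (simp add: divide_simps power2_eq_square mult_ac flip: a_b_m_F_def(3))
    qed
    then have "gcoef \<sigma> n * P\<^sup>2 = q ^ n * (real n + 1)\<^sup>2 / \<tau>\<^sup>2" by (simp only: P_def)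
    moreover have "ebound j \<sigma> n * (A * P)\<^sup>2 =
        A\<^sup>2 * ((1 + real n / \<sigma> + j * (real n)\<^sup>2 / \<sigma>\<^sup>2 + \<sigma>) * (gcoef \<sigma> n * P\<^sup>2))"
      unfolding ebound_def by (simp add: power_mult_distrib)
    ultimately show ?thesis
      by (simp only: P_def mult.assoc) (simp add: power_divide)
  qed
  \<comment> \<open>A ratio strictly between \<open>q\<close> and 1 absorbs the polynomial
    factor.\<close>
  define r where "r = (q + 1) / 2"
  have r: "q < r" "r < 1" "r > 0" using q by (auto simp: r_def)
  have "summable (\<lambda>n. q ^ n * ((1 + real n / \<sigma> + j * (real n)\<^sup>2 / \<sigma>\<^sup>2 + \<sigma>) * (real n + 1)\<^sup>2))"
  proof (rule summable_comparison_test_bigo)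
    show "summable (\<lambda>n. norm (r ^ n))" using r by (simp add: summable_geometric)
    show "(\<lambda>n. q ^ n * ((1 + real n / \<sigma> + j * (real n)\<^sup>2 / \<sigma>\<^sup>2 + \<sigma>) * (real n + 1)\<^sup>2)) \<in> O(\<lambda>n. r ^ n)"
      using q r \<sigma> by real_asymp
  qed
  then show ?thesis unfolding eq by (rule summable_mult)
qed

text \<open>Made for glueing: \<open>v\<close> may coincide with \<open>u\<close> on one part of the
  interval and obey a Gevrey bound of larger radius on the rest.\<close>

lemma Esp_dominated:
  assumes "j \<ge> 0" "0 < \<sigma>" "\<sigma> < \<tau>" and u: "u \<in> Esp j \<sigma>" and v: "smooth01 v"
    and le: "\<And>n x. x \<in> {0..1} \<Longrightarrow>
      (norm (dn n v x))\<^sup>2 \<le> (norm (dn n u x))\<^sup>2 + (A * (1 / \<tau>) ^ Suc n * (fact (Suc n))\<^sup>2)\<^sup>2"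
  shows "v \<in> Esp j \<sigma>"
proof -
  have "summable (eterm j \<sigma> v)"
  proof (rule summable_comparison_test')
    show "summable (\<lambda>n. eterm j \<sigma> u n + ebound j \<sigma> n * (A * (1 / \<tau>) ^ Suc n * (fact (Suc n))\<^sup>2)\<^sup>2)"
      using u geometric_ebound_summable[OF assms(2,3)] by (intro summable_add) (auto simp: Esp_def)
    show "norm (eterm j \<sigma> v n) \<le> eterm j \<sigma> u n + ebound j \<sigma> n * (A * (1 / \<tau>) ^ Suc n * (fact (Suc n))\<^sup>2)\<^sup>2" for n
      using eterm_le[OF assms(1,2) Esp_smooth[OF assms(1,2) u] v le] eterm_nonneg[OF assms(1,2) v, of n]
      by simp
  qed
  then show ?thesis using v by (simp add: Esp_def)
qed

text \<open>The bound extends from the open interval to the endpoints by continuity of the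
  derivatives.\<close>

lemma gevrey_bound:
  assumes "gevrey \<tau> 2 W" "\<tau> > 0"
  obtains C where "C > 0" "\<And>n x. x \<in> {0..1} \<Longrightarrow> norm (dn n W x) \<le> C * (1 / \<tau>) ^ n * (fact n)\<^sup>2"
proof -
  from assms obtain C where s: "smooth01 W" and C: "C > 0"
    "\<And>n x. x \<in> {0<..<1} \<Longrightarrow> norm (dn n W x) \<le> C * \<tau> powr (- real n) * (fact n) powr 2"
    unfolding gevrey_def by auto
  have "norm (dn n W x) \<le> C * (1 / \<tau>) ^ n * (fact n)\<^sup>2" if "x \<in> {0..1}" for n x
  proof (rule continuous_on_closure_norm_le[where s="{0<..<1::real}"])
    show "\<forall>y\<in>{0<..<1}. norm (dn n W y) \<le> C * (1 / \<tau>) ^ n * (fact n)\<^sup>2"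
      using C(2)[of _ n] assms(2)
      by (auto simp: powr_minus powr_realpow power_one_over inverse_eq_divide)
  qed (use that dn_continuous[OF s] in auto)
  then show ?thesis using that C(1) by blast
qed

lemma gevrey_in_Ysp:
  assumes "gevrey \<tau> 2 W" "0 < \<sigma>" "\<sigma> < \<tau>"
  shows "W \<in> Ysp \<sigma>"
proof -
  obtain C where C: "C > 0" "\<And>n x. x \<in> {0..1} \<Longrightarrow> norm (dn n W x) \<le> C * (1 / \<tau>) ^ n * (fact n)\<^sup>2"
    using gevrey_bound[OF assms(1)] assms by auto
  have "W \<in> Esp 0 \<sigma>"
  proof (rule Esp_dominated[OF _ assms(2,3) Esp_zero])
    show "smooth01 W" using assms(1) by (simp add: gevrey_def)
    fix n and x :: real assume x: "x \<in> {0..1}"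
    have "C * (1 / \<tau>) ^ n * (fact n)\<^sup>2 \<le> C * (1 / \<tau>) ^ n * (fact (Suc n))\<^sup>2"
      using C assms by (intro mult_left_mono power_mono fact_mono) auto
    \<comment> \<open>The additional \<open>\<tau>\<close> in the constant pays for raising the
      exponent from \<open>n\<close> to \<open>Suc n\<close>.\<close>
    then have "norm (dn n W x) \<le> C * \<tau> * (1 / \<tau>) ^ Suc n * (fact (Suc n))\<^sup>2"
      using C(2)[OF x, of n] assms by simp
    then show "(norm (dn n W x))\<^sup>2 \<le> (norm (dn n (\<lambda>x. 0) x))\<^sup>2 + (C * \<tau> * (1 / \<tau>) ^ Suc n * (fact (Suc n))\<^sup>2)\<^sup>2"
      by (intro add_increasing power_mono) auto
  qed (use assms in auto)
  then show ?thesis using Ysp_eq assms by simp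
qed

text \<open>Only the derivative is measured; on X the condition \<open>u 1 = 0\<close> recovers the
  function on the interval.\<close>

definition Xnorm :: "real \<Rightarrow> (real \<Rightarrow> complex) \<Rightarrow> real" where
  "Xnorm \<sigma> u = Enorm 1 \<sigma> (dn 1 u)"

section \<open>Linear structure and completeness of X\<close>

context
  fixes \<sigma> :: real
  assumes \<sigma>: "\<sigma> > 0"
begin

lemma Xsp_smooth: "u \<in> Xsp \<sigma> \<Longrightarrow> smooth01 u"
  by (simp add: Xsp_def)

lemma Xsp_cong:
  assumes u: "u \<in> Xsp \<sigma>" and eq: "\<And>x. x \<in> {0..1} \<Longrightarrow> u x = v x"
  shows "v \<in> Xsp \<sigma>" "Xnorm \<sigma> v = Xnorm \<sigma> u"
proof -
  note c = smooth01_cong[OF Xsp_smooth[OF u] eq]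
  have "dn 1 u \<in> Esp 1 \<sigma>" using u Xsp_iff \<sigma> by auto
  note e = Esp_cong[OF _ \<sigma> this, of "dn 1 v"]
  show "v \<in> Xsp \<sigma>" "Xnorm \<sigma> v = Xnorm \<sigma> u"
    using e c u eq[of 1] by (auto simp: Xsp_iff[OF \<sigma>] Xnorm_def)
qed

lemma
  assumes u: "u \<in> Xsp \<sigma>" and v: "v \<in> Xsp \<sigma>"
  shows Xsp_diff: "(\<lambda>x. u x - v x) \<in> Xsp \<sigma>"
    and Xnorm_diff: "Xnorm \<sigma> (\<lambda>x. u x - v x) \<le> Xnorm \<sigma> u + Xnorm \<sigma> v"
proof -
  note s = Xsp_smooth[OF u] Xsp_smooth[OF v]
  have e: "dn 1 u \<in> Esp 1 \<sigma>" "dn 1 v \<in> Esp 1 \<sigma>" using u v Xsp_iff \<sigma> by auto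
  note c = Esp_cong[OF _ \<sigma> Esp_diff[OF _ \<sigma> e], of "dn 1 (\<lambda>x. u x - v x)"]
  show "(\<lambda>x. u x - v x) \<in> Xsp \<sigma>" "Xnorm \<sigma> (\<lambda>x. u x - v x) \<le> Xnorm \<sigma> u + Xnorm \<sigma> v"
    using c dn_diff[OF s] Enorm_diff[OF _ \<sigma> e] u v smooth01_diff[OF s]
    by (auto simp: Xsp_iff[OF \<sigma>] Xnorm_def)
qed

lemma
  assumes u: "u \<in> Xsp \<sigma>"
  shows Xsp_cmult: "(\<lambda>x. c * u x) \<in> Xsp \<sigma>"
    and Xnorm_cmult: "Xnorm \<sigma> (\<lambda>x. c * u x) = norm c * Xnorm \<sigma> u"
proof -
  note s = Xsp_smooth[OF u]
  have e: "dn 1 u \<in> Esp 1 \<sigma>" using u Xsp_iff \<sigma> by auto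
  note c = Esp_cong[OF _ \<sigma> Esp_cmult[OF _ \<sigma> e], of c "dn 1 (\<lambda>x. c * u x)"]
  show "(\<lambda>x. c * u x) \<in> Xsp \<sigma>" "Xnorm \<sigma> (\<lambda>x. c * u x) = norm c * Xnorm \<sigma> u"
    using c dn_cmult[OF s] Enorm_cmult[OF _ \<sigma> e] u smooth01_cmult[OF s]
    by (auto simp: Xsp_iff[OF \<sigma>] Xnorm_def)
qed

lemma Xsp_add:
  assumes "u \<in> Xsp \<sigma>" "v \<in> Xsp \<sigma>"
  shows "(\<lambda>x. u x + v x) \<in> Xsp \<sigma>"
  using Xsp_diff[OF assms(1) Xsp_cmult[OF assms(2), of "-1"]] by simp

lemma Xsp_zero: "(\<lambda>x. 0) \<in> Xsp \<sigma>"
  using Esp_cong[OF _ \<sigma> Esp_zero[OF _ \<sigma>], of 1 "dn 1 (\<lambda>x. 0)"] dn_const[of _ 1 0]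
  by (auto simp: Xsp_iff[OF \<sigma>] smooth01_const)

lemma Xsp_sum: "(\<And>i::nat. F i \<in> Xsp \<sigma>) \<Longrightarrow> (\<lambda>x. \<Sum>i<m. F i x) \<in> Xsp \<sigma>"
  by (induction m) (auto intro: Xsp_zero Xsp_add)

lemma Xnorm_nonneg: "u \<in> Xsp \<sigma> \<Longrightarrow> Xnorm \<sigma> u \<ge> 0"
  unfolding Xnorm_def by (intro Enorm_nonneg) (use \<sigma> Xsp_iff in auto)

text \<open>Order 0 is reached by integrating the derivative from the endpoint 1, where
  \<open>u\<close> vanishes. Truncated subtraction lets \<open>sob \<sigma> 0\<close> serve orders 0
  and 1 alike.\<close>

lemma norm_dn_le_Xnorm:
  assumes u: "u \<in> Xsp \<sigma>" and x: "x \<in> {0..1}"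
  shows "norm (dn k u x) \<le> sob \<sigma> (k - 1) * Xnorm \<sigma> u"
proof -
  have e: "dn 1 u \<in> Esp 1 \<sigma>" and s: "smooth01 u" and u1: "u 1 = 0" using u Xsp_iff \<sigma> by auto
  have *: "norm (dn (Suc n) u x) \<le> sob \<sigma> n * Xnorm \<sigma> u" if "x \<in> {0..1}" for n x
    using norm_dn_le_Enorm[OF _ \<sigma> e that, of n] by (simp add: dn_dn Xnorm_def)
  show ?thesis
  proof (cases k)
    case 0
    have "norm (u x - u 1) \<le> integral {0..1} (\<lambda>t. norm (dn 1 u t))"
      using x dn_has_derivative[OF s, of _ 0] dn_continuous[OF s, of 1] by (intro norm_diff_le_integral) auto
    also have "\<dots> \<le> integral {0..1} (\<lambda>t::real. sob \<sigma> 0 * Xnorm \<sigma> u)"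
      using *[of _ 0] dn_continuous[OF s, of 1]
      by (intro integral_le integrable_continuous_real continuous_intros) auto
    finally show ?thesis using 0 u1 by simp
  next
    case (Suc n) then show ?thesis using *[OF x, of n] by simp
  qed
qed

lemma Xnorm_nonpos_imp_zero:
  assumes "u \<in> Xsp \<sigma>" "Xnorm \<sigma> u \<le> 0" "x \<in> {0..1}"
  shows "u x = 0"
proof -
  have "norm (u x) \<le> 0"
    using norm_dn_le_Xnorm[OF assms(1,3), of 0] mult_nonneg_nonpos[OF sob_nonneg[OF order_refl \<sigma>] assms(2), of 0]
    by (metis dn.simps(1) diff_0_eq_0 order_trans)
  then show ?thesis by simp
qed

text \<open>The derivatives have a limit \<open>v\<close> in the energy space; \<open>u\<close> is
  its primitive, with the integration constant fixed by \<open>u 1 = 0\<close>.\<close>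

lemma Xsp_complete:
  assumes U: "\<And>i::nat. U i \<in> Xsp \<sigma>" and summ: "summable (\<lambda>i. Xnorm \<sigma> (U i))"
  shows "\<exists>u\<in>Xsp \<sigma>. (\<lambda>m. Xnorm \<sigma> (\<lambda>x. u x - (\<Sum>i<m. U i x))) \<longlonglongrightarrow> 0"
proof -
  have e: "dn 1 (U i) \<in> Esp 1 \<sigma>" and s: "smooth01 (U i)" for i using U Xsp_iff \<sigma> by auto
  obtain v where v: "v \<in> Esp 1 \<sigma>" and lim: "(\<lambda>m. Enorm 1 \<sigma> (\<lambda>x. v x - (\<Sum>i<m. dn 1 (U i) x))) \<longlonglongrightarrow> 0"
    using Esp_complete[where F="\<lambda>i. dn 1 (U i)", OF _ \<sigma> e] summ by (auto simp: Xnorm_def)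
  have vs: "smooth01 v" using v by (simp add: Esp_def)
  define u where "u x = integral {0..x} v - integral {0..1} v" for x
  define g where "g n = (case n of 0 \<Rightarrow> u | Suc k \<Rightarrow> dn k v)" for n
  have der: "(g n has_vector_derivative g (Suc n) x) (at x within {0..1})" if x: "x \<in> {0..1}" for n x
  proof (cases n)
    case 0
    have "(u has_vector_derivative v x - 0) (at x within {0..1})"
      unfolding u_def using x vs
      by (intro has_vector_derivative_diff integral_has_vector_derivative smooth01_continuous) auto
    then show ?thesis using 0 by (simp add: g_def)
  next
    case (Suc k) then show ?thesis using dn_has_derivative[OF vs x] by (simp add: g_def)
  qed
  have us: "smooth01 u" and dnu: "\<And>x n. x \<in> {0..1} \<Longrightarrow> dn n u x = g n x"
    by (rule dn_eqI[where g=g]; use der in \<open>simp add: g_def\<close>)+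
  have d1: "dn 1 u x = v x" if "x \<in> {0..1}" for x using dnu[OF that, of 1] by (simp add: g_def)
  have uX: "u \<in> Xsp \<sigma>"
    using Esp_cong(1)[OF _ \<sigma> v, of "dn 1 u"] d1 us by (auto simp: Xsp_iff[OF \<sigma>] u_def)
  have "Xnorm \<sigma> (\<lambda>x. u x - (\<Sum>i<m. U i x)) = Enorm 1 \<sigma> (\<lambda>x. v x - (\<Sum>i<m. dn 1 (U i) x))" for m
    unfolding Xnorm_def
  proof (rule Esp_cong(2)[OF _ \<sigma>])
    show "(\<lambda>x. v x - (\<Sum>i<m. dn 1 (U i) x)) \<in> Esp 1 \<sigma>" using \<sigma> by (intro Esp_diff Esp_sum v e) auto
    show "v x - (\<Sum>i<m. dn 1 (U i) x) = dn 1 (\<lambda>x. u x - (\<Sum>i<m. U i x)) x" if "x \<in> {0..1}" for x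
      using that dn_diff[OF us smooth01_sum[OF s] that] dn_sum[OF s that] d1[OF that] by simp
  qed simp
  then have "(\<lambda>m. Xnorm \<sigma> (\<lambda>x. u x - (\<Sum>i<m. U i x))) \<longlonglongrightarrow> 0" using lim by simp
  then show ?thesis using uX by blast
qed

lemma Xnorm_le_suminf:
  assumes U: "\<And>i::nat. U i \<in> Xsp \<sigma>" and u: "u \<in> Xsp \<sigma>"
    and lim: "(\<lambda>m. Xnorm \<sigma> (\<lambda>x. u x - (\<Sum>i<m. U i x))) \<longlonglongrightarrow> 0"
    and le: "\<And>i. Xnorm \<sigma> (U i) \<le> a i" and "summable a"
  shows "Xnorm \<sigma> u \<le> suminf a"
proof -
  have e: "dn 1 (U i) \<in> Esp 1 \<sigma>" "smooth01 (U i)" and v: "dn 1 u \<in> Esp 1 \<sigma>" "smooth01 u" for i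
    using U u Xsp_iff \<sigma> by auto
  have eq: "Xnorm \<sigma> (\<lambda>x. u x - (\<Sum>i<m. U i x)) = Enorm 1 \<sigma> (\<lambda>x. dn 1 u x - (\<Sum>i<m. dn 1 (U i) x))" for m
    unfolding Xnorm_def
  proof (rule Esp_cong(2)[OF _ \<sigma>])
    show "(\<lambda>x. dn 1 u x - (\<Sum>i<m. dn 1 (U i) x)) \<in> Esp 1 \<sigma>" using \<sigma> by (intro Esp_diff Esp_sum v e) auto
    show "dn 1 u x - (\<Sum>i<m. dn 1 (U i) x) = dn 1 (\<lambda>x. u x - (\<Sum>i<m. U i x)) x" if "x \<in> {0..1}" for x
      using that dn_diff[OF v(2) smooth01_sum[OF e(2)] that] dn_sum[OF e(2) that] by simp
  qed simp
  show ?thesis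
    unfolding Xnorm_def
    by (rule Enorm_le_suminf[OF _ \<sigma> e(1) v(1) lim[unfolded eq] _ \<open>summable a\<close>]) (use le in \<open>auto simp: Xnorm_def\<close>)
qed

text \<open>Convergence in X forces pointwise convergence of orders 0, 1 and 2, which is all that
  \<open>Lop\<close> involves. This plays the part of closedness of the operator.\<close>

lemma Lop_tendsto:
  assumes U: "\<And>i::nat. U i \<in> Xsp \<sigma>" and u: "u \<in> Xsp \<sigma>"
    and lim: "(\<lambda>m. Xnorm \<sigma> (\<lambda>x. u x - (\<Sum>i<m. U i x))) \<longlonglongrightarrow> 0" and x: "x \<in> {0..1}"
  shows "(\<lambda>m. \<Sum>i<m. Lop W s (U i) x) \<longlonglongrightarrow> Lop W s u x"
proof -
  define w where "w m = (\<lambda>x. u x - (\<Sum>i<m. U i x))" for m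
  have w: "w m \<in> Xsp \<sigma>" for m unfolding w_def by (intro Xsp_diff Xsp_sum U u)
  have "(\<lambda>m. dn k (w m) x) \<longlonglongrightarrow> 0" for k
  proof (rule Lim_null_comparison)
    show "(\<lambda>m. sob \<sigma> (k - 1) * Xnorm \<sigma> (w m)) \<longlonglongrightarrow> 0"
      unfolding w_def using tendsto_mult_right_zero[OF lim] .
  qed (use norm_dn_le_Xnorm[OF w x] in auto)
  note lims = this[of 0] this[of 1] this[of 2]
  have "(\<lambda>m. Lop W s (w m) x) \<longlonglongrightarrow>
      of_real (x\<^sup>2) * 0 + (of_real (2*x) + s) * 0 - W x * 0"
    unfolding Lop_eq[OF Xsp_smooth[OF w] x] using lims by (intro tendsto_intros) auto
  moreover have "Lop W s (w m) x = Lop W s u x - (\<Sum>i<m. Lop W s (U i) x)" for m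
    unfolding w_def
    using Lop_diff[OF Xsp_smooth[OF u] smooth01_sum[OF Xsp_smooth[OF U]] x] Lop_sum[OF Xsp_smooth[OF U] x] by simp
  ultimately have "(\<lambda>m. Lop W s u x - (\<Sum>i<m. Lop W s (U i) x)) \<longlonglongrightarrow> 0" by simp
  from tendsto_diff[OF tendsto_const[of "Lop W s u x"] this] show ?thesis by simp
qed

end

section \<open>Openness of invertibility\<close>

context
  fixes W :: "real \<Rightarrow> complex" and \<sigma> :: real
  assumes \<sigma>: "\<sigma> > 0"
begin

lemma Dom_iff: "u \<in> Dom W \<sigma> s \<longleftrightarrow> u \<in> Xsp \<sigma> \<and> Lop W s u \<in> Esp 0 \<sigma>"
  by (simp add: Dom_def Ysp_eq[OF \<sigma>])

lemma DomI:
  assumes "u \<in> Xsp \<sigma>" "f \<in> Esp 0 \<sigma>" "\<And>x. x \<in> {0..1} \<Longrightarrow> Lop W s u x = f x"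
  shows "u \<in> Dom W \<sigma> s"
  using assms Esp_cong(1)[OF order_refl \<sigma> assms(2), of "Lop W s u"] by (auto simp: Dom_iff)

lemma Dom_X: "u \<in> Dom W \<sigma> s \<Longrightarrow> u \<in> Xsp \<sigma>"
  by (simp add: Dom_iff)

lemma Dom_smooth: "u \<in> Dom W \<sigma> s \<Longrightarrow> smooth01 u"
  by (simp add: Dom_def Xsp_def)

lemma Xsp_dn1:
  assumes "u \<in> Xsp \<sigma>"
  shows "dn 1 u \<in> Esp 0 \<sigma>" "Enorm 0 \<sigma> (dn 1 u) \<le> Xnorm \<sigma> u"
  using assms Xsp_iff[OF \<sigma>] Esp_1_subset_0[OF \<sigma>] Enorm_0_le_1[OF \<sigma>] by (auto simp: Xnorm_def)

lemma Dom_indep: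
  assumes u: "u \<in> Dom W \<sigma> s"
  shows "u \<in> Dom W \<sigma> t"
proof (rule DomI)
  show "u \<in> Xsp \<sigma>" using u by (rule Dom_X)
  show "(\<lambda>x. Lop W s u x + (t - s) * dn 1 u x) \<in> Esp 0 \<sigma>"
    using u Xsp_dn1[OF Dom_X[OF u]] \<sigma> by (intro Esp_add Esp_cmult) (auto simp: Dom_iff)
  show "Lop W t u x = Lop W s u x + (t - s) * dn 1 u x" if "x \<in> {0..1}" for x
    using Lop_shift[OF Dom_smooth[OF u] that] .
qed

lemma Dom_diff:
  assumes u: "u \<in> Dom W \<sigma> s" and v: "v \<in> Dom W \<sigma> s"
  shows "(\<lambda>x. u x - v x) \<in> Dom W \<sigma> s"
proof (rule DomI)
  show "(\<lambda>x. u x - v x) \<in> Xsp \<sigma>" using Xsp_diff[OF \<sigma>] Dom_X[OF u] Dom_X[OF v] by blast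
  show "(\<lambda>x. Lop W s u x - Lop W s v x) \<in> Esp 0 \<sigma>"
    using u v \<sigma> by (intro Esp_diff) (auto simp: Dom_iff)
qed (use Lop_diff Dom_smooth[OF u] Dom_smooth[OF v] in auto)

lemma Dom_cmult:
  assumes u: "u \<in> Dom W \<sigma> s"
  shows "(\<lambda>x. c * u x) \<in> Dom W \<sigma> s"
proof (rule DomI)
  show "(\<lambda>x. c * u x) \<in> Xsp \<sigma>" using Xsp_cmult[OF \<sigma>] Dom_X[OF u] by blast
  show "(\<lambda>x. c * Lop W s u x) \<in> Esp 0 \<sigma>"
    using u \<sigma> by (intro Esp_cmult) (auto simp: Dom_iff)
qed (use Lop_cmult Dom_smooth[OF u] in auto)

text \<open>\<open>J\<close> is a mere choice of solutions: their values off the interval are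
  arbitrary, so linearity can be expected of it only on the interval.\<close>

lemma Linvertible_solution:
  assumes "Linvertible W \<sigma> s"
  obtains J where "\<And>f. f \<in> Esp 0 \<sigma> \<Longrightarrow> J f \<in> Dom W \<sigma> s"
    "\<And>f x. f \<in> Esp 0 \<sigma> \<Longrightarrow> x \<in> {0..1} \<Longrightarrow> Lop W s (J f) x = f x"
proof -
  have "\<forall>f\<in>Esp 0 \<sigma>. \<exists>u. u \<in> Dom W \<sigma> s \<and> (\<forall>x\<in>{0..1}. Lop W s u x = f x)"
    using assms unfolding Linvertible_def Ysp_eq[OF \<sigma>] by blast
  from bchoice[OF this] show ?thesis using that by blast
qed

text \<open>\<open>zabrejko\<close> is applied to the map sending \<open>f\<close> to
  \<open>Xnorm\<close> of its solution. Injectivity makes this independent of the choice, hence a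
  seminorm; it is countably subadditive because the solutions for the terms of a series add up in X
  to a solution for the sum.\<close>

lemma Linvertible_bounded:
  assumes inv: "Linvertible W \<sigma> s"
  shows "\<exists>K\<ge>0. \<forall>u\<in>Dom W \<sigma> s. Xnorm \<sigma> u \<le> K * Enorm 0 \<sigma> (Lop W s u)"
proof -
  obtain J where J: "\<And>g. g \<in> Esp 0 \<sigma> \<Longrightarrow> J g \<in> Dom W \<sigma> s"
      "\<And>g x. g \<in> Esp 0 \<sigma> \<Longrightarrow> x \<in> {0..1} \<Longrightarrow> Lop W s (J g) x = g x"
    using Linvertible_solution[OF inv] by metis
  define p where "p f = Xnorm \<sigma> (J f)" for f
  have p: "p f = Xnorm \<sigma> u"
    if u: "u \<in> Dom W \<sigma> s" and eq: "\<And>x. x \<in> {0..1} \<Longrightarrow> Lop W s u x = f x" and f: "f \<in> Esp 0 \<sigma>" for u f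
  proof -
    have "\<forall>x\<in>{0..1}. u x = J f x"
      using inv J[OF f] u eq unfolding Linvertible_def by auto
    then show ?thesis unfolding p_def by (intro Xsp_cong(2)[OF \<sigma> Dom_X[OF u]]) auto
  qed
  have "\<exists>K\<ge>0. \<forall>f\<in>Esp 0 \<sigma>. p f \<le> K * Enorm 0 \<sigma> f"
  proof (rule zabrejko)
    fix f g c assume f: "f \<in> Esp 0 \<sigma>"
    show "(\<lambda>x. c *\<^sub>R f x) \<in> Esp 0 \<sigma>" "Enorm 0 \<sigma> (\<lambda>x. c *\<^sub>R f x) = \<bar>c\<bar> * Enorm 0 \<sigma> f"
      using Esp_cmult[OF _ \<sigma> f, of "of_real c"] Enorm_cmult[OF _ \<sigma> f, of "of_real c"]
      by (auto simp: scaleR_conv_of_real)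
    show "p (\<lambda>x. c *\<^sub>R f x) = \<bar>c\<bar> * p f"
    proof -
      have "p (\<lambda>x. of_real c * f x) = Xnorm \<sigma> (\<lambda>x. of_real c * J f x)"
        using J[OF f] Lop_cmult[OF Dom_smooth[OF J(1)[OF f]]] Esp_cmult[OF _ \<sigma> f] by (intro p Dom_cmult) auto
      then show ?thesis
        using Xnorm_cmult[OF \<sigma> Dom_X[OF J(1)[OF f]], of "of_real c"] by (simp add: scaleR_conv_of_real p_def)
    qed
    show "Enorm 0 \<sigma> f \<ge> 0" using Enorm_nonneg[OF _ \<sigma> f] by simp
    assume g: "g \<in> Esp 0 \<sigma>"
    show "(\<lambda>x. f x - g x) \<in> Esp 0 \<sigma>" "Enorm 0 \<sigma> (\<lambda>x. f x - g x) \<le> Enorm 0 \<sigma> f + Enorm 0 \<sigma> g"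
      using Esp_diff[OF _ \<sigma> f g] Enorm_diff[OF _ \<sigma> f g] by auto
    have "p (\<lambda>x. f x - g x) = Xnorm \<sigma> (\<lambda>x. J f x - J g x)"
      using J[OF f] J[OF g] Lop_diff[OF Dom_smooth[OF J(1)[OF f]] Dom_smooth[OF J(1)[OF g]]] Esp_diff[OF _ \<sigma> f g]
      by (intro p Dom_diff) auto
    also have "\<dots> \<le> p f + p g"
      unfolding p_def by (rule Xnorm_diff[OF \<sigma> Dom_X[OF J(1)[OF f]] Dom_X[OF J(1)[OF g]]])
    finally show "p (\<lambda>x. f x - g x) \<le> p f + p g" .
  next
    show "(\<lambda>x. 0) \<in> Esp 0 \<sigma>" using Esp_zero \<sigma> by simp
  next
    fix F :: "nat \<Rightarrow> real \<Rightarrow> complex" assume "\<And>i. F i \<in> Esp 0 \<sigma>" "summable (\<lambda>i. Enorm 0 \<sigma> (F i))"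
    then show "\<exists>f\<in>Esp 0 \<sigma>. (\<lambda>m. Enorm 0 \<sigma> (\<lambda>x. f x - (\<Sum>i<m. F i x))) \<longlonglongrightarrow> 0"
      using Esp_complete[OF _ \<sigma>, of 0 F] by simp
  next
    fix F f a
    assume F: "\<And>i::nat. F i \<in> Esp 0 \<sigma>" and f: "f \<in> Esp 0 \<sigma>"
      and lim: "(\<lambda>m. Enorm 0 \<sigma> (\<lambda>x. f x - (\<Sum>i<m. F i x))) \<longlonglongrightarrow> 0"
      and le: "\<And>i. p (F i) \<le> a i" and a: "summable a"
    note JF = J[OF F]
    have "summable (\<lambda>i. Xnorm \<sigma> (J (F i)))"
      using le Xnorm_nonneg[OF \<sigma> Dom_X[OF JF(1)]] by (intro summable_comparison_test'[OF a]) (auto simp: p_def)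
    then obtain u where u: "u \<in> Xsp \<sigma>" and limu: "(\<lambda>m. Xnorm \<sigma> (\<lambda>x. u x - (\<Sum>i<m. J (F i) x))) \<longlonglongrightarrow> 0"
      using Xsp_complete[OF \<sigma>, of "\<lambda>i. J (F i)"] Dom_X[OF JF(1)] by auto
    \<comment> \<open>The same partial sums have two pointwise limits, one by convergence of the
      solutions in X and one by convergence of the series in Y.\<close>
    have Lu: "Lop W s u x = f x" if x: "x \<in> {0..1}" for x
    proof (rule LIMSEQ_unique)
      show "(\<lambda>m. \<Sum>i<m. Lop W s (J (F i)) x) \<longlonglongrightarrow> Lop W s u x"
        by (rule Lop_tendsto[OF \<sigma> Dom_X[OF JF(1)] u limu x])
      have "(\<lambda>m. f x - (\<Sum>i<m. F i x)) \<longlonglongrightarrow> 0"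
      proof (rule Lim_null_comparison)
        show "(\<lambda>m. sob \<sigma> 0 * Enorm 0 \<sigma> (\<lambda>x. f x - (\<Sum>i<m. F i x))) \<longlonglongrightarrow> 0"
          using tendsto_mult_right_zero[OF lim] .
        have "norm (f x - (\<Sum>i<m. F i x)) \<le> sob \<sigma> 0 * Enorm 0 \<sigma> (\<lambda>x. f x - (\<Sum>i<m. F i x))" for m
          using norm_dn_le_Enorm[OF order_refl \<sigma> Esp_diff[OF order_refl \<sigma> f Esp_sum[OF order_refl \<sigma> F, where m=m]] x, of 0] by simp
        then show "\<forall>\<^sub>F m in sequentially. norm (f x - (\<Sum>i<m. F i x)) \<le> sob \<sigma> 0 * Enorm 0 \<sigma> (\<lambda>x. f x - (\<Sum>i<m. F i x))"
          by auto
      qed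
      from tendsto_diff[OF tendsto_const[of "f x"] this]
      show "(\<lambda>m. \<Sum>i<m. Lop W s (J (F i)) x) \<longlonglongrightarrow> f x" using JF(2)[OF x] by simp
    qed
    have "p f = Xnorm \<sigma> u" by (rule p[OF DomI[OF u f Lu] Lu f])
    also have "\<dots> \<le> suminf a"
      by (rule Xnorm_le_suminf[OF \<sigma> Dom_X[OF JF(1)] u limu _ a]) (use le in \<open>simp add: p_def\<close>)
    finally show "p f \<le> suminf a" .
  qed
  then obtain K where K: "K \<ge> 0" "\<And>f. f \<in> Esp 0 \<sigma> \<Longrightarrow> p f \<le> K * Enorm 0 \<sigma> f" by auto
  show ?thesis
    using K p[of _ "Lop W s _"] by (intro exI[of _ K]) (metis Dom_iff)
qed

text \<open>The perturbation costs at most half of \<open>Xnorm \<sigma> u\<close>, which is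
  absorbed on the left: hence the threshold 1/2 and the factor 2. The resulting bound also gives
  injectivity, and a Neumann series gives surjectivity.\<close>

lemma Linvertible_perturb:
  assumes inv: "Linvertible W \<sigma> s" and K: "K \<ge> 0"
    and bound: "\<And>u. u \<in> Dom W \<sigma> s \<Longrightarrow> Xnorm \<sigma> u \<le> K * Enorm 0 \<sigma> (Lop W s u)"
    and t: "K * norm (t - s) \<le> 1 / 2"
  shows "Linvertible W \<sigma> t"
    and "\<And>u. u \<in> Dom W \<sigma> t \<Longrightarrow> Xnorm \<sigma> u \<le> 2 * K * Enorm 0 \<sigma> (Lop W t u)"
proof -
  show bound': "Xnorm \<sigma> u \<le> 2 * K * Enorm 0 \<sigma> (Lop W t u)" if u: "u \<in> Dom W \<sigma> t" for u
  proof -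
    have us: "u \<in> Dom W \<sigma> s" using Dom_indep[OF u] .
    have L: "Lop W t u \<in> Esp 0 \<sigma>" using u by (simp add: Dom_iff)
    note d = Xsp_dn1[OF Dom_X[OF u]]
    have "Enorm 0 \<sigma> (Lop W s u) = Enorm 0 \<sigma> (\<lambda>x. Lop W t u x + (s - t) * dn 1 u x)"
      using Lop_shift[OF Dom_smooth[OF u]] \<sigma> by (intro Esp_cong(2) Esp_add Esp_cmult L d) auto
    also have "\<dots> \<le> Enorm 0 \<sigma> (Lop W t u) + norm (s - t) * Enorm 0 \<sigma> (dn 1 u)"
      using Enorm_add[OF order_refl \<sigma> L Esp_cmult[OF order_refl \<sigma> d(1)]] Enorm_cmult[OF order_refl \<sigma> d(1)] by metis
    also have "\<dots> \<le> Enorm 0 \<sigma> (Lop W t u) + norm (s - t) * Xnorm \<sigma> u"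
      using d by (intro add_left_mono mult_left_mono) auto
    finally have "Xnorm \<sigma> u \<le> K * (Enorm 0 \<sigma> (Lop W t u) + norm (s - t) * Xnorm \<sigma> u)"
      using bound[OF us] K by (meson mult_left_mono order_trans)
    also have "\<dots> = K * Enorm 0 \<sigma> (Lop W t u) + (K * norm (t - s)) * Xnorm \<sigma> u"
      by (simp add: algebra_simps norm_minus_commute)
    also have "\<dots> \<le> K * Enorm 0 \<sigma> (Lop W t u) + (1 / 2) * Xnorm \<sigma> u"
      using Xnorm_nonneg[OF \<sigma> Dom_X[OF u]] by (intro add_left_mono mult_right_mono t)
    finally show ?thesis by simp
  qed
  show "Linvertible W \<sigma> t"
    unfolding Linvertible_def
  proof (intro conjI ballI impI)
    fix u v x
    assume u: "u \<in> Dom W \<sigma> t" and v: "v \<in> Dom W \<sigma> t" and eq: "\<forall>x\<in>{0..1}. Lop W t u x = Lop W t v x"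
      and x: "x \<in> {0..1::real}"
    let ?w = "\<lambda>x. u x - v x"
    have w: "?w \<in> Dom W \<sigma> t" by (rule Dom_diff[OF u v])
    have "Enorm 0 \<sigma> (Lop W t ?w) = Enorm 0 \<sigma> (\<lambda>x. 0)"
      using Lop_diff[OF Dom_smooth[OF u] Dom_smooth[OF v]] eq
      by (intro Esp_cong(2)[OF _ \<sigma> Esp_zero[OF _ \<sigma>]]) auto
    then have "Xnorm \<sigma> ?w \<le> 0" using bound'[OF w] Enorm_zero[OF order_refl \<sigma>] by simp
    from Xnorm_nonpos_imp_zero[OF \<sigma> Dom_X[OF w] this x] show "u x = v x" by simp
  next
    fix f assume "f \<in> Ysp \<sigma>"
    then have f: "f \<in> Esp 0 \<sigma>" by (simp add: Ysp_eq[OF \<sigma>])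
    obtain J where J: "\<And>g. g \<in> Esp 0 \<sigma> \<Longrightarrow> J g \<in> Dom W \<sigma> s"
      "\<And>g x. g \<in> Esp 0 \<sigma> \<Longrightarrow> x \<in> {0..1} \<Longrightarrow> Lop W s (J g) x = g x"
    using Linvertible_solution[OF inv] by metis
    have JX: "Xnorm \<sigma> (J g) \<le> K * Enorm 0 \<sigma> g" if g: "g \<in> Esp 0 \<sigma>" for g
      using bound[OF J(1)[OF g]] Esp_cong(2)[OF order_refl \<sigma> g, of "Lop W s (J g)"] J(2)[OF g] by simp
    \<comment> \<open>The residual after \<open>n\<close> corrections: on the interval
      \<open>Lop W t (J (G n)) = G n - G (Suc n)\<close>, so the corrections telescope to
      \<open>f\<close>, and the norm in Y at least halves in every step.\<close>
    define G where "G n = ((\<lambda>g x. (s - t) * dn 1 (J g) x) ^^ n) f" for n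
    have G0: "G 0 = f" and GS: "G (Suc n) = (\<lambda>x. (s - t) * dn 1 (J (G n)) x)" for n by (auto simp: G_def)
    have G: "G n \<in> Esp 0 \<sigma> \<and> Enorm 0 \<sigma> (G n) \<le> (1/2)^n * Enorm 0 \<sigma> f" for n
    proof (induction n)
      case 0 then show ?case using f G0 by simp
    next
      case (Suc n)
      then have g: "G n \<in> Esp 0 \<sigma>" by simp
      note d = Xsp_dn1[OF Dom_X[OF J(1)[OF g]]]
      have "Enorm 0 \<sigma> (G (Suc n)) = norm (t - s) * Enorm 0 \<sigma> (dn 1 (J (G n)))"
        unfolding GS using Enorm_cmult[OF order_refl \<sigma> d(1)] by (simp add: norm_minus_commute)
      also have "\<dots> \<le> norm (t - s) * (K * Enorm 0 \<sigma> (G n))"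
        using d(2) JX[OF g] by (intro mult_left_mono) auto
      also have "\<dots> = (K * norm (t - s)) * Enorm 0 \<sigma> (G n)" by simp
      also have "\<dots> \<le> (1/2) * ((1/2)^n * Enorm 0 \<sigma> f)"
        using Suc t K Enorm_nonneg[OF order_refl \<sigma> g] by (intro mult_mono) auto
      finally show ?case using Esp_cmult[OF order_refl \<sigma> d(1)] by (simp add: GS)
    qed
    define U where "U n = J (G n)" for n
    have UD: "U n \<in> Dom W \<sigma> s" for n unfolding U_def using J G by blast
    have sums: "summable (\<lambda>n. Xnorm \<sigma> (U n))"
    proof (rule summable_comparison_test')
      show "summable (\<lambda>n. K * Enorm 0 \<sigma> f * (1/2)^n)" by (intro summable_mult) (simp add: summable_geometric)
      show "norm (Xnorm \<sigma> (U n)) \<le> K * Enorm 0 \<sigma> f * (1/2)^n" for n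
      proof -
        have "Xnorm \<sigma> (U n) \<le> K * Enorm 0 \<sigma> (G n)" unfolding U_def using JX G by blast
        also have "\<dots> \<le> K * ((1/2)^n * Enorm 0 \<sigma> f)" using G K by (intro mult_left_mono) auto
        finally show ?thesis using Xnorm_nonneg[OF \<sigma> Dom_X[OF UD[of n]]] by (simp add: mult_ac)
      qed
    qed
    obtain u where u: "u \<in> Xsp \<sigma>" and limu: "(\<lambda>m. Xnorm \<sigma> (\<lambda>x. u x - (\<Sum>i<m. U i x))) \<longlonglongrightarrow> 0"
      using Xsp_complete[OF \<sigma>, of U] Dom_X[OF UD] sums by auto
    have Lu: "Lop W t u x = f x" if x: "x \<in> {0..1}" for x
    proof (rule LIMSEQ_unique)
      show "(\<lambda>m. \<Sum>i<m. Lop W t (U i) x) \<longlonglongrightarrow> Lop W t u x"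
        by (rule Lop_tendsto[OF \<sigma> Dom_X[OF UD] u limu x])
      have "Lop W t (U i) x = G i x - G (Suc i) x" for i
        using Lop_shift[OF Dom_smooth[OF UD[of i]] x, of W t s] J(2)[of "G i" x] G[of i] x
        by (simp add: U_def GS algebra_simps)
      then have "(\<Sum>i<m. Lop W t (U i) x) = f x - G m x" for m
        using sum_lessThan_telescope'[of "\<lambda>i. G i x" m] by (simp add: G0)
      moreover have "(\<lambda>m. G m x) \<longlonglongrightarrow> 0"
      proof (rule Lim_null_comparison)
        show "(\<lambda>m. sob \<sigma> 0 * Enorm 0 \<sigma> f * (1/2)^m) \<longlonglongrightarrow> 0"
          using tendsto_mult_right_zero[OF LIMSEQ_power_zero[of "1/2::real"]] by simp
        have "norm (G m x) \<le> sob \<sigma> 0 * Enorm 0 \<sigma> f * (1/2)^m" for m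
        proof -
          have "norm (G m x) \<le> sob \<sigma> 0 * Enorm 0 \<sigma> (G m)"
            using norm_dn_le_Enorm[OF order_refl \<sigma> _ x, of "G m" 0] G[of m] by simp
          also have "\<dots> \<le> sob \<sigma> 0 * ((1/2)^m * Enorm 0 \<sigma> f)"
            using G[of m] sob_nonneg[OF order_refl \<sigma>] by (intro mult_left_mono) auto
          finally show ?thesis by (simp add: mult_ac)
        qed
        then show "\<forall>\<^sub>F m in sequentially. norm (G m x) \<le> sob \<sigma> 0 * Enorm 0 \<sigma> f * (1/2)^m" by auto
      qed
      ultimately show "(\<lambda>m. \<Sum>i<m. Lop W t (U i) x) \<longlonglongrightarrow> f x"
        using tendsto_diff[OF tendsto_const[of "f x"]] by force
    qed
    show "\<exists>u\<in>Dom W \<sigma> t. \<forall>x\<in>{0..1}. Lop W t u x = f x"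
      using DomI[OF u f Lu] Lu by blast
  qed
qed

end

lemma open_Omega:
  assumes "\<sigma> > 0"
  shows "open (Omega \<sigma>)"
proof -
  have "Omega1 \<sigma> = {s. \<sigma> < \<bar>Im s\<bar>} \<union> ({s. Re s > 0} \<inter> {s. \<sigma> < cmod s})"
  proof -
    have "\<sigma> < cmod s" if "\<sigma> < \<bar>Im s\<bar>" for s using abs_Im_le_cmod[of s] that by linarith
    then show ?thesis unfolding Omega1_def by force
  qed
  then have 1: "open (Omega1 \<sigma>)"
    by (simp only:) (intro open_Un open_Int open_Collect_less continuous_intros)
  have 2: "open (Omega2 \<sigma>)"
  proof -
    \<comment> \<open>On \<open>?A\<close> the denominator exceeds \<open>2 * \<sigma>\<close>,
      which makes \<open>?g\<close> continuous there.\<close>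
    let ?A = "{s. \<sigma> < cmod s + Re s}" and ?g = "\<lambda>s. \<sigma> - (- Re s * cmod s / (2 * (cmod s + Re s)))"
    have A: "open ?A" by (intro open_Collect_less continuous_intros)
    have "Omega2 \<sigma> = ?A \<inter> ?g -` {0<..}" unfolding Omega2_def by auto
    moreover have "continuous_on ?A ?g" using assms by (intro continuous_intros) auto
    ultimately show ?thesis using continuous_on_open_vimage[OF A, of ?g] by (simp add: Int_commute)
  qed
  have 3: "open (Omega3 \<sigma>)"
  proof -
    let ?g = "\<lambda>s. \<sigma> * (cmod s - \<sigma> + Re s) - (\<sigma> * (1 + Re s / cmod s) + Re s / 2)^2"
    have "Omega3 \<sigma> = (- {0}) \<inter> ?g -` {0<..}" unfolding Omega3_def by auto
    moreover have "continuous_on (- {0}) ?g" by (intro continuous_intros) auto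
    ultimately show ?thesis using continuous_on_open_vimage[of "- {0::complex}" ?g] by (simp add: Int_commute open_Compl)
  qed
  show ?thesis unfolding Omega_def by (intro open_Int open_Un 1 2 3)
qed

section \<open>Linear initial value problems\<close>

lemma integral_exp_le:
  fixes \<kappa> b :: real
  assumes "\<kappa> > 0" "b \<ge> 0"
  shows "integral {0..b} (\<lambda>t. exp (\<kappa> * t)) \<le> exp (\<kappa> * b) / \<kappa>"
proof -
  have "((\<lambda>t. exp (\<kappa> * t)) has_integral exp (\<kappa> * b) / \<kappa> - exp (\<kappa> * 0) / \<kappa>) {0..b}"
    using assms by (intro fundamental_theorem_of_calculus)
      (auto intro!: derivative_eq_intros simp: has_real_derivative_iff_has_vector_derivative[symmetric])
  from integral_unique[OF this] show ?thesis using assms by simp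
qed

text \<open>Gronwall's inequality, with a lossy constant: maximise \<open>exp (- 2 * M * x) * \<phi> x\<close>.\<close>
lemma gronwall:
  fixes \<phi> :: "real \<Rightarrow> real"
  assumes T: "T \<ge> 0" and cont: "continuous_on {0..T} \<phi>" and nonneg: "\<And>x. x \<in> {0..T} \<Longrightarrow> \<phi> x \<ge> 0"
    and le: "\<And>x. x \<in> {0..T} \<Longrightarrow> \<phi> x \<le> B + M * integral {0..x} \<phi>"
    and M: "M > 0" and B: "B \<ge> 0" and x: "x \<in> {0..T}"
  shows "\<phi> x \<le> 2 * B * exp (2 * M * x)"
proof -
  define \<kappa> where "\<kappa> = 2 * M"
  have l: "\<kappa> > 0" using M by (simp add: \<kappa>_def)
  have "\<exists>a\<in>{0..T}. \<forall>y\<in>{0..T}. exp (- \<kappa> * y) * \<phi> y \<le> exp (- \<kappa> * a) * \<phi> a"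
    using T by (intro continuous_attains_sup continuous_intros cont) auto
  then obtain a where a: "a \<in> {0..T}" "\<And>y. y \<in> {0..T} \<Longrightarrow> exp (- \<kappa> * y) * \<phi> y \<le> exp (- \<kappa> * a) * \<phi> a"
    by blast
  define S where "S = exp (- \<kappa> * a) * \<phi> a"
  have S: "S \<ge> 0" unfolding S_def using nonneg[OF a(1)] by simp
  have phi: "\<phi> y \<le> S * exp (\<kappa> * y)" if "y \<in> {0..T}" for y
    using a(2)[OF that] unfolding S_def[symmetric] by (simp add: exp_minus field_simps)
  have "\<phi> a \<le> B + M * integral {0..a} \<phi>" by (rule le[OF a(1)])
  also have "integral {0..a} \<phi> \<le> integral {0..a} (\<lambda>t. S * exp (\<kappa> * t))"
    using a(1) phi by (intro integral_le integrable_continuous_real continuous_intros continuous_on_subset[OF cont]) auto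
  also have "\<dots> = S * integral {0..a} (\<lambda>t. exp (\<kappa> * t))" by simp
  also have "\<dots> \<le> S * (exp (\<kappa> * a) / \<kappa>)"
    using a(1) l S by (intro mult_left_mono integral_exp_le) auto
  finally have "\<phi> a \<le> B + S * exp (\<kappa> * a) / 2" using M by (simp add: \<kappa>_def)
  then have "exp (- \<kappa> * a) * \<phi> a \<le> exp (- \<kappa> * a) * (B + S * exp (\<kappa> * a) / 2)"
    by (intro mult_left_mono) auto
  also have "\<dots> = exp (- \<kappa> * a) * B + S / 2" by (simp add: algebra_simps exp_minus)
  also have "exp (- \<kappa> * a) * B \<le> 1 * B" using a(1) l B by (intro mult_right_mono) auto
  finally have "S \<le> 1 * B + S / 2" by (simp only: S_def)
  then have "S \<le> 2 * B" by simp
  then have "S * exp (\<kappa> * x) \<le> 2 * B * exp (\<kappa> * x)" by (intro mult_right_mono) auto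
  then show ?thesis using phi[OF x] unfolding \<kappa>_def by linarith
qed

text \<open>Picard iteration for \<open>w\<close> with
  \<open>y t = exp (\<kappa> * t) *\<^sub>R w t\<close>. In this weighted norm, with
  \<open>\<kappa> = 2 * M\<close>, the integral operator contracts by 1/2 on the whole interval at
  once.\<close>

lemma lipschitz_ode_exists:
  fixes F :: "real \<Rightarrow> 'a::banach \<Rightarrow> 'a"
  assumes cont: "\<And>y. continuous_on {0..1} y \<Longrightarrow> continuous_on {0..1} (\<lambda>t. F t (y t))"
    and lip: "\<And>t y z. t \<in> {0..1} \<Longrightarrow> norm (F t y - F t z) \<le> M * norm (y - z)" and M: "M > 0"
  shows "\<exists>y. continuous_on {0..1} y \<and> (\<forall>x\<in>{0..1}. y x = integral {0..x} (\<lambda>t. F t (y t)))"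
proof -
  define \<kappa> where "\<kappa> = 2 * M"
  have l: "\<kappa> > 0" using M by (simp add: \<kappa>_def)
  \<comment> \<open>Members of \<open>bcontfun\<close> live on the whole line; composing with the
    clamp \<open>c\<close> extends a continuous function on the interval to one of them.\<close>
  define c :: "real \<Rightarrow> real" where "c x = max 0 (min 1 x)" for x
  have c: "c x \<in> {0..1}" "x \<in> {0..1} \<Longrightarrow> c x = x" "continuous_on A c" for x A
    by (auto simp: c_def[abs_def] intro!: continuous_intros)
  define V where "V w x = exp (- \<kappa> * x) *\<^sub>R integral {0..x} (\<lambda>t. F t (exp (\<kappa> * t) *\<^sub>R apply_bcontfun w t))"
    for w :: "real \<Rightarrow>\<^sub>C 'a" and x
  have Fc: "continuous_on {0..1} (\<lambda>t. F t (exp (\<kappa> * t) *\<^sub>R apply_bcontfun w t))" for w :: "real \<Rightarrow>\<^sub>C 'a"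
    by (intro cont continuous_intros) auto
  have Vc: "continuous_on {0..1} (V w)" for w
    unfolding V_def using Fc
    by (intro continuous_intros indefinite_integral_continuous_1 integrable_continuous_real)
  have Vb: "(\<lambda>x. V w (c x)) \<in> bcontfun" for w
  proof -
    have "bounded (V w ` {0..1})" by (intro compact_imp_bounded compact_continuous_image Vc) auto
    then obtain b where "\<And>x. x \<in> {0..1} \<Longrightarrow> norm (V w x) \<le> b" unfolding bounded_iff by (metis imageI)
    then have "norm (V w (c x)) \<le> b" for x using c(1) by blast
    moreover have "continuous_on UNIV (\<lambda>x. V w (c x))"
      by (rule continuous_on_compose2[OF Vc c(3)]) (use c(1) in auto)
    ultimately show ?thesis by (intro bcontfun_normI)
  qed
  define T where "T w = Bcontfun (\<lambda>x. V w (c x))" for w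
  have T: "apply_bcontfun (T w) x = V w (c x)" for w x
    unfolding T_def using Vb by (simp add: Bcontfun_inverse)
  have "dist (T w) (T v) \<le> 1 / 2 * dist w v" for w v
  proof (rule dist_bound)
    fix x
    let ?b = "c x" and ?G = "\<lambda>w t. F t (exp (\<kappa> * t) *\<^sub>R apply_bcontfun w t)"
    have sub: "{0..?b} \<subseteq> {0..1}" using c(1)[of x] by auto
    have i: "?G w integrable_on {0..?b}" for w
      by (intro integrable_continuous_real continuous_on_subset[OF Fc sub])
    have "norm (integral {0..?b} (?G w) - integral {0..?b} (?G v)) = norm (integral {0..?b} (\<lambda>t. ?G w t - ?G v t))"
      by (subst integral_diff[OF i i]) simp
    also have "\<dots> \<le> integral {0..?b} (\<lambda>t. M * dist w v * exp (\<kappa> * t))"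
    proof (rule integral_norm_bound_integral)
      show "(\<lambda>t. ?G w t - ?G v t) integrable_on {0..?b}" by (intro integrable_diff i)
      show "(\<lambda>t. M * dist w v * exp (\<kappa> * t)) integrable_on {0..?b}"
        by (intro integrable_continuous_real continuous_intros)
      fix t assume t: "t \<in> {0..?b}"
      have "norm (?G w t - ?G v t) \<le> M * norm (exp (\<kappa> * t) *\<^sub>R apply_bcontfun w t - exp (\<kappa> * t) *\<^sub>R apply_bcontfun v t)"
        using t sub by (intro lip) auto
      also have "\<dots> = M * (exp (\<kappa> * t) * dist (apply_bcontfun w t) (apply_bcontfun v t))"
        by (simp add: scaleR_diff_right[symmetric] dist_norm)
      also have "\<dots> \<le> M * (exp (\<kappa> * t) * dist w v)"
        using M by (intro mult_left_mono dist_bounded) auto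
      finally show "norm (?G w t - ?G v t) \<le> M * dist w v * exp (\<kappa> * t)" by (simp add: mult_ac)
    qed
    also have "\<dots> = M * dist w v * integral {0..?b} (\<lambda>t. exp (\<kappa> * t))" by simp
    also have "\<dots> \<le> M * dist w v * (exp (\<kappa> * ?b) / \<kappa>)"
      using M l c(1)[of x] by (intro mult_left_mono integral_exp_le) auto
    finally have le: "norm (integral {0..?b} (?G w) - integral {0..?b} (?G v)) \<le> exp (\<kappa> * ?b) * (dist w v / 2)"
      using M by (simp add: \<kappa>_def mult_ac)
    have "dist (V w ?b) (V v ?b) = exp (- \<kappa> * ?b) * norm (integral {0..?b} (?G w) - integral {0..?b} (?G v))"
      by (simp add: V_def dist_norm scaleR_diff_right[symmetric])
    also have "\<dots> \<le> exp (- \<kappa> * ?b) * (exp (\<kappa> * ?b) * (dist w v / 2))"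
      using le by (intro mult_left_mono) auto
    finally show "dist (apply_bcontfun (T w) x) (apply_bcontfun (T v) x) \<le> 1 / 2 * dist w v"
      by (simp add: T exp_minus field_simps)
  qed
  then obtain w where w: "T w = w" using banach_fix_type[of "1/2" T] by auto
  define y where "y t = exp (\<kappa> * t) *\<^sub>R apply_bcontfun w t" for t
  have "y x = integral {0..x} (\<lambda>t. F t (y t))" if x: "x \<in> {0..1}" for x
  proof -
    have "apply_bcontfun w x = V w x" using T[of w x] w c(2)[OF x] by simp
    then show ?thesis unfolding y_def V_def by (simp add: exp_minus)
  qed
  moreover have "continuous_on {0..1} y" unfolding y_def by (intro continuous_intros) auto
  ultimately show ?thesis by blast
qed

lemma norm_Pair_le_add: "norm (a, b) \<le> norm a + norm b"
  by (simp add: norm_Pair sqrt_sum_squares_le_sum)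

text \<open>Below \<open>d\<close> the singular coefficient \<open>1 / x\<^sup>2\<close> is frozen
  at \<open>1 / d\<^sup>2\<close>, which leaves a linear system with continuous coefficients and
  zero initial data. The original equation holds nevertheless: beyond \<open>d\<close> the
  coefficients agree, and up to \<open>d\<close> both \<open>f\<close> and the solution
  vanish.\<close>

lemma cutoff_ode_solution:
  fixes W f :: "real \<Rightarrow> complex"
  assumes W: "continuous_on {0..1} W" "\<And>x. x \<in> {0..1} \<Longrightarrow> norm (W x) \<le> Wb" and f: "continuous_on {0..1} f"
    and d: "0 < d" "d < 1" and f0: "\<And>x. x \<in> {0..d} \<Longrightarrow> f x = 0" and s: "norm s \<le> R"
  shows "\<exists>z p q. (\<forall>x\<in>{0..1}. (z has_vector_derivative p x) (at x within {0..1}) \<and>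
        (p has_vector_derivative q x) (at x within {0..1}) \<and>
        of_real (x\<^sup>2) * q x + (of_real (2*x) + s) * p x - W x * z x = f x \<and>
        norm (z x) \<le> 2 / d\<^sup>2 * exp (2 * (1 + (2 + R + Wb) / d\<^sup>2)) * integral {0..1} (\<lambda>t. norm (f t)) \<and>
        norm (p x) \<le> 2 / d\<^sup>2 * exp (2 * (1 + (2 + R + Wb) / d\<^sup>2)) * integral {0..1} (\<lambda>t. norm (f t)) \<and>
        norm (q x) \<le> (norm (f x) + (2 + R) * norm (p x) + Wb * norm (z x)) / d\<^sup>2) \<and>
      (\<forall>x\<in>{0..d}. z x = 0)"
proof -
  define m where "m x = 1 / (max x d)\<^sup>2" for x
  have mpos: "m x > 0" "m x \<le> 1 / d\<^sup>2" for x
    using d by (auto simp: m_def intro!: divide_left_mono power_mono zero_less_power)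
  have mc: "continuous_on {0..1} m" unfolding m_def using d by (intro continuous_intros) auto
  define Q where "Q t z p = of_real (m t) * (f t - (of_real (2*t) + s) * p + W t * z)" for t z p
  define F where "F t y = (snd y, Q t (fst y) (snd y))" for t y
  \<comment> \<open>The summand 1 is the Lipschitz constant of the first component of
    \<open>F\<close>, the quotient that of the second.\<close>
  define M where "M = 1 + (2 + R + Wb) / d\<^sup>2"
  have Wb: "Wb \<ge> 0" using order_trans[OF norm_ge_zero W(2)[of 0]] by simp
  have R: "R \<ge> 0" using s norm_ge_zero[of s] by linarith
  have M: "M > 0" unfolding M_def using Wb R d by (auto intro!: add_pos_nonneg)
  have Qn: "norm (Q t z p - of_real (m t) * f t) \<le> ((2 + R) * norm p + Wb * norm z) / d\<^sup>2" if t: "t \<in> {0..1}" for t z p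
  proof -
    have "norm (Q t z p - of_real (m t) * f t) = m t * norm (W t * z - (of_real (2*t) + s) * p)"
    proof -
      have "Q t z p - of_real (m t) * f t = of_real (m t) * (W t * z - (of_real (2*t) + s) * p)"
        unfolding Q_def by (simp add: algebra_simps)
      then show ?thesis using mpos(1)[of t] by (simp add: norm_mult)
    qed
    also have "\<dots> \<le> (1 / d\<^sup>2) * (norm (W t * z) + norm ((of_real (2*t) + s) * p))"
      using mpos[of t] d by (intro mult_mono norm_triangle_ineq4) auto
    also have "\<dots> \<le> (1 / d\<^sup>2) * (Wb * norm z + (2 + R) * norm p)"
    proof (intro mult_left_mono add_mono)
      show "norm (W t * z) \<le> Wb * norm z" using W(2)[OF t] by (simp add: norm_mult mult_right_mono)
      have "norm (of_real (2*t) + s) \<le> 2 + R"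
        using norm_triangle_ineq[of "of_real (2*t)" s] t s by (simp add: norm_mult)
      then show "norm ((of_real (2*t) + s) * p) \<le> (2 + R) * norm p" by (simp add: norm_mult mult_right_mono)
    qed (use d in auto)
    finally show ?thesis by (simp add: add.commute)
  qed
  have norm_fst: "norm (fst y) \<le> norm y" and norm_snd: "norm (snd y) \<le> norm y" for y :: "complex \<times> complex"
    using norm_fst_le[of "fst y" "snd y"] norm_snd_le[of "snd y" "fst y"] by simp_all
  have Fn: "norm (F t y - (0, of_real (m t) * f t)) \<le> M * norm y" if t: "t \<in> {0..1}" for t y
  proof -
    have "norm (F t y - (0, of_real (m t) * f t)) \<le> norm (snd y) + norm (Q t (fst y) (snd y) - of_real (m t) * f t)"
      unfolding F_def using norm_Pair_le_add[of "snd y" "Q t (fst y) (snd y) - of_real (m t) * f t"] by simp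
    also have "\<dots> \<le> norm y + ((2 + R) * norm y + Wb * norm y) / d\<^sup>2"
      using Qn[OF t, of "fst y" "snd y"] R Wb
      by (intro add_mono order_trans[OF Qn[OF t]] divide_right_mono mult_left_mono)
         (auto simp: norm_fst norm_snd)
    finally show ?thesis unfolding M_def by (simp add: field_simps)
  qed
  have lip: "norm (F t y - F t y') \<le> M * norm (y - y')" if t: "t \<in> {0..1}" for t y y'
  proof -
    \<comment> \<open>\<open>F t\<close> is affine with constant part
      \<open>(0, of_real (m t) * f t)\<close>, so the growth bound \<open>Fn\<close> at
      \<open>y - y'\<close> is the Lipschitz bound.\<close>
    have "F t y - F t y' = F t (y - y') - (0, of_real (m t) * f t)"
      unfolding F_def Q_def by (simp add: algebra_simps)
    then show ?thesis using Fn[OF t] by simp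
  qed
  have Fc: "continuous_on {0..1} (\<lambda>t. F t (y t))" if "continuous_on {0..1} y" for y
    unfolding F_def Q_def by (intro continuous_intros that W f mc)
  obtain y where y: "continuous_on {0..1} y" "\<And>x. x \<in> {0..1} \<Longrightarrow> y x = integral {0..x} (\<lambda>t. F t (y t))"
    using lipschitz_ode_exists[of F M] Fc lip M by blast
  have dy: "(y has_vector_derivative F x (y x)) (at x within {0..1})" if x: "x \<in> {0..1}" for x
    by (rule has_vector_derivative_transform[OF x y(2) integral_has_vector_derivative[OF Fc[OF y(1)] x]])
  have yn: "norm (y x) \<le> B + M * integral {0..x} (\<lambda>t. norm (y t))"
    if x: "x \<in> {0..1}" and B: "integral {0..x} (\<lambda>t. norm (f t)) / d\<^sup>2 \<le> B" for x B
  proof -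
    have sub: "{0..x} \<subseteq> {0..1}" using x by auto
    have ci: "g integrable_on {0..x}" if "continuous_on {0..1} g" for g :: "real \<Rightarrow> real"
      using continuous_on_subset[OF that sub] by (rule integrable_continuous_real)
    have "norm (y x) \<le> integral {0..x} (\<lambda>t. norm (f t) / d\<^sup>2 + M * norm (y t))"
      unfolding y(2)[OF x]
    proof (rule integral_norm_bound_integral)
      show "(\<lambda>t. F t (y t)) integrable_on {0..x}"
        by (intro integrable_continuous_real continuous_on_subset[OF Fc[OF y(1)] sub])
      show "(\<lambda>t. norm (f t) / d\<^sup>2 + M * norm (y t)) integrable_on {0..x}"
        using d by (intro ci continuous_intros f y) auto
      fix t assume "t \<in> {0..x}"
      then have t: "t \<in> {0..1}" using sub by auto
      have "norm (F t (y t)) \<le> norm (0::complex, of_real (m t) * f t) + norm (F t (y t) - (0, of_real (m t) * f t))"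
        by (rule norm_triangle_sub)
      also have "norm (0::complex, of_real (m t) * f t) \<le> norm (f t) / d\<^sup>2"
        using mpos[of t] mult_right_mono[OF mpos(2)[of t], of "norm (f t)"] by (simp add: norm_Pair norm_mult)
      finally show "norm (F t (y t)) \<le> norm (f t) / d\<^sup>2 + M * norm (y t)" using Fn[OF t, of "y t"] by simp
    qed
    also have "\<dots> = integral {0..x} (\<lambda>t. norm (f t)) / d\<^sup>2 + M * integral {0..x} (\<lambda>t. norm (y t))"
      using d by (subst integral_add) (auto intro!: ci continuous_intros f y)
    finally show ?thesis using B by simp
  qed
  \<comment> \<open>Gronwall's inequality on \<open>{0..d}\<close> with \<open>B = 0\<close>, since
    \<open>f\<close> vanishes there.\<close>
  have y0: "y x = 0" if "x \<in> {0..d}" for x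
  proof -
    have "integral {0..x} (\<lambda>t. norm (f t)) = integral {0..x} (\<lambda>t. 0)" if "x \<in> {0..d}" for x
      by (rule integral_cong) (use f0 that in auto)
    then have "norm (y x) \<le> 2 * 0 * exp (2 * M * x)"
      using yn[of _ 0] d M that
      by (intro gronwall[where T=d and \<phi>="\<lambda>x. norm (y x)"] continuous_intros continuous_on_subset[OF y(1)]) auto
    then show ?thesis by simp
  qed
  have yb: "norm (y x) \<le> 2 / d\<^sup>2 * exp (2 * M) * integral {0..1} (\<lambda>t. norm (f t))" if x: "x \<in> {0..1}" for x
  proof -
    let ?I = "integral {0..1} (\<lambda>t. norm (f t))"
    have fi: "(\<lambda>t. norm (f t)) integrable_on {0..1}"
      using f by (intro integrable_continuous_real continuous_intros)
    have I: "?I \<ge> 0" by (intro integral_nonneg fi) auto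
    have "integral {0..x} (\<lambda>t. norm (f t)) \<le> ?I" if "x \<in> {0..1}" for x
      using that f by (intro integral_subset_le fi integrable_continuous_real continuous_intros)
        (auto intro: continuous_on_subset)
    then have "norm (y x) \<le> 2 * (?I / d\<^sup>2) * exp (2 * M * x)"
      using yn M I d x
      by (intro gronwall[where T=1 and \<phi>="\<lambda>x. norm (y x)"] continuous_intros y(1)) (auto simp: divide_right_mono)
    also have "\<dots> \<le> 2 * (?I / d\<^sup>2) * exp (2 * M)"
      using x M I by (intro mult_left_mono) auto
    finally show ?thesis by (simp add: mult_ac)
  qed
  define z p q where "z x = fst (y x)" and "p x = snd (y x)" and "q x = Q x (z x) (p x)" for x
  have "(z has_vector_derivative p x) (at x within {0..1})" "(p has_vector_derivative q x) (at x within {0..1})"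
    if x: "x \<in> {0..1}" for x
    using bounded_linear.has_vector_derivative[OF bounded_linear_fst dy[OF x]]
      bounded_linear.has_vector_derivative[OF bounded_linear_snd dy[OF x]]
    by (simp_all add: F_def z_def[abs_def] p_def[abs_def] q_def)
  moreover have "of_real (x\<^sup>2) * q x + (of_real (2*x) + s) * p x - W x * z x = f x" if x: "x \<in> {0..1}" for x
  proof (cases "x \<le> d")
    case True then show ?thesis using y0[of x] f0[of x] x by (simp add: z_def p_def q_def Q_def)
  next
    case False
    then have "complex_of_real (x\<^sup>2) * of_real (m x) = 1" using d by (simp add: m_def flip: of_real_mult)
    then have "of_real (x\<^sup>2) * q x = f x - (of_real (2*x) + s) * p x + W x * z x"
      unfolding q_def Q_def by (simp only: mult.assoc[symmetric]) simp
    then show ?thesis by simp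
  qed
  moreover have "norm (z x) \<le> norm (y x)" "norm (p x) \<le> norm (y x)" for x
    by (auto simp: z_def p_def norm_fst norm_snd)
  moreover have "norm (q x) \<le> (norm (f x) + (2 + R) * norm (p x) + Wb * norm (z x)) / d\<^sup>2" if x: "x \<in> {0..1}" for x
  proof -
    have "norm (q x) \<le> norm (of_real (m x) * f x) + norm (q x - of_real (m x) * f x)" by (rule norm_triangle_sub)
    also have "norm (of_real (m x) * f x) \<le> norm (f x) / d\<^sup>2"
      using mpos[of x] mult_right_mono[OF mpos(2)[of x], of "norm (f x)"] by (simp add: norm_mult)
    finally show ?thesis
      using Qn[OF x, of "z x" "p x"] unfolding q_def by (simp add: add_divide_distrib)
  qed
  moreover have "z x = 0" if "x \<in> {0..d}" for x using y0[OF that] by (simp add: z_def)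
  ultimately show ?thesis
    using yb unfolding M_def by (intro exI[of _ z] exI[of _ p] exI[of _ q]) (meson order_trans)
qed

section \<open>Gevrey regularity of homogeneous solutions\<close>

text \<open>Pascal's rule; it shows that differentiating the Leibniz sum of order \<open>n\<close>
  gives the one of order \<open>n + 1\<close>.\<close>

lemma leibniz_step:
  fixes a b :: "nat \<Rightarrow> 'a::comm_ring_1"
  shows "(\<Sum>j\<le>n. of_nat (n choose j) * (a (Suc j) * b (n - j) + a j * b (Suc (n - j)))) =
    (\<Sum>j\<le>Suc n. of_nat (Suc n choose j) * (a j * b (Suc n - j)))"
proof -
  have "(\<Sum>j\<le>Suc n. of_nat (Suc n choose j) * (a j * b (Suc n - j))) =
      a 0 * b (Suc n) + (\<Sum>j\<le>n. of_nat (n choose Suc j) * (a (Suc j) * b (n - j))) +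
      (\<Sum>j\<le>n. of_nat (n choose j) * (a (Suc j) * b (n - j)))"
    by (subst sum.atMost_Suc_shift) (simp add: algebra_simps sum.distrib)
  also have "a 0 * b (Suc n) + (\<Sum>j\<le>n. of_nat (n choose Suc j) * (a (Suc j) * b (n - j))) =
      (\<Sum>j\<le>Suc n. of_nat (n choose j) * (a j * b (Suc n - j)))"
    by (subst sum.atMost_Suc_shift) simp
  also have "\<dots> = (\<Sum>j\<le>n. of_nat (n choose j) * (a j * b (Suc (n - j))))"
    by (simp add: Suc_diff_le binomial_eq_0)
  finally show ?thesis by (simp add: algebra_simps sum.distrib)
qed

text \<open>The derivatives of a solution \<open>v\<close> with \<open>v' = p\<close> of the homogeneous equation, as the
  differentiated equation prescribes them away from the origin.\<close>
fun hder :: "(real \<Rightarrow> complex) \<Rightarrow> complex \<Rightarrow> (real \<Rightarrow> complex) \<Rightarrow> (real \<Rightarrow> complex) \<Rightarrow> nat \<Rightarrow> real \<Rightarrow> complex" where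
  "hder W s v p 0 x = v x"
| "hder W s v p (Suc 0) x = p x"
| "hder W s v p (Suc (Suc n)) x = inverse (x\<^sup>2) *\<^sub>R
     ((\<Sum>j\<le>n. of_nat (n choose j) * (dn j W x * hder W s v p (n - j) x)) -
      (of_real (2 * real (n + 1) * x) + s) * hder W s v p (Suc n) x -
      of_nat (n * (n + 1)) * hder W s v p n x)"

text \<open>The induction is strong because the recursion being differentiated involves all lower
  orders. Order 1 is the equation solved for \<open>q\<close>, which requires
  \<open>x \<noteq> 0\<close>.\<close>

lemma hder_has_derivative:
  assumes W: "smooth01 W"
    and v: "\<And>x. x \<in> {0..1} \<Longrightarrow> (v has_vector_derivative p x) (at x within {0..1})"
    and p: "\<And>x. x \<in> {0..1} \<Longrightarrow> (p has_vector_derivative q x) (at x within {0..1})"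
    and ode: "\<And>x. x \<in> {0..1} \<Longrightarrow> of_real (x\<^sup>2) * q x + (of_real (2*x) + s) * p x - W x * v x = 0"
    and x: "x \<in> {0<..1}"
  shows "(hder W s v p n has_vector_derivative hder W s v p (Suc n) x) (at x within {0..1})"
proof (induction n rule: less_induct)
  case (less n)
  let ?h = "hder W s v p"
  have x': "x \<in> {0..1}" "x \<noteq> 0" using x by auto
  consider "n = 0" | "n = 1" | k where "n = Suc (Suc k)" by (metis One_nat_def not0_implies_Suc)
  then show ?case
  proof cases
    case 1
    have "?h 0 = v" "?h (Suc 0) = p" by auto
    then show ?thesis using v[OF x'(1)] 1 by simp
  next
    case 2
    have "?h (Suc 0) = p" by auto
    have "of_real (x\<^sup>2) * q x = W x * v x - (of_real (2*x) + s) * p x"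
      using ode[OF x'(1)] by (simp add: algebra_simps)
    then have "x\<^sup>2 *\<^sub>R q x = W x * v x - (of_real (2*x) + s) * p x"
      by (simp add: scaleR_conv_of_real)
    then have "inverse (x\<^sup>2) *\<^sub>R (x\<^sup>2 *\<^sub>R q x) = ?h (Suc (Suc 0)) x" by simp
    then have "q x = ?h (Suc (Suc 0)) x" using x'(2) by simp
    then show ?thesis using p[OF x'(1)] 2 \<open>?h (Suc 0) = p\<close> by simp
  next
    case (3 k)
    define num where "num k x = (\<Sum>j\<le>k. of_nat (k choose j) * (dn j W x * ?h (k - j) x)) -
      (of_real (2 * real (k + 1) * x) + s) * ?h (Suc k) x - of_nat (k * (k + 1)) * ?h k x" for k x
    have hnum: "?h (Suc (Suc k)) = (\<lambda>x. inverse (x\<^sup>2) *\<^sub>R num k x)" for k by (auto simp: num_def)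
    define num' where "num' = (\<Sum>j\<le>k. of_nat (k choose j) * (dn (Suc j) W x * ?h (k - j) x + dn j W x * ?h (Suc (k - j)) x)) -
      (of_real (2 * real (k + 1)) * ?h (Suc k) x + (of_real (2 * real (k + 1) * x) + s) * ?h (Suc (Suc k)) x) -
      of_nat (k * (k + 1)) * ?h (Suc k) x"
    have lin: "((\<lambda>x. complex_of_real (2 * real (k + 1) * x) + s) has_vector_derivative of_real (2 * real (k + 1))) (at x within {0..1})"
    proof -
      have "((\<lambda>x. 2 * real (k + 1) * x) has_real_derivative 2 * real (k + 1)) (at x within {0..1})"
        by (auto intro!: derivative_eq_intros)
      from has_vector_derivative_add[OF has_vector_derivative_of_real[OF this] has_vector_derivative_const[of s]]
      show ?thesis by simp
    qed
    have "(num k has_vector_derivative num') (at x within {0..1})"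
    proof -
      have IH: "(?h i has_vector_derivative ?h (Suc i) x) (at x within {0..1})" if "i \<le> Suc k" for i
        using less[of i] that 3 by simp
      have a: "((\<lambda>x. of_nat (k choose j) * (dn j W x * ?h (k - j) x)) has_vector_derivative
          of_nat (k choose j) * (dn (Suc j) W x * ?h (k - j) x + dn j W x * ?h (Suc (k - j)) x)) (at x within {0..1})" for j
        using has_vector_derivative_mult_right[OF has_vector_derivative_mult[OF dn_has_derivative[OF W x'(1), of j] IH[of "k - j"]],
            of "of_nat (k choose j)"] by (simp add: algebra_simps)
      have b: "((\<lambda>x. (of_real (2 * real (k + 1) * x) + s) * ?h (Suc k) x) has_vector_derivative
          of_real (2 * real (k + 1)) * ?h (Suc k) x + (of_real (2 * real (k + 1) * x) + s) * ?h (Suc (Suc k)) x) (at x within {0..1})"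
        using has_vector_derivative_mult[OF lin IH[of "Suc k"]] by (simp add: add.commute)
      show ?thesis
        unfolding num_def num'_def
        by (intro has_vector_derivative_diff has_vector_derivative_sum a b)
           (rule has_vector_derivative_mult_right, rule IH, simp)
    qed
    then have "(?h (Suc (Suc k)) has_vector_derivative
        inverse (x\<^sup>2) *\<^sub>R num' + (- 2 * inverse (x ^ 3)) *\<^sub>R num k x) (at x within {0..1})"
      unfolding hnum using x'(2)
      by (intro has_vector_derivative_scaleR)
         (auto intro!: derivative_eq_intros simp: power2_eq_square power3_eq_cube field_simps)
    moreover have "inverse (x\<^sup>2) *\<^sub>R num' + (- 2 * inverse (x ^ 3)) *\<^sub>R num k x = ?h (Suc (Suc (Suc k))) x"
    proof -
      have "(- 2 * inverse (x ^ 3)) *\<^sub>R num k x = inverse (x\<^sup>2) *\<^sub>R (- of_real (2 * x) * ?h (Suc (Suc k)) x)"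
        unfolding hnum using x'(2) by (simp add: scaleR_conv_of_real field_simps power2_eq_square power3_eq_cube)
      \<comment> \<open>The derivative of \<open>inverse (x\<^sup>2)\<close> raises the coefficient
        \<open>2 * (k + 1) * x\<close> to \<open>2 * (k + 2) * x\<close>; the derivative of that
        linear coefficient adds \<open>2 * (k + 1)\<close> to \<open>k * (k + 1)\<close>, giving
        \<open>(k + 1) * (k + 2)\<close>.\<close>
      moreover have "num' - of_real (2 * x) * ?h (Suc (Suc k)) x = num (Suc k) x"
        unfolding num'_def num_def leibniz_step[of k "\<lambda>j. dn j W x" "\<lambda>j. ?h j x"]
        by (simp add: algebra_simps)
      ultimately show ?thesis
        unfolding hnum[of "Suc k"] by (metis add_uminus_conv_diff mult_minus_left scaleR_right_distrib)
    qed
    ultimately show ?thesis by (simp only: 3)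
  qed
qed

text \<open>Two overlapping regions cover the interval: for \<open>x < d\<close> the function is the
  smooth \<open>u\<close>, and for \<open>x > 0\<close> the family \<open>hder\<close> is a tower of
  derivatives.\<close>

lemma homogeneous_solution_smooth:
  assumes W: "smooth01 W" and u: "smooth01 u" and d: "0 < d"
    and vu: "\<And>x. x \<in> {0..1} \<Longrightarrow> x < d \<Longrightarrow> v x = u x"
    and v: "\<And>x. x \<in> {0..1} \<Longrightarrow> (v has_vector_derivative p x) (at x within {0..1})"
    and p: "\<And>x. x \<in> {0..1} \<Longrightarrow> (p has_vector_derivative q x) (at x within {0..1})"
    and ode: "\<And>x. x \<in> {0..1} \<Longrightarrow> of_real (x\<^sup>2) * q x + (of_real (2*x) + s) * p x - W x * v x = 0"
  shows "smooth01 v"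
    and "\<And>x n. x \<in> {0<..1} \<Longrightarrow> dn n v x = hder W s v p n x"
    and "\<And>x n. x \<in> {0..1} \<Longrightarrow> x < d \<Longrightarrow> dn n v x = dn n u x"
proof -
  have hd: "(hder W s v p n has_vector_derivative hder W s v p (Suc n) x) (at x within {0..1})"
    if "x \<in> {0<..1}" for n x
    by (rule hder_has_derivative[where q=q, OF W _ _ _ that]) (use v p ode in auto)
  have near: "(dn n v has_vector_derivative hder W s v p (Suc n) x) (at x within {0..1})"
    if x: "x \<in> {0<..1}" and eq: "\<And>x. x \<in> {0<..1} \<Longrightarrow> dn n v x = hder W s v p n x" for n x
  proof (rule has_vector_derivative_transform_within[OF hd[OF x]])
    show "0 < x" "x \<in> {0..1}" using x by auto
    show "hder W s v p n y = dn n v y" if "y \<in> {0..1}" "dist y x < x" for y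
      using eq[of y] that by (auto simp: dist_real_def)
  qed
  show eq: "dn n v x = hder W s v p n x" if "x \<in> {0<..1}" for n x
    using that
  proof (induction n arbitrary: x)
    case (Suc n)
    have "vector_derivative (dn n v) (at x within {0..1}) = hder W s v p (Suc n) x"
      using Suc by (intro vector_derivative_within at_within_unit_interval_nontrivial near) auto
    then show ?case by (simp only: dn.simps(2))
  qed simp
  show equ: "dn n v x = dn n u x" if "x \<in> {0..1}" "x < d" for n x
    using that vu by (intro dn_local[of "{..<d}"]) auto
  show "smooth01 v"
    unfolding smooth01_def
  proof (intro allI ballI)
    fix n and x :: real assume x: "x \<in> {0..1}"
    show "dn n v differentiable at x within {0..1}"
    proof (cases "x < d")
      case True
      have "(dn n v has_vector_derivative dn (Suc n) u x) (at x within {0..1})"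
      proof (rule has_vector_derivative_transform_within[OF dn_has_derivative[OF u x]])
        show "0 < d - x" "x \<in> {0..1}" using True x by auto
        show "dn n u y = dn n v y" if "y \<in> {0..1}" "dist y x < d - x" for y
          using equ[of y n] that by (auto simp: dist_real_def)
      qed
      then show ?thesis by (auto simp: differentiable_def has_vector_derivative_def)
    next
      case False
      then have "(dn n v has_vector_derivative hder W s v p (Suc n) x) (at x within {0..1})"
        using x d eq by (intro near) auto
      then show ?thesis by (auto simp: differentiable_def has_vector_derivative_def)
    qed
  qed
qed

section \<open>Growth of derivatives away from the origin\<close>

lemma fact_mult_fact_le: "j \<le> n \<Longrightarrow> fact j * fact (n - j) \<le> (fact n :: real)"
proof -
  assume j: "j \<le> n"
  have "fact j * fact (n - j) \<le> fact j * fact (n - j) * real (n choose j)"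
    using j mult_left_mono[of 1 "real (n choose j)" "fact j * fact (n - j)"] by (simp add: Suc_leI)
  also have "\<dots> = fact n" using binomial_fact_lemma[OF j] by (metis of_nat_fact of_nat_mult)
  finally show ?thesis .
qed

text \<open>The claimed bound may grow by \<open>E (k + 2) / E k = (k + 1)\<^sup>2 * (k + 2)\<^sup>2
  / \<tau>\<^sup>2\<close> over two orders, whereas the right-hand side of the recursion produces
  only a cubic factor in \<open>k + 1\<close>. The spare power absorbs \<open>1 / d\<^sup>2\<close>
  and all constants for large \<open>k\<close>, so the radius \<open>\<tau>\<close> is kept.\<close>

lemma recursion_gevrey_bound:
  fixes g w :: "nat \<Rightarrow> real \<Rightarrow> complex"
  assumes d: "0 < d" and \<tau>: "\<tau> > 0" and C: "C \<ge> 0"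
    and cont: "\<And>n. continuous_on {d..1} (g n)"
    and w: "\<And>n x. x \<in> {d..1} \<Longrightarrow> norm (w n x) \<le> C * (1 / \<tau>) ^ n * (fact n)\<^sup>2"
    and rec: "\<And>n x. x \<in> {d..1} \<Longrightarrow> g (Suc (Suc n)) x = inverse (x\<^sup>2) *\<^sub>R
       ((\<Sum>j\<le>n. of_nat (n choose j) * (w j x * g (n - j) x)) -
      (of_real (2 * real (n + 1) * x) + s) * g (Suc n) x - of_nat (n * (n + 1)) * g n x)"
  shows "\<exists>A\<ge>0. \<forall>n. \<forall>x\<in>{d..1}. norm (g n x) \<le> A * (1 / \<tau>) ^ n * (fact n)\<^sup>2"
proof -
  define E where "E n = (1 / \<tau>) ^ n * (fact n :: real)\<^sup>2" for n
  have Epos: "E n > 0" for n unfolding E_def using \<tau> by simp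
  have ES: "E (Suc n) = E n * ((real n + 1)\<^sup>2 / \<tau>)" for n
    unfolding E_def by (simp add: power_mult_distrib mult_ac add.commute)
  have "\<exists>b. \<forall>x\<in>{d..1}. norm (g n x) \<le> b" for n
    using compact_imp_bounded[OF compact_continuous_image[OF cont[of n]]] unfolding bounded_iff by auto
  then obtain b where b: "\<And>n x. x \<in> {d..1} \<Longrightarrow> norm (g n x) \<le> b n" by metis
  \<comment> \<open>With \<open>m = k + 1\<close>, this choice gives \<open>C + (2 + norm s) *
    m\<^sup>2 / \<tau> + k \<le> m\<^sup>2 * (c / \<tau>\<^sup>2)\<close>; from \<open>n0\<close>
    on, moreover, \<open>c \<le> d\<^sup>2 * k\<close>.\<close>
  define c where "c = \<tau> * (2 + norm s) + \<tau>\<^sup>2 + C * \<tau>\<^sup>2"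
  obtain n0 where n0: "c / d\<^sup>2 \<le> real n0" using real_arch_simple by blast
  \<comment> \<open>The orders below \<open>n0 + 2\<close> are bounded by compactness, and the sum
    of their ratios to \<open>E\<close> majorises each of them.\<close>
  define A where "A = (\<Sum>k<n0 + 2. \<bar>b k\<bar> / E k)"
  have A: "A \<ge> 0" unfolding A_def by (intro sum_nonneg) (auto simp: Epos less_imp_le)
  have "norm (g n x) \<le> A * E n" if x: "x \<in> {d..1}" for n x
  proof (induction n rule: less_induct)
    case (less n)
    show ?case
    proof (cases "n < n0 + 2")
      case True
      have "\<bar>b n\<bar> / E n \<le> A"
        unfolding A_def using True by (intro member_le_sum) (auto simp: Epos less_imp_le)
      then have "\<bar>b n\<bar> \<le> A * E n" using Epos[of n] by (simp add: field_simps)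
      then show ?thesis using b[OF x, of n] by linarith
    next
      case False
      then obtain k where k: "n = Suc (Suc k)" "k \<ge> n0" by (metis add_2_eq_Suc' le_Suc_ex not_less plus_nat.simps(2) add.commute le_add1)
      have xd: "x > 0" "d\<^sup>2 \<le> x\<^sup>2" "x \<le> 1" using x d by (auto intro: power_mono)
      have IH: "norm (g i x) \<le> A * E i" if "i \<le> Suc k" for i using less[of i] that k by simp
      let ?S = "\<Sum>j\<le>k. of_nat (k choose j) * (w j x * g (k - j) x)"
      \<comment> \<open>The binomial coefficient times the squares of \<open>fact j\<close> and
        \<open>fact (k - j)\<close> equals \<open>fact k * fact j * fact (k - j)\<close>, at most
        \<open>(fact k)\<^sup>2\<close>; the factor \<open>real k + 1\<close> counts the
        summands.\<close>
      have S: "norm ?S \<le> (real k + 1) * (C * A * E k)"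
      proof -
        have "norm ?S \<le> (\<Sum>j\<le>k. C * A * E k)"
        proof (rule sum_norm_le)
          fix j assume "j \<in> {..k}"
          then have j: "j \<le> k" by simp
          have "norm (of_nat (k choose j) * (w j x * g (k - j) x)) \<le> real (k choose j) * ((C * E j) * (A * E (k - j)))"
            unfolding norm_mult norm_of_nat using w[OF x, of j] IH[of "k - j"] C Epos[of j]
            by (intro mult_left_mono mult_mono) (auto simp: E_def mult.assoc)
          also have "\<dots> = C * A * ((1/\<tau>) ^ k * (real (k choose j) * (fact j * fact (k - j)) * (fact j * fact (k - j))))"
            unfolding E_def using j by (simp add: power2_eq_square mult_ac flip: power_add)
          also have "real (k choose j) * (fact j * fact (k - j)) = fact k"
            using binomial_fact_lemma[OF j] by (metis mult.commute of_nat_fact of_nat_mult)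
          also have "C * A * ((1/\<tau>) ^ k * (fact k * (fact j * fact (k - j)))) \<le> C * A * ((1/\<tau>) ^ k * (fact k * fact k))"
            using C A \<tau> by (intro mult_left_mono fact_mult_fact_le j) auto
          finally show "norm (of_nat (k choose j) * (w j x * g (k - j) x)) \<le> C * A * E k"
            by (simp add: E_def power2_eq_square)
        qed
        then show ?thesis by (simp add: add.commute)
      qed
      have L: "norm ((of_real (2 * real (k + 1) * x) + s) * g (Suc k) x) \<le> (real k + 1) * (2 + norm s) * (A * E (Suc k))"
        unfolding norm_mult
      proof (intro mult_mono IH)
        have "norm (complex_of_real (2 * real (k + 1) * x) + s) \<le> 2 * real (k + 1) * x + norm s"
          using norm_triangle_ineq[of "complex_of_real (2 * real (k + 1) * x)" s]
            norm_of_real[of "2 * real (k + 1) * x", where 'a=complex]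
            abs_of_nonneg[of "2 * real (k + 1) * x"] xd(1) by simp
        also have "\<dots> \<le> 2 * real (k + 1) * 1 + (real k + 1) * norm s"
          using xd by (intro add_mono mult_left_mono) (auto simp: algebra_simps)
        finally show "norm (complex_of_real (2 * real (k + 1) * x) + s) \<le> (real k + 1) * (2 + norm s)"
          by (simp add: algebra_simps)
      qed auto
      have N: "norm (of_nat (k * (k + 1)) * g k x) \<le> (real k * (real k + 1)) * (A * E k)"
        unfolding norm_mult norm_of_nat using IH[of k] by (intro mult_mono) (auto simp: algebra_simps)
      have "x\<^sup>2 * norm (g n x) = norm (?S - (of_real (2 * real (k + 1) * x) + s) * g (Suc k) x - of_nat (k * (k + 1)) * g k x)"
        unfolding k(1) rec[OF x] using xd by simp
      also have "\<dots> \<le> norm ?S + norm ((of_real (2 * real (k + 1) * x) + s) * g (Suc k) x) + norm (of_nat (k * (k + 1)) * g k x)"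
        by (intro order_trans[OF norm_triangle_ineq4] add_mono norm_triangle_ineq4) auto
      also have "\<dots> \<le> (real k + 1) * (C * A * E k) + (real k + 1) * (2 + norm s) * (A * E (Suc k)) + (real k * (real k + 1)) * (A * E k)"
        by (intro add_mono S L N)
      also have "\<dots> = A * E k * ((real k + 1) * (C + (2 + norm s) * (real k + 1)\<^sup>2 / \<tau> + real k))"
        unfolding ES by (simp add: algebra_simps add_divide_distrib)
      also have "\<dots> \<le> A * E k * ((real k + 1)\<^sup>2 * (d\<^sup>2 * (real k + 2)\<^sup>2) / \<tau>\<^sup>2)"
      proof (intro mult_left_mono)
        let ?m = "real k + 1"
        have m: "1 \<le> ?m" "1 \<le> ?m\<^sup>2" "?m \<le> ?m\<^sup>2" by (auto simp: power2_eq_square algebra_simps)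
        have "C + (2 + norm s) * ?m\<^sup>2 / \<tau> + real k \<le> C * ?m\<^sup>2 + (2 + norm s) * ?m\<^sup>2 / \<tau> + 1 * ?m\<^sup>2"
          using m C by (intro add_mono) (auto simp: mult_le_cancel_left1)
        also have "\<dots> = ?m\<^sup>2 * (c / \<tau>\<^sup>2)" unfolding c_def using \<tau> by (simp add: field_simps power2_eq_square)
        finally have "?m * (C + (2 + norm s) * ?m\<^sup>2 / \<tau> + real k) \<le> ?m * (?m\<^sup>2 * (c / \<tau>\<^sup>2))"
          by (intro mult_left_mono) auto
        also have "\<dots> = ?m\<^sup>2 * (c * ?m / \<tau>\<^sup>2)" by simp
        also have "\<dots> \<le> ?m\<^sup>2 * (d\<^sup>2 * (real k + 2)\<^sup>2 / \<tau>\<^sup>2)"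
        proof (intro mult_left_mono divide_right_mono)
          have "c / d\<^sup>2 \<le> real k" using n0 k(2) by simp
          then have "c \<le> d\<^sup>2 * real k" using d by (simp add: pos_divide_le_eq mult.commute)
          then have "c * ?m \<le> (d\<^sup>2 * (real k + 2)) * (real k + 2)"
            using d by (intro mult_mono) (auto simp: algebra_simps add_increasing2)
          then show "c * ?m \<le> d\<^sup>2 * (real k + 2)\<^sup>2" by (simp add: power2_eq_square mult.assoc)
        qed auto
        finally show "?m * (C + (2 + norm s) * ?m\<^sup>2 / \<tau> + real k) \<le> ?m\<^sup>2 * (d\<^sup>2 * (real k + 2)\<^sup>2) / \<tau>\<^sup>2" by simp
      qed (use A Epos[of k] in auto)
      also have "\<dots> = d\<^sup>2 * (A * E n)"
        unfolding k(1) ES using \<tau> by (simp add: field_simps power2_eq_square)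
      finally have "x\<^sup>2 * norm (g n x) \<le> d\<^sup>2 * (A * E n)" .
      moreover have "d\<^sup>2 * norm (g n x) \<le> x\<^sup>2 * norm (g n x)" using xd by (intro mult_right_mono) auto
      ultimately have "d\<^sup>2 * norm (g n x) \<le> d\<^sup>2 * (A * E n)" by linarith
      then show ?thesis using d by simp
    qed
  qed
  then show ?thesis using A unfolding E_def by (auto simp: mult.assoc)
qed

section \<open>The uniform estimate\<close>

text \<open>Solving the equation for the second derivative leaves a multiple of \<open>f x\<close>,
  which has no pointwise bound by its \<open>L\<^sup>2\<close> norm. Splitting that square produces
  \<open>2 / e\<^sup>2\<close> and two of the four \<open>P\<^sup>2\<close>; \<open>u\<close> and
  its first derivative give the others.\<close>

lemma H2norm_le:
  assumes u: "smooth01 u" and f: "continuous_on {0..1} f" and P: "P \<ge> 0" and e: "e > 0"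
    and b: "\<And>x. x \<in> {0..1} \<Longrightarrow> norm (u x) \<le> P * L2norm f"
      "\<And>x. x \<in> {0..1} \<Longrightarrow> norm (dn 1 u x) \<le> P * L2norm f"
      "\<And>x. x \<in> {0..1} \<Longrightarrow> norm (dn 2 u x) \<le> norm (f x) / e + P * L2norm f"
  shows "H2norm u \<le> sqrt (4 * P\<^sup>2 + 2 / e\<^sup>2) * L2norm f"
proof -
  let ?N = "L2norm f"
  have fi: "(\<lambda>x. (norm (f x))\<^sup>2) integrable_on {0..1}"
    using f by (intro integrable_continuous_real continuous_intros)
  have N: "?N\<^sup>2 = integral {0..1} (\<lambda>x. (norm (f x))\<^sup>2)" "?N \<ge> 0"
    using integral_nonneg[OF fi] by (auto simp: L2norm_def)
  have "integral {0..1} (\<lambda>x. (norm (u x))\<^sup>2 + (norm (dn 1 u x))\<^sup>2 + (norm (dn 2 u x))\<^sup>2) \<le>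
      integral {0..1} (\<lambda>x. 2 / e\<^sup>2 * (norm (f x))\<^sup>2 + 4 * P\<^sup>2 * ?N\<^sup>2)"
  proof (rule integral_le)
    show "(\<lambda>x. (norm (u x))\<^sup>2 + (norm (dn 1 u x))\<^sup>2 + (norm (dn 2 u x))\<^sup>2) integrable_on {0..1}"
      by (intro integrable_continuous_real continuous_intros dn_continuous smooth01_continuous u)
    show "(\<lambda>x. 2 / e\<^sup>2 * (norm (f x))\<^sup>2 + 4 * P\<^sup>2 * ?N\<^sup>2) integrable_on {0..1}"
      using f by (intro integrable_continuous_real continuous_intros)
    fix x :: real assume x: "x \<in> {0..1}"
    have "(norm (u x))\<^sup>2 \<le> (P * ?N)\<^sup>2" "(norm (dn 1 u x))\<^sup>2 \<le> (P * ?N)\<^sup>2"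
      "(norm (dn 2 u x))\<^sup>2 \<le> (norm (f x) / e + P * ?N)\<^sup>2"
      by (intro power_mono b x norm_ge_zero)+
    moreover have "(norm (f x) / e + P * ?N)\<^sup>2 \<le> 2 * (norm (f x) / e)\<^sup>2 + 2 * (P * ?N)\<^sup>2"
      using zero_le_power2[of "norm (f x) / e - P * ?N"] by (simp add: power2_eq_square algebra_simps)
    ultimately show "(norm (u x))\<^sup>2 + (norm (dn 1 u x))\<^sup>2 + (norm (dn 2 u x))\<^sup>2 \<le> 2 / e\<^sup>2 * (norm (f x))\<^sup>2 + 4 * P\<^sup>2 * ?N\<^sup>2"
      by (simp add: power_mult_distrib power_divide)
  qed
  also have "\<dots> = 2 / e\<^sup>2 * ?N\<^sup>2 + 4 * P\<^sup>2 * ?N\<^sup>2"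
    unfolding N(1) using integrable_on_cmult_left[OF fi, of "2 / e\<^sup>2"] by (subst integral_add) auto
  finally show ?thesis
    unfolding H2norm_def using N(2) by (intro real_le_lsqrt) (auto simp: power_mult_distrib algebra_simps)
qed

text \<open>The solution is split as \<open>u = z + v\<close>, where \<open>z\<close> solves the regular initial value problem and
  vanishes near the origin. The remainder \<open>v\<close> solves the homogeneous equation and inherits the
  regularity of \<open>u\<close> at the origin, so by injectivity it is a multiple of the homogeneous solution
  \<open>1 + w\<close>.\<close>
lemma solution_decomposition:
  assumes W: "gevrey \<tau> 2 W" and \<sigma>: "0 < \<sigma>" "\<sigma> < \<tau>" and inv: "Linvertible W \<sigma> s"
    and d: "0 < d" "d < 1"
    and u: "u \<in> Dom W \<sigma> s" and Lu: "\<And>x. x \<in> {0..1} \<Longrightarrow> Lop W s u x = f x"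
    and w: "w \<in> Dom W \<sigma> s" and Lw: "\<And>x. x \<in> {0..1} \<Longrightarrow> Lop W s w x = W x"
    and z: "\<And>x. x \<in> {0..1} \<Longrightarrow> (z has_vector_derivative p x) (at x within {0..1})"
    and p: "\<And>x. x \<in> {0..1} \<Longrightarrow> (p has_vector_derivative q x) (at x within {0..1})"
    and ode: "\<And>x. x \<in> {0..1} \<Longrightarrow> of_real (x\<^sup>2) * q x + (of_real (2*x) + s) * p x - W x * z x = f x"
    and z0: "\<And>x. x \<in> {0..d} \<Longrightarrow> z x = 0" and x: "x \<in> {0..1}"
  shows "u x = z x - z 1 * (1 + w x)"
    and "dn 1 u x = p x - z 1 * dn 1 w x"
    and "dn 2 u x = q x - z 1 * dn 2 w x"
proof -
  have Ws: "smooth01 W" using W by (simp add: gevrey_def)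
  have \<tau>: "\<tau> > 0" using \<sigma> by simp
  obtain C where C: "C > 0" "\<And>n x. x \<in> {0..1} \<Longrightarrow> norm (dn n W x) \<le> C * (1 / \<tau>) ^ n * (fact n)\<^sup>2"
    using gevrey_bound[OF W \<tau>] by blast
  note us = Dom_smooth[OF \<sigma>(1) u] and ws = Dom_smooth[OF \<sigma>(1) w]
  have uX: "dn 1 u \<in> Esp 1 \<sigma>" "u 1 = 0" and wX: "dn 1 w \<in> Esp 1 \<sigma>" "w 1 = 0"
    using Dom_X[OF \<sigma>(1) u] Dom_X[OF \<sigma>(1) w] Xsp_iff[OF \<sigma>(1)] by auto
  define v where "v x = u x - z x" for x
  define v1 where "v1 x = dn 1 u x - p x" for x
  define v2 where "v2 x = dn 2 u x - q x" for x
  have dv: "(v has_vector_derivative v1 x) (at x within {0..1})" if "x \<in> {0..1}" for x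
    unfolding v_def v1_def using has_vector_derivative_diff[OF dn_has_derivative[OF us that, of 0] z[OF that]] by simp
  have dv1: "(v1 has_vector_derivative v2 x) (at x within {0..1})" if "x \<in> {0..1}" for x
    unfolding v2_def v1_def
    using has_vector_derivative_diff[OF dn_has_derivative[OF us that, of 1] p[OF that]] by (simp add: numeral_2_eq_2)
  have odev: "of_real (x\<^sup>2) * v2 x + (of_real (2*x) + s) * v1 x - W x * v x = 0" if "x \<in> {0..1}" for x
    using Lu[OF that] ode[OF that] unfolding Lop_eq[OF us that] v_def v1_def v2_def by (simp add: algebra_simps)
  have vu: "v x = u x" if "x \<in> {0..1}" "x < d" for x using z0[of x] that by (simp add: v_def)
  have vs: "smooth01 v" and v_hder: "\<And>x n. x \<in> {0<..1} \<Longrightarrow> dn n v x = hder W s v v1 n x"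
    and v_near: "\<And>x n. x \<in> {0..1} \<Longrightarrow> x < d \<Longrightarrow> dn n v x = dn n u x"
    by (rule homogeneous_solution_smooth[OF Ws us d(1), where q=v2 and p=v1]; use vu dv dv1 odev in blast)+
  have dn1v: "dn 1 v x = v1 x" if "x \<in> {0..1}" for x
    using vector_derivative_within[OF at_within_unit_interval_nontrivial[OF that] dv[OF that]] by (simp add: dn.simps(2))
  have dn2v: "dn 2 v x = v2 x" if x: "x \<in> {0..1}" for x
  proof -
    have "(dn 1 v has_vector_derivative v2 x) (at x within {0..1})"
      by (rule has_vector_derivative_transform[OF x dn1v dv1[OF x]])
    from vector_derivative_within[OF at_within_unit_interval_nontrivial[OF x] this]
    show ?thesis by (simp add: dn.simps(2) numeral_2_eq_2)
  qed
  have Lv: "Lop W s v x = 0" if "x \<in> {0..1}" for x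
    unfolding Lop_eq[OF vs that] dn1v[OF that] dn2v[OF that] using odev[OF that] .
  \<comment> \<open>Here \<open>A\<close> may depend on \<open>u\<close> and \<open>s\<close>: it
    serves only to place \<open>v'\<close> in the energy space and does not enter the final
    estimate.\<close>
  have "\<exists>A\<ge>0. \<forall>n. \<forall>x\<in>{d..1}. norm (dn n v x) \<le> A * (1 / \<tau>) ^ n * (fact n)\<^sup>2"
  proof (rule recursion_gevrey_bound[OF d(1) \<tau> less_imp_le[OF C(1)], where w="\<lambda>n. dn n W" and s=s])
    show "continuous_on {d..1} (dn n v)" for n
      by (rule continuous_on_subset[OF dn_continuous[OF vs]]) (use d in auto)
    show "norm (dn n W x) \<le> C * (1 / \<tau>) ^ n * (fact n)\<^sup>2" if "x \<in> {d..1}" for n x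
      using C(2) that d by auto
    fix n x assume "x \<in> {d..1}"
    then have "x \<in> {0<..1}" using d by auto
    note eq = v_hder[OF this]
    show "dn (Suc (Suc n)) v x = inverse (x\<^sup>2) *\<^sub>R
       ((\<Sum>j\<le>n. of_nat (n choose j) * (dn j W x * dn (n - j) v x)) -
        (of_real (2 * real (n + 1) * x) + s) * dn (Suc n) v x - of_nat (n * (n + 1)) * dn n v x)"
      unfolding eq by (rule hder.simps)
  qed
  then obtain A where A: "\<And>n x. x \<in> {d..1} \<Longrightarrow> norm (dn n v x) \<le> A * (1 / \<tau>) ^ n * (fact n)\<^sup>2" by blast
  \<comment> \<open>Glueing at \<open>d\<close>: below it the derivatives are those of
    \<open>u\<close>, beyond it the Gevrey bound of radius \<open>\<tau> > \<sigma>\<close> is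
    summable.\<close>
  have v'E: "dn 1 v \<in> Esp 1 \<sigma>"
  proof (rule Esp_dominated[OF _ \<sigma> uX(1) smooth01_dn[OF vs]])
    fix n and x :: real assume x: "x \<in> {0..1}"
    show "(norm (dn n (dn 1 v) x))\<^sup>2 \<le> (norm (dn n (dn 1 u) x))\<^sup>2 + (A * (1 / \<tau>) ^ Suc n * (fact (Suc n))\<^sup>2)\<^sup>2"
    proof (cases "x < d")
      case True then show ?thesis using v_near[OF x] by (simp add: dn_dn)
    next
      case False
      then have "norm (dn (Suc n) v x) \<le> A * (1 / \<tau>) ^ Suc n * (fact (Suc n))\<^sup>2"
        using A[of x "Suc n"] x by auto
      from power_mono[OF this, of 2] show ?thesis by (simp add: dn_dn add_increasing del: fact_Suc)
    qed
  qed simp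
  \<comment> \<open>Subtracting \<open>v 1\<close> times \<open>1 + w\<close> makes the value at 1
    vanish, as \<open>w 1 = 0\<close>. The constant disappears in the derivative, so
    \<open>h\<close> lies in X.\<close>
  define h where "h x = (v x - v 1) - v 1 * w x" for x
  note s1 = smooth01_diff[OF vs smooth01_const[of "v 1"]] and s2 = smooth01_cmult[OF ws, of "v 1"]
  have hs: "smooth01 h" unfolding h_def by (rule smooth01_diff[OF s1 s2])
  have dnh: "dn n h x = dn n v x - v 1 * dn n w x" if "x \<in> {0..1}" "n > 0" for n x
    unfolding h_def
    using that dn_diff[OF s1 s2] dn_diff[OF vs smooth01_const[of "v 1"]] dn_cmult[OF ws] dn_const[of x n "v 1"] by simp
  have hX: "h \<in> Xsp \<sigma>"
  proof -
    have "dn 1 h \<in> Esp 1 \<sigma>"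
    proof (rule Esp_cong(1)[OF _ \<sigma>(1)])
      show "(\<lambda>x. dn 1 v x - v 1 * dn 1 w x) \<in> Esp 1 \<sigma>"
        using \<sigma> by (intro Esp_diff Esp_cmult v'E wX) auto
    qed (use dnh in auto)
    then show ?thesis using hs wX by (simp add: Xsp_iff[OF \<sigma>(1)] h_def)
  qed
  have Lh: "Lop W s h x = 0" if x: "x \<in> {0..1}" for x
  proof -
    \<comment> \<open>The term \<open>- W x\<close> in the bracket is the image of the constant 1,
      so the choice of \<open>w\<close> makes the bracket zero.\<close>
    have "Lop W s h x = Lop W s v x - v 1 * (Lop W s w x - W x)"
      unfolding Lop_eq[OF hs x] Lop_eq[OF vs x] Lop_eq[OF ws x] dnh[OF x zero_less_one] dnh[OF x zero_less_numeral]
      by (simp add: h_def algebra_simps)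
    then show ?thesis using Lv[OF x] Lw[OF x] by simp
  qed
  have hD: "h \<in> Dom W \<sigma> s" by (rule DomI[OF \<sigma>(1) hX Esp_zero[OF order_refl \<sigma>(1)]]) (use Lh in auto)
  have L0: "Lop W s (\<lambda>x. 0) x = 0" if "x \<in> {0..1}" for x
    using Lop_cmult[OF smooth01_const[of 0] that, of W s 0] by simp
  have "(\<lambda>x. 0) \<in> Dom W \<sigma> s"
    by (rule DomI[OF \<sigma>(1) Xsp_zero[OF \<sigma>(1)] Esp_zero[OF order_refl \<sigma>(1)]]) (use L0 in auto)
  then have h0: "h x = 0" if "x \<in> {0..1}" for x
    using inv hD Lh L0 that unfolding Linvertible_def by metis
  have dnh0: "dn n h x = 0" if "n > 0" for n
    using smooth01_cong(2)[OF smooth01_const[of 0], of h x n] dn_const[OF x, of n 0] h0 x that by auto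
  have v1z: "v 1 = - z 1" using uX(2) by (simp add: v_def)
  show "u x = z x - z 1 * (1 + w x)"
    using h0[OF x] v1z by (simp add: h_def v_def algebra_simps)
  have "dn 1 u x - p x = - (z 1 * dn 1 w x)"
    using dnh[OF x, of 1] dnh0[of 1] dn1v[OF x] v1z by (simp add: v1_def eq_neg_iff_add_eq_0)
  then show "dn 1 u x = p x - z 1 * dn 1 w x" by (simp add: algebra_simps)
  have "dn 2 u x - q x = - (z 1 * dn 2 w x)"
    using dnh[OF x, of 2] dnh0[of 2] dn2v[OF x] v1z by (simp add: v2_def eq_neg_iff_add_eq_0)
  then show "dn 2 u x = q x - z 1 * dn 2 w x" by (simp add: algebra_simps)
qed

text \<open>The inverse appears through its values, as solutions \<open>u\<close> in the domain;
  these exist and are unique on the interval because invertibility throughout \<open>U\<close> is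
  part of the conclusion.\<close>

theorem mainTheorem16:
  fixes W :: "real \<Rightarrow> complex" and \<sigma> \<sigma>s \<delta> :: real and s0 :: complex
  assumes "gevrey \<sigma>s 2 W"
    and "0 < \<sigma>" and "\<sigma> < \<sigma>s"
    and "s0 \<in> Omega \<sigma>"
    and "Linvertible W \<sigma> s0"
    and "\<delta> > 0"
  shows "\<exists>U. open U \<and> s0 \<in> U \<and> U \<subseteq> Omega \<sigma> \<and>
           (\<forall>s\<in>U. Linvertible W \<sigma> s) \<and>
           (\<exists>C. \<forall>f\<in>Ysp \<sigma>. (\<forall>x\<in>{0..<\<delta>}. f x = 0) \<longrightarrow>
              (\<forall>s\<in>U. \<forall>u\<in>Dom W \<sigma> s. (\<forall>x\<in>{0..1}. Lop W s u x = f x) \<longrightarrow>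
                 H2norm u \<le> C * L2norm f))"
proof -
  note \<sigma> = assms(2)
  obtain K where K: "K \<ge> 0" and bound: "\<And>u. u \<in> Dom W \<sigma> s0 \<Longrightarrow> Xnorm \<sigma> u \<le> K * Enorm 0 \<sigma> (Lop W s0 u)"
    using Linvertible_bounded[OF \<sigma> assms(5)] by blast
  \<comment> \<open>The radius times \<open>K\<close> is at most 1/2, the threshold of the
    perturbation argument; adding 1 covers \<open>K = 0\<close>.\<close>
  define U where "U = ball s0 (1 / (2 * (K + 1))) \<inter> Omega \<sigma>"
  have near: "norm (s - s0) \<le> 1 / (2 * (K + 1))" "K * norm (s - s0) \<le> 1 / 2" if "s \<in> U" for s
  proof -
    show le: "norm (s - s0) \<le> 1 / (2 * (K + 1))" using that by (simp add: U_def dist_norm norm_minus_commute)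
    have "K * norm (s - s0) \<le> K * (1 / (2 * (K + 1)))" using K le by (intro mult_left_mono)
    also have "\<dots> \<le> 1 / 2" using K by (simp add: field_simps)
    finally show "K * norm (s - s0) \<le> 1 / 2" .
  qed
  have pert: "Linvertible W \<sigma> s" "\<And>u. u \<in> Dom W \<sigma> s \<Longrightarrow> Xnorm \<sigma> u \<le> 2 * K * Enorm 0 \<sigma> (Lop W s u)"
    if "s \<in> U" for s
    using Linvertible_perturb[OF \<sigma> assms(5) K _ near(2)[OF that]] bound by blast+
  have WE: "W \<in> Esp 0 \<sigma>" using gevrey_in_Ysp[OF assms(1-3)] Ysp_eq[OF \<sigma>] by simp
  have Wc: "continuous_on {0..1} W" using assms(1) by (intro smooth01_continuous) (simp add: gevrey_def)
  obtain Wb where Wb: "Wb > 0" "\<And>x. x \<in> {0..1} \<Longrightarrow> norm (W x) \<le> Wb"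
  proof -
    have "\<sigma>s > 0" using assms by simp
    from gevrey_bound[OF assms(1) this] obtain C where
      "C > 0" "\<And>n x. x \<in> {0..1} \<Longrightarrow> norm (dn n W x) \<le> C * (1 / \<sigma>s) ^ n * (fact n)\<^sup>2" by blast
    from this(1) this(2)[of _ 0] show thesis by (intro that) auto
  qed
  \<comment> \<open>Strictly below \<open>\<delta>\<close>, so that \<open>f\<close> vanishes on the
    closed interval \<open>{0..d}\<close>, and strictly below 1.\<close>
  define d where "d = min \<delta> 1 / 2"
  have d: "0 < d" "d < 1" "d < \<delta>" using assms(6) by (auto simp: d_def min_def)
  \<comment> \<open>A bound for \<open>norm s\<close> valid on all of \<open>U\<close>; it makes the
    constants of the initial value problem independent of \<open>s\<close>.\<close>
  define R where "R = norm s0 + 1 / (2 * (K + 1))"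
  define C1 where "C1 = 2 / d\<^sup>2 * exp (2 * (1 + (2 + R + Wb) / d\<^sup>2))"
  \<comment> \<open>A bound for \<open>w\<close>, \<open>w'\<close> and \<open>w''\<close> on all of
    \<open>U\<close>: the perturbed inverse has norm at most \<open>2 * K\<close>, and its argument
    is the fixed function \<open>W\<close>.\<close>
  define D where "D = (sob \<sigma> 0 + sob \<sigma> 1) * (2 * K * Enorm 0 \<sigma> W)"
  \<comment> \<open>A common majorant for the three orders; \<open>2 + D\<close> arises from
    \<open>z x - z 1 * (1 + w x)\<close>, and the last summand from the bound on
    \<open>q\<close>.\<close>
  define P where "P = C1 * (2 + D) + (2 + R + Wb) * C1 / d\<^sup>2"
  have R: "R \<ge> 0" unfolding R_def using K by simp
  have sob: "sob \<sigma> n \<ge> 0" for n by (rule sob_nonneg[OF order_refl \<sigma>])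
  have C1: "C1 \<ge> 0" and D: "D \<ge> 0" unfolding C1_def D_def using sob K Enorm_nonneg[OF order_refl \<sigma> WE] by simp_all
  have P: "P \<ge> C1 * (2 + D)" "P \<ge> C1 * (1 + D)" "P \<ge> C1 * D + (2 + R + Wb) * C1 / d\<^sup>2" "P \<ge> 0"
    unfolding P_def using C1 D R Wb by (auto simp: algebra_simps)
  have "H2norm u \<le> sqrt (4 * P\<^sup>2 + 2 / (d\<^sup>2)\<^sup>2) * L2norm f"
    if f: "f \<in> Ysp \<sigma>" and f0: "\<forall>x\<in>{0..<\<delta>}. f x = 0" and s: "s \<in> U" and u: "u \<in> Dom W \<sigma> s"
      and Lu: "\<forall>x\<in>{0..1}. Lop W s u x = f x" for f s u
  proof -
    have fc: "continuous_on {0..1} f" using f by (intro smooth01_continuous) (simp add: Ysp_def)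
    have sR: "norm s \<le> R"
      unfolding R_def using near(1)[OF s] norm_triangle_ineq[of s0 "s - s0"] by simp
    have fd: "f x = 0" if "x \<in> {0..d}" for x using f0 that d by auto
    let ?N = "L2norm f"
    have I: "integral {0..1} (\<lambda>t. norm (f t)) \<le> ?N"
      unfolding L2norm_def by (intro integral_le_sqrt_integral_square continuous_intros fc)
    have N: "?N \<ge> 0"
      using I integral_nonneg[of "\<lambda>t. norm (f t)" "{0..1}"] integrable_continuous_real[of 0 1 "\<lambda>t. norm (f t)"] fc
      by (fastforce intro!: continuous_intros)
    obtain z p q where zpq: "\<forall>x\<in>{0..1}. (z has_vector_derivative p x) (at x within {0..1}) \<and>
        (p has_vector_derivative q x) (at x within {0..1}) \<and>
        of_real (x\<^sup>2) * q x + (of_real (2*x) + s) * p x - W x * z x = f x \<and>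
        norm (z x) \<le> C1 * integral {0..1} (\<lambda>t. norm (f t)) \<and>
        norm (p x) \<le> C1 * integral {0..1} (\<lambda>t. norm (f t)) \<and>
        norm (q x) \<le> (norm (f x) + (2 + R) * norm (p x) + Wb * norm (z x)) / d\<^sup>2"
      and z0: "\<forall>x\<in>{0..d}. z x = 0"
      using cutoff_ode_solution[OF Wc Wb(2) fc d(1,2) fd sR] unfolding C1_def by blast
    have CI: "C1 * integral {0..1} (\<lambda>t. norm (f t)) \<le> C1 * ?N" using I C1 by (intro mult_left_mono)
    have zb: "norm (z x) \<le> C1 * ?N" and pb: "norm (p x) \<le> C1 * ?N" if "x \<in> {0..1}" for x
      using zpq that CI order_trans by blast+
    have qb: "norm (q x) \<le> norm (f x) / d\<^sup>2 + (2 + R + Wb) * C1 / d\<^sup>2 * ?N" if x: "x \<in> {0..1}" for x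
    proof -
      have "norm (q x) \<le> (norm (f x) + (2 + R) * norm (p x) + Wb * norm (z x)) / d\<^sup>2" using zpq x by blast
      also have "\<dots> \<le> (norm (f x) + (2 + R) * (C1 * ?N) + Wb * (C1 * ?N)) / d\<^sup>2"
        using R Wb zb[OF x] pb[OF x] by (intro divide_right_mono add_mono mult_left_mono) auto
      also have "\<dots> = norm (f x) / d\<^sup>2 + (2 + R + Wb) * C1 / d\<^sup>2 * ?N"
        by (simp add: add_divide_distrib[symmetric]) (simp add: algebra_simps)
      finally show ?thesis .
    qed
    obtain w where w: "w \<in> Dom W \<sigma> s" and Lw: "\<forall>x\<in>{0..1}. Lop W s w x = W x"
      using pert(1)[OF s] gevrey_in_Ysp[OF assms(1-3)] unfolding Linvertible_def by blast
    have "Xnorm \<sigma> w \<le> 2 * K * Enorm 0 \<sigma> W"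
      using pert(2)[OF s w] Esp_cong(2)[OF order_refl \<sigma> WE, of "Lop W s w"] Lw by simp
    then have wb: "norm (dn k w x) \<le> D" if "x \<in> {0..1}" "k \<in> {0,1,2}" for k x
    proof -
      have "norm (dn k w x) \<le> sob \<sigma> (k - 1) * Xnorm \<sigma> w"
        by (rule norm_dn_le_Xnorm[OF \<sigma> Dom_X[OF \<sigma> w] that(1)])
      also have "\<dots> \<le> (sob \<sigma> 0 + sob \<sigma> 1) * (2 * K * Enorm 0 \<sigma> W)"
        using that(2) sob[of 0] sob[of 1] \<open>Xnorm \<sigma> w \<le> _\<close> Xnorm_nonneg[OF \<sigma> Dom_X[OF \<sigma> w]]
        by (intro mult_mono) auto
      finally show ?thesis by (simp add: D_def)
    qed
    have dec: "u x = z x - z 1 * (1 + w x)" "dn 1 u x = p x - z 1 * dn 1 w x" "dn 2 u x = q x - z 1 * dn 2 w x"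
      if "x \<in> {0..1}" for x
      using solution_decomposition[OF assms(1-3) pert(1)[OF s] d(1,2) u _ w _ _ _ _ _ that, of f z p q] Lu Lw zpq z0
      by auto
    have zw: "norm (z 1 * g) \<le> C1 * ?N * r" if "norm g \<le> r" for g r
      unfolding norm_mult using zb[of 1] that C1 N by (intro mult_mono) auto
    show ?thesis
    proof (rule H2norm_le[OF Dom_smooth[OF \<sigma> u] fc P(4)])
      show "0 < d\<^sup>2" using d by simp
      fix x :: real assume x: "x \<in> {0..1}"
      have "norm (1 + w x) \<le> 1 + D" using norm_triangle_ineq[of 1 "w x"] wb[OF x, of 0] by simp
      then have "norm (u x) \<le> C1 * ?N + C1 * ?N * (1 + D)"
        unfolding dec(1)[OF x] using zb[OF x] zw[of "1 + w x" "1 + D"] norm_triangle_ineq4[of "z x" "z 1 * (1 + w x)"] by linarith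
      also have "\<dots> = C1 * (2 + D) * ?N" by (simp add: algebra_simps)
      also have "\<dots> \<le> P * ?N" using P N by (intro mult_right_mono)
      finally show "norm (u x) \<le> P * ?N" .
      have "norm (dn 1 u x) \<le> C1 * ?N + C1 * ?N * D"
        unfolding dec(2)[OF x] using pb[OF x] zw[OF wb[OF x, of 1]] norm_triangle_ineq4[of "p x" "z 1 * dn 1 w x"] by simp
      also have "\<dots> = C1 * (1 + D) * ?N" by (simp add: algebra_simps)
      also have "\<dots> \<le> P * ?N" using P N by (intro mult_right_mono)
      finally show "norm (dn 1 u x) \<le> P * ?N" .
      have "norm (dn 2 u x) \<le> norm (f x) / d\<^sup>2 + (2 + R + Wb) * C1 / d\<^sup>2 * ?N + C1 * ?N * D"
        unfolding dec(3)[OF x] using qb[OF x] zw[OF wb[OF x, of 2]] norm_triangle_ineq4[of "q x" "z 1 * dn 2 w x"] by simp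
      also have "\<dots> = norm (f x) / d\<^sup>2 + (C1 * D + (2 + R + Wb) * C1 / d\<^sup>2) * ?N" by (simp add: algebra_simps)
      also have "\<dots> \<le> norm (f x) / d\<^sup>2 + P * ?N" using P N by (intro add_left_mono mult_right_mono)
      finally show "norm (dn 2 u x) \<le> norm (f x) / d\<^sup>2 + P * ?N" .
    qed
  qed
  then have "\<exists>C. \<forall>f\<in>Ysp \<sigma>. (\<forall>x\<in>{0..<\<delta>}. f x = 0) \<longrightarrow>
              (\<forall>s\<in>U. \<forall>u\<in>Dom W \<sigma> s. (\<forall>x\<in>{0..1}. Lop W s u x = f x) \<longrightarrow> H2norm u \<le> C * L2norm f)"
    by blast
  moreover have "open U" "s0 \<in> U" "U \<subseteq> Omega \<sigma>"
    unfolding U_def using open_Omega[OF \<sigma>] assms(4) K by auto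
  ultimately show ?thesis using pert(1) by blast
qed

end
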